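(* Let $n\ge 2$, and suppose either $n=2$ and $p\geq 2$, or $n\geq 3$ and $p\geq\frac{2n}{n-1}$. Let $u \in W^{1,p}(\mathbb{H}^n)$, and let $u^\sharp_g$ and $u^\sharp_e$ be as defined in the context. Then \[ \int_{\mathbb{B}^n}|\nabla_g u^\sharp_g|_g^p\,dV - \left(\frac{n-1}{p}\right)^p\int_{\mathbb{B}^n}|u^\sharp_g|^p\,dV \geq \int_{\mathbb{R}^n}|\nabla u^\sharp_e|^p\,dx. \]
   Context: $\mathbb{H}^n$ is the Poincaré ball model: the unit ball $\mathbb{B}^n\subset\mathbb{R}^n$ with metric $g(x)=\frac{4}{(1-|x|^2)^2}\sum_i dx_i^2$, volume element $dV=\left(\frac{2}{1-|x|^2}\right)^n dx$, $V(E)=\int_E dV$, hyperbolic gradient $\nabla_g=\left(\frac{1-|x|^2}{2}\right)^2\nabla$ and $|\nabla_g u|_g=\sqrt{g(\nabla_g u,\nabla_g u)}=\frac{1-|x|^2}{2}|\nabla u|$. $W^{1,p}(\mathbb{H}^n)$ is the completion of $C_0^\infty(\mathbb{B}^n)$ under the norm $\left(\int|\nabla_g u|_g^p dV+\int|u|^p dV\right)^{1/p}$. For $u$ with $V(\{|u|>t\})<\infty$ for all $t>0$, let $\mu_u(t)=V(\{x:|u(x)|>t\})$ and define the decreasing rearrangement $u^*(t)=\sup\{s>0:\mu_u(s)>t\}$ on $(0,\infty)$. Let $\rho(x)=\ln\frac{1+|x|}{1-|x|}$ be the hyperbolic distance from $x$ to $0$, $B_g(0,r)$ the open geodesic ball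 of radius $r$ centered at $0$ (so $V(B_g(0,r)) = n\sigma_n\int_0^r(\sinh t)^{n-1}dt$), and $\sigma_n$ the volume of the Euclidean unit ball. Define $u^\sharp_g(x)=u^*(V(B_g(0,\rho(x))))$ for $x\in\mathbb{B}^n$ and $u^\sharp_e(x)=u^*(\sigma_n|x|^n)$ for $x\in\mathbb{R}^n$. *)

theory Defs
  imports "HOL-Analysis.Analysis"
begin

definition partial_deriv :: "'n::finite \<Rightarrow> (real^'n \<Rightarrow> real) \<Rightarrow> real^'n \<Rightarrow> real" where
  "partial_deriv i f x = frechet_derivative f (at x) (axis i 1)"

fun iter_partial :: "'n::finite list \<Rightarrow> (real^'n \<Rightarrow> real) \<Rightarrow> real^'n \<Rightarrow> real" where
  "iter_partial [] f = f"
| "iter_partial (i # is) f = partial_deriv i (iter_partial is f)"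

definition smooth_fun :: "(real^'n::finite \<Rightarrow> real) \<Rightarrow> bool" where
  "smooth_fun f \<longleftrightarrow> (\<forall>is. (\<forall>x. iter_partial is f differentiable (at x))
                            \<and> continuous_on UNIV (iter_partial is f))"

definition egrad :: "(real^'n::finite \<Rightarrow> real) \<Rightarrow> real^'n \<Rightarrow> real^'n" where
  "egrad f x = (\<chi> i. partial_deriv i f x)"

definition test_fun :: "(real^'n::finite) set \<Rightarrow> (real^'n \<Rightarrow> real) \<Rightarrow> bool" where
  "test_fun U f \<longleftrightarrow> smooth_fun f \<and> compact (closure {x. f x \<noteq> 0})
                     \<and> closure {x. f x \<noteq> 0} \<subseteq> U"

definition weak_grad :: "(real^'n::finite) set \<Rightarrow> (real^'n \<Rightarrow> real) \<Rightarrow> (real^'n \<Rightarrow> real^'n) \<Rightarrow> bool" where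
  "weak_grad U f G \<longleftrightarrow>
     (\<forall>K. compact K \<and> K \<subseteq> U \<longrightarrow>
        set_integrable lebesgue K f \<and> (\<forall>i. set_integrable lebesgue K (\<lambda>x. G x $ i))) \<and>
     (\<forall>\<phi> i. test_fun U \<phi> \<longrightarrow>
        (\<integral>x. f x * partial_deriv i \<phi> x \<partial>lebesgue) = - (\<integral>x. G x $ i * \<phi> x \<partial>lebesgue))"

definition hyp_weight :: "real^'n::finite \<Rightarrow> real" where
  "hyp_weight x = (2 / (1 - (norm x)\<^sup>2)) ^ CARD('n)"

definition hypV :: "(real^'n::finite) measure" where
  "hypV = density (lebesgue_on (ball 0 1)) (\<lambda>x. ennreal (hyp_weight x))"

text \<open>|grad_g u|_g in terms of the Euclidean gradient vector G.\<close>
definition hyp_norm :: "real^'n::finite \<Rightarrow> real^'n \<Rightarrow> real" where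
  "hyp_norm x G = (1 - (norm x)\<^sup>2) / 2 * norm G"

text \<open>W^{1,p}(H^n): completion of C_0^infinity(B^n) under the norm
  (int |grad_g u|_g^p dV + int |u|^p dV)^(1/p), realised concretely: u (with gradient G)
  is the limit in this norm of a sequence of test functions.\<close>
definition W1p_hyp :: "real \<Rightarrow> (real^'n::finite \<Rightarrow> real) set" where
  "W1p_hyp p = {u. \<exists>G \<phi>.
       u \<in> borel_measurable hypV \<and> G \<in> borel_measurable hypV \<and>
       (\<integral>\<^sup>+ x. ennreal (\<bar>u x\<bar> powr p) \<partial>hypV) < \<infinity> \<and>
       (\<integral>\<^sup>+ x. ennreal (hyp_norm x (G x) powr p) \<partial>hypV) < \<infinity> \<and>
       (\<forall>k. test_fun (ball 0 1) (\<phi> k)) \<and>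
       ((\<lambda>k. \<integral>\<^sup>+ x. ennreal (\<bar>\<phi> k x - u x\<bar> powr p) \<partial>hypV) \<longlonglongrightarrow> 0) \<and>
       ((\<lambda>k. \<integral>\<^sup>+ x. ennreal (hyp_norm x (egrad (\<phi> k) x - G x) powr p) \<partial>hypV) \<longlonglongrightarrow> 0)}"

definition distr_hyp :: "(real^'n::finite \<Rightarrow> real) \<Rightarrow> real \<Rightarrow> ennreal" where
  "distr_hyp u t = emeasure hypV {x \<in> space hypV. \<bar>u x\<bar> > t}"

text \<open>Decreasing rearrangement u^*(t) = sup {s > 0. mu_u(s) > t} (sup of the empty set := 0).\<close>
definition decr_rearr :: "(real^'n::finite \<Rightarrow> real) \<Rightarrow> real \<Rightarrow> real" where
  "decr_rearr u t = Sup (insert 0 {s. s > 0 \<and> distr_hyp u s > ennreal t})"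

definition hyp_dist0 :: "real^'n::finite \<Rightarrow> real" where
  "hyp_dist0 x = ln ((1 + norm x) / (1 - norm x))"

definition hyp_ball_vol :: "'n::finite itself \<Rightarrow> real \<Rightarrow> real" where
  "hyp_ball_vol _ r = measure (hypV :: (real^'n) measure) {x \<in> ball 0 1. hyp_dist0 x < r}"

definition hyp_sym_rearr :: "(real^'n::finite \<Rightarrow> real) \<Rightarrow> real^'n \<Rightarrow> real" where
  "hyp_sym_rearr u x = decr_rearr u (hyp_ball_vol TYPE('n) (hyp_dist0 x))"

definition unit_ball_vol :: "'n::finite itself \<Rightarrow> real" where
  "unit_ball_vol _ = measure lborel (ball (0::real^'n) 1)"

definition euc_sym_rearr :: "(real^'n::finite \<Rightarrow> real) \<Rightarrow> real^'n \<Rightarrow> real" where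
  "euc_sym_rearr u x = decr_rearr u (unit_ball_vol TYPE('n) * norm x ^ CARD('n))"

end

theory Submission
  imports Defs
begin

text \<open>
  Both symmetrizations are radial profiles of the same decreasing function \<open>f = u\<^sup>*\<close> of the volume. If
  \<open>-f\<close> has a derivative \<open>h\<close>, then in the volume coordinate \<open>s\<close> the Euclidean and hyperbolic energies
  are \<open>\<integral> (h s K s)\<^sup>p ds\<close>, where \<open>K\<close> is the perimeter of the Euclidean, respectively hyperbolic, ball of
  volume \<open>s\<close>. The assumption on \<open>p\<close> gives the pointwise comparison \<open>K\<^sub>e\<^sup>p + ((n - 1) s)\<^sup>p \<le> K\<^sub>g\<^sup>p\<close>, and
  Hardy's inequality bounds \<open>\<integral> f\<^sup>p\<close> by \<open>p\<^sup>p \<integral> (s h)\<^sup>p\<close>.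

  What remains is that \<open>f\<close> is absolutely continuous. A weak isoperimetric inequality suffices for this:
  perimeter at least a constant times \<open>V\<close> for large volumes (Cheeger, by integrating the divergence of the
  radial field), and at least a constant times \<open>V\<^bsup>1 - 1/n\<^esup>\<close> for small ones (comparing a function with
  its averages over balls whose radius is proportional to the conformal factor). Applied to truncations
  of a test function, it bounds the difference quotients of its rearrangement, weighted with the
  isoperimetric profile, in \<open>L\<^sup>p\<close> by its energy. By Fatou's lemma the bound passes to \<open>u\<close>; it makes the
  Stieltjes measure of \<open>f\<close> absolutely continuous and survives in its density \<open>h\<close>.
\<close>


section \<open>Hoelder and Hardy inequalities\<close>

lemma AE_eq_0_if_nn_integral_powr_eq_0:
  fixes f :: "'a \<Rightarrow> real"
  assumes "f \<in> borel_measurable M" "(\<integral>\<^sup>+x. ennreal (f x powr p) \<partial>M) = 0"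
  shows "AE x in M. f x = 0"
  using assms by (simp add: nn_integral_0_iff_AE ennreal_eq_0_iff antisym_conv[OF powr_ge_zero])

lemma Youngs_inequality_scaled:
  fixes x y :: real
  assumes conjugate: "p > 1" "q > 1" "1 / p + 1 / q = 1" and nonneg: "x \<ge> 0" "y \<ge> 0" and AB: "A > 0" "B > 0"
  shows "x * y \<le> (A powr (1 / p) * B powr (1 / q)) * (x powr p / (p * A) + y powr q / (q * B))"
proof -
  define a b where "a = A powr (1 / p)" and "b = B powr (1 / q)"
  have ab: "a > 0" "b > 0" "a powr p = A" "b powr q = B"
    using conjugate AB by (auto simp: a_def b_def powr_powr)
  have "(x / a) * (y / b) \<le> (x / a) powr p / p + (y / b) powr q / q"
    using conjugate nonneg ab by (intro Youngs_inequality) auto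
  also have "\<dots> = x powr p / (p * A) + y powr q / (q * B)"
    using nonneg ab by (simp add: powr_divide mult.commute)
  finally have "(a * b) * ((x / a) * (y / b)) \<le> (a * b) * (x powr p / (p * A) + y powr q / (q * B))"
    using ab by (intro mult_left_mono) auto
  thus ?thesis using ab by (simp add: field_simps a_def b_def)
qed

lemma nn_integral_Holder:
  fixes f g :: "'a \<Rightarrow> real"
  assumes conjugate: "p > 1" "q > 1" "1 / p + 1 / q = 1"
    and [measurable]: "f \<in> borel_measurable M" "g \<in> borel_measurable M"
    and nonneg: "\<And>x. x \<in> space M \<Longrightarrow> f x \<ge> 0" "\<And>x. x \<in> space M \<Longrightarrow> g x \<ge> 0"
    and f_bound: "(\<integral>\<^sup>+x. ennreal (f x powr p) \<partial>M) \<le> ennreal A" "A \<ge> 0"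
    and g_bound: "(\<integral>\<^sup>+x. ennreal (g x powr q) \<partial>M) \<le> ennreal B" "B \<ge> 0"
  shows "(\<integral>\<^sup>+x. ennreal (f x * g x) \<partial>M) \<le> ennreal (A powr (1 / p) * B powr (1 / q))"
proof (cases "A = 0 \<or> B = 0")
  case True
  hence "(AE x in M. f x = 0) \<or> (AE x in M. g x = 0)"
    using f_bound(1) g_bound(1) by (auto intro!: AE_eq_0_if_nn_integral_powr_eq_0)
  hence "AE x in M. ennreal (f x * g x) = 0"
    by (auto elim: eventually_mono)
  hence "(\<integral>\<^sup>+x. ennreal (f x * g x) \<partial>M) = 0"
    by (subst nn_integral_0_iff_AE) auto
  thus ?thesis by simp
next
  case False
  define a b where "a = A powr (1 / p)" and "b = B powr (1 / q)"
  have AB: "A > 0" "B > 0" using False f_bound(2) g_bound(2) by auto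
  hence ab: "a > 0" "b > 0" by (auto simp: a_def b_def)
  have Young: "f x * g x \<le> (a * b) * (f x powr p / (p * A) + g x powr q / (q * B))" if "x \<in> space M" for x
    unfolding a_def b_def by (rule Youngs_inequality_scaled[OF conjugate nonneg[OF that] AB])
  have "(\<integral>\<^sup>+x. ennreal (f x * g x) \<partial>M)
      \<le> (\<integral>\<^sup>+x. ennreal (a * b) * (ennreal (1 / (p * A)) * ennreal (f x powr p)
            + ennreal (1 / (q * B)) * ennreal (g x powr q)) \<partial>M)"
    using Young conjugate ab AB
    by (intro nn_integral_mono) (auto simp flip: ennreal_mult'' ennreal_plus intro!: ennreal_leI)
  also have "\<dots> = ennreal (a * b) * (ennreal (1 / (p * A)) * (\<integral>\<^sup>+x. ennreal (f x powr p) \<partial>M)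
            + ennreal (1 / (q * B)) * (\<integral>\<^sup>+x. ennreal (g x powr q) \<partial>M))"
    by (simp add: nn_integral_cmult nn_integral_add)
  also have "\<dots> \<le> ennreal (a * b) * (ennreal (1 / (p * A)) * ennreal A
            + ennreal (1 / (q * B)) * ennreal B)"
    using f_bound(1) g_bound(1) by (intro mult_left_mono add_mono) auto
  also have "\<dots> = ennreal (a * b * (1 / (p * A) * A + 1 / (q * B) * B))"
    using conjugate ab AB by (simp flip: ennreal_mult'' ennreal_plus)
  also have "1 / (p * A) * A + 1 / (q * B) * B = 1"
    using conjugate AB by simp
  finally show ?thesis by (simp add: a_def b_def)
qed

lemma nn_integral_powr_atLeast:
  assumes "e > 0" "s > 0"
  shows "(\<integral>\<^sup>+t. ennreal (t powr (- 1 - e)) * indicator {s..} t \<partial>lborel) = ennreal (s powr (- e) / e)"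
proof -
  have "(\<integral>\<^sup>+t. ennreal (t powr (- 1 - e)) * indicator {s..} t \<partial>lborel)
      = ennreal (0 - (- (s powr (- e) / e)))"
  proof (rule nn_integral_FTC_atLeast)
    fix t assume "s \<le> t"
    hence "t > 0" using assms by simp
    thus "((\<lambda>t. - (t powr (- e) / e)) has_real_derivative t powr (- 1 - e)) (at t)"
      using assms by (auto intro!: derivative_eq_intros simp: minus_diff_commute)
  next
    show "((\<lambda>t. - (t powr (- e) / e)) \<longlongrightarrow> 0) at_top"
      using assms by real_asymp
  qed auto
  thus ?thesis by simp
qed

lemma nn_integral_powr_greaterThanAtMost:
  assumes "e > 0" "t > 0"
  shows "(\<integral>\<^sup>+s. ennreal (s powr (e - 1)) * indicator {0<..t} s \<partial>lborel) = ennreal (t powr e / e)"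
proof -
  have "(\<integral>\<^sup>+s. ennreal (s powr (e - 1)) * indicator {0<..t} s \<partial>lborel)
      = (\<integral>\<^sup>+s. ennreal (s powr (e - 1)) * indicator {0..t} s \<partial>lborel)"
    by (intro nn_integral_cong) (auto simp: indicator_def)
  also have "\<dots> = ennreal (t powr e / e)"
    using has_integral_powr_from_0[of "e - 1" t] assms
    by (intro nn_integral_has_integral_lebesgue') auto
  finally show ?thesis .
qed

text \<open>The weight \<open>t powr (1 - 1/p\<^sup>2)\<close> is the one for which Hoelder loses nothing, so that the
  constant \<open>p powr p\<close> in Hardy's inequality is the sharp one.\<close>
lemma powr_tail_integral_le:
  fixes h :: "real \<Rightarrow> real"
  assumes p: "p > 1" and s: "s > 0"
    and [measurable]: "h \<in> borel_measurable borel" and h_nonneg: "\<And>t. h t \<ge> 0"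
    and y: "ennreal y \<le> (\<integral>\<^sup>+t. ennreal (h t) * indicator {s..} t \<partial>lborel)" "y \<ge> 0"
  shows "ennreal (y powr p) \<le> ennreal (p powr (p - 1) * s powr (1 / p - 1))
     * (\<integral>\<^sup>+t. ennreal ((t powr (1 - 1 / p\<^sup>2) * h t) powr p) * indicator {s..} t \<partial>lborel)"
    (is "_ \<le> ennreal (?c * _) * ?I")
proof (cases "?I = \<infinity>")
  case True
  thus ?thesis using p s by (simp add: ennreal_mult_top)
next
  case False
  then obtain A where A: "?I = ennreal A" "A \<ge> 0"
    by (cases ?I) auto
  define q where "q = p / (p - 1)"
  define \<alpha> where "\<alpha> = 1 - 1 / p\<^sup>2"
  have conjugate: "p > 1" "q > 1" "1 / p + 1 / q = 1"
    using p by (auto simp: q_def field_simps)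
  have \<alpha>q: "\<alpha> * q = 1 + 1 / p"
    using p by (simp add: \<alpha>_def q_def field_simps power2_eq_square)
  have "ennreal y \<le> (\<integral>\<^sup>+t. ennreal (h t) * indicator {s..} t \<partial>lborel)"
    by (rule y)
  also have "\<dots> = (\<integral>\<^sup>+t. ennreal ((t powr \<alpha> * h t * indicator {s..} t)
      * (t powr (- \<alpha>) * indicator {s..} t)) \<partial>lborel)"
    using s by (intro nn_integral_cong) (auto simp: indicator_def powr_minus field_simps)
  also have "\<dots> \<le> ennreal (A powr (1 / p) * (s powr (- (1 / p)) / (1 / p)) powr (1 / q))"
  proof (rule nn_integral_Holder[OF conjugate])
    have "(\<integral>\<^sup>+t. ennreal ((t powr \<alpha> * h t * indicator {s..} t) powr p) \<partial>lborel) = ?I"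
      using p by (intro nn_integral_cong) (auto simp: indicator_def \<alpha>_def)
    thus "(\<integral>\<^sup>+t. ennreal ((t powr \<alpha> * h t * indicator {s..} t) powr p) \<partial>lborel) \<le> ennreal A"
      by (simp add: A)
    have "(\<integral>\<^sup>+t. ennreal ((t powr (- \<alpha>) * indicator {s..} t) powr q) \<partial>lborel)
        = (\<integral>\<^sup>+t. ennreal (t powr (- 1 - 1 / p)) * indicator {s..} t \<partial>lborel)"
      using \<alpha>q conjugate by (intro nn_integral_cong) (auto simp: indicator_def powr_powr)
    thus "(\<integral>\<^sup>+t. ennreal ((t powr (- \<alpha>) * indicator {s..} t) powr q) \<partial>lborel)
        \<le> ennreal (s powr (- (1 / p)) / (1 / p))"
      using nn_integral_powr_atLeast[of "1 / p" s] p s by simp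
  qed (use h_nonneg p A in auto)
  finally have "y \<le> A powr (1 / p) * (p * s powr (- (1 / p))) powr (1 / q)"
    by (simp add: mult.commute[of _ p])
  hence "y powr p \<le> (A powr (1 / p) * (p * s powr (- (1 / p))) powr (1 / q)) powr p"
    using y(2) p by (intro powr_mono2) simp_all
  also have "\<dots> = A * (p powr (p / q) * s powr (- (1 / q)))"
    using p A by (simp add: powr_mult powr_powr)
  also have "p / q = p - 1" using p by (simp add: q_def)
  also have "- (1 / q) = 1 / p - 1" using conjugate(3) by linarith
  finally have "y powr p \<le> ?c * s powr (1 / p - 1) * A" by (simp add: mult_ac)
  thus ?thesis unfolding A(1) by (subst ennreal_mult''[symmetric]) (auto simp: A(2) intro!: ennreal_leI)
qed

lemma nn_integral_Hardy_weight:
  fixes y :: real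
  assumes p: "p > 1" and t: "t > 0" and y: "y \<ge> 0"
  shows "(\<integral>\<^sup>+s. ennreal (p powr (p - 1) * s powr (1 / p - 1)) * indicator {0<..t} s \<partial>lborel)
      * ennreal ((t powr (1 - 1 / p\<^sup>2) * y) powr p) = ennreal (p powr p) * ennreal ((t * y) powr p)"
proof -
  have "(\<integral>\<^sup>+s. ennreal (p powr (p - 1) * s powr (1 / p - 1)) * indicator {0<..t} s \<partial>lborel)
      = (\<integral>\<^sup>+s. ennreal (p powr (p - 1)) * (ennreal (s powr (1 / p - 1)) * indicator {0<..t} s) \<partial>lborel)"
    by (intro nn_integral_cong) (simp add: ennreal_mult' mult.assoc)
  also have "\<dots> = ennreal (p powr (p - 1)) * ennreal (t powr (1 / p) / (1 / p))"
    using p t nn_integral_powr_greaterThanAtMost[of "1 / p" t] by (subst nn_integral_cmult) auto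
  also have "\<dots> = ennreal (p powr p * t powr (1 / p))"
    using p by (simp add: powr_diff flip: ennreal_mult')
  finally have "(\<integral>\<^sup>+s. ennreal (p powr (p - 1) * s powr (1 / p - 1)) * indicator {0<..t} s \<partial>lborel)
      * ennreal ((t powr (1 - 1 / p\<^sup>2) * y) powr p)
      = ennreal (p powr p * (t powr (1 / p) * (t powr (1 - 1 / p\<^sup>2) * y) powr p))"
    by (simp add: mult.assoc flip: ennreal_mult')
  also have "t powr (1 / p) * (t powr (1 - 1 / p\<^sup>2) * y) powr p
      = t powr (1 / p + (1 - 1 / p\<^sup>2) * p) * y powr p"
    using t y by (simp add: powr_mult powr_powr powr_add)
  also have "1 / p + (1 - 1 / p\<^sup>2) * p = p"
    using p by (simp add: field_simps power2_eq_square)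
  finally show ?thesis using t y by (simp add: powr_mult ennreal_mult')
qed

lemma Hardy_inequality_tail:
  fixes f h :: "real \<Rightarrow> real"
  assumes p: "p > 1"
    and [measurable]: "f \<in> borel_measurable borel" "h \<in> borel_measurable borel"
    and h_nonneg: "\<And>t. h t \<ge> 0" and f_nonneg: "\<And>s. s > 0 \<Longrightarrow> f s \<ge> 0"
    and f_le_tail: "\<And>s. s > 0 \<Longrightarrow> ennreal (f s) \<le> (\<integral>\<^sup>+t. ennreal (h t) * indicator {s..} t \<partial>lborel)"
  shows "(\<integral>\<^sup>+s. ennreal (f s powr p) * indicator {0<..} s \<partial>lborel)
     \<le> ennreal (p powr p) * (\<integral>\<^sup>+t. ennreal ((t * h t) powr p) * indicator {0<..} t \<partial>lborel)"
proof -
  define W where "W t = (t powr (1 - 1 / p\<^sup>2) * h t) powr p" for t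
  define c where "c s = p powr (p - 1) * s powr (1 / p - 1)" for s
  have [measurable]: "W \<in> borel_measurable borel" "c \<in> borel_measurable borel"
    unfolding W_def c_def by measurable
  have inner_integral: "(\<integral>\<^sup>+s. ennreal (c s) * indicator {0<..} s
      * (ennreal (W t) * (if s \<le> t then 1 else 0)) \<partial>lborel)
      = ennreal (p powr p) * (ennreal ((t * h t) powr p) * indicator {0<..} t)" for t
  proof -
    have "(\<integral>\<^sup>+s. ennreal (c s) * indicator {0<..} s * (ennreal (W t) * (if s \<le> t then 1 else 0)) \<partial>lborel)
        = (\<integral>\<^sup>+s. (ennreal (c s) * indicator {0<..t} s) * ennreal (W t) \<partial>lborel)"
      by (intro nn_integral_cong) (auto simp: indicator_def)
    also have "\<dots> = (\<integral>\<^sup>+s. ennreal (c s) * indicator {0<..t} s \<partial>lborel) * ennreal (W t)"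
      by (rule nn_integral_multc) measurable
    finally show ?thesis
      using nn_integral_Hardy_weight[OF p _ h_nonneg] by (cases "t > 0") (simp_all add: c_def W_def)
  qed
  have "(\<integral>\<^sup>+s. ennreal (f s powr p) * indicator {0<..} s \<partial>lborel)
     \<le> (\<integral>\<^sup>+s. (\<integral>\<^sup>+t. ennreal (c s) * indicator {0<..} s * (ennreal (W t) * (if s \<le> t then 1 else 0)) \<partial>lborel) \<partial>lborel)"
  proof (rule nn_integral_mono)
    fix s :: real
    have "ennreal (f s powr p) \<le> ennreal (c s) * (\<integral>\<^sup>+t. ennreal (W t) * (if s \<le> t then 1 else 0) \<partial>lborel)"
      if "s > 0"
    proof -
      have "(\<integral>\<^sup>+t. ennreal (W t) * indicator {s..} t \<partial>lborel)
          = (\<integral>\<^sup>+t. ennreal (W t) * (if s \<le> t then 1 else 0) \<partial>lborel)"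
        by (intro nn_integral_cong) (auto simp: indicator_def)
      thus ?thesis
        using powr_tail_integral_le[OF p that _ h_nonneg f_le_tail[OF that] f_nonneg[OF that]]
        by (simp add: c_def W_def)
    qed
    thus "ennreal (f s powr p) * indicator {0<..} s
        \<le> (\<integral>\<^sup>+t. ennreal (c s) * indicator {0<..} s * (ennreal (W t) * (if s \<le> t then 1 else 0)) \<partial>lborel)"
      by (subst nn_integral_cmult) (auto simp: indicator_def)
  qed
  also have "\<dots> = (\<integral>\<^sup>+t. (\<integral>\<^sup>+s. ennreal (c s) * indicator {0<..} s
      * (ennreal (W t) * (if s \<le> t then 1 else 0)) \<partial>lborel) \<partial>lborel)"
    by (rule lborel_pair.Fubini') measurable
  also have "\<dots> = ennreal (p powr p) * (\<integral>\<^sup>+t. ennreal ((t * h t) powr p) * indicator {0<..} t \<partial>lborel)"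
    unfolding inner_integral by (rule nn_integral_cmult) simp
  finally show ?thesis .
qed

section \<open>Volume and perimeter of hyperbolic balls\<close>

text \<open>For a point at Euclidean distance \<open>r\<close> from the origin of the ball, the conformal factor and
  the hyperbolic sine and cosine of its hyperbolic distance to the origin.\<close>
definition conf :: "real \<Rightarrow> real" where "conf r = 2 / (1 - r\<^sup>2)"
definition hsinh :: "real \<Rightarrow> real" where "hsinh r = 2 * r / (1 - r\<^sup>2)"
definition hcosh :: "real \<Rightarrow> real" where "hcosh r = (1 + r\<^sup>2) / (1 - r\<^sup>2)"

text \<open>Hyperbolic volume of the ball of Euclidean radius \<open>r\<close>, divided by the volume of the Euclidean
  unit ball. The value for \<open>r \<ge> 1\<close> is irrelevant; it makes \<open>hvol n\<close> measurable on the whole line.\<close>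
definition hvol :: "nat \<Rightarrow> real \<Rightarrow> real" where
  "hvol n r = (if r < 1 then integral {0..r} (\<lambda>t. real n * hsinh t ^ (n - 1) * conf t) else 0)"

lemma one_minus_square_pos: "0 \<le> r \<Longrightarrow> r < 1 \<Longrightarrow> 0 < 1 - r\<^sup>2" for r :: real
  by (simp add: power_less_one_iff abs_square_less_1)

lemma powr_of_power: "0 \<le> y \<Longrightarrow> 0 < k \<Longrightarrow> (y ^ k) powr m = y powr (real k * m)" for y :: real
  by (simp flip: powr_realpow' add: powr_powr)

lemma conf_ge_2: "0 \<le> r \<Longrightarrow> r < 1 \<Longrightarrow> conf r \<ge> 2"
  using one_minus_square_pos[of r] by (simp add: conf_def field_simps)

lemma conf_pos: "0 \<le> r \<Longrightarrow> r < 1 \<Longrightarrow> conf r > 0"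
  using conf_ge_2[of r] by simp

lemma hsinh_nonneg: "0 \<le> r \<Longrightarrow> r < 1 \<Longrightarrow> hsinh r \<ge> 0"
  using one_minus_square_pos[of r] by (simp add: hsinh_def)

lemma hsinh_pos: "0 < r \<Longrightarrow> r < 1 \<Longrightarrow> hsinh r > 0"
  using one_minus_square_pos[of r] by (simp add: hsinh_def)

lemma hsinh_eq_conf_mult: "hsinh r = conf r * r"
  by (simp add: hsinh_def conf_def)

lemma hcosh_ge_1: "0 \<le> r \<Longrightarrow> r < 1 \<Longrightarrow> hcosh r \<ge> 1"
  using one_minus_square_pos[of r] by (simp add: hcosh_def field_simps)

lemma hcosh_square: "0 \<le> r \<Longrightarrow> r < 1 \<Longrightarrow> (hcosh r)\<^sup>2 = 1 + (hsinh r)\<^sup>2"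
  using one_minus_square_pos[of r] by (simp add: hcosh_def hsinh_def field_simps) algebra

lemma hsinh_le_hcosh: "0 \<le> r \<Longrightarrow> r < 1 \<Longrightarrow> hsinh r \<le> hcosh r"
  by (rule power2_le_imp_le) (use hcosh_square[of r] hcosh_ge_1[of r] in auto)

lemma hcosh_le_1_plus_hsinh:
  assumes "0 \<le> r" "r < 1"
  shows "hcosh r \<le> 1 + hsinh r"
proof (rule power2_le_imp_le)
  show "(hcosh r)\<^sup>2 \<le> (1 + hsinh r)\<^sup>2"
    using hsinh_nonneg[OF assms] by (simp add: hcosh_square[OF assms] power2_sum)
qed (use hsinh_nonneg[OF assms] in simp)

lemma DERIV_hsinh: "0 \<le> r \<Longrightarrow> r < 1 \<Longrightarrow> (hsinh has_real_derivative conf r * hcosh r) (at r)"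
  unfolding hsinh_def[abs_def] conf_def hcosh_def using one_minus_square_pos[of r]
  by (auto intro!: derivative_eq_intros simp: field_simps power2_eq_square)

lemma DERIV_hcosh: "0 \<le> r \<Longrightarrow> r < 1 \<Longrightarrow> (hcosh has_real_derivative conf r * hsinh r) (at r)"
  unfolding hcosh_def[abs_def] conf_def hsinh_def using one_minus_square_pos[of r]
  by (auto intro!: derivative_eq_intros simp: field_simps power2_eq_square)

lemma continuous_on_conf: "continuous_on {0..<1} conf"
  unfolding conf_def[abs_def] by (intro continuous_intros) (auto simp: power2_eq_1_iff)

lemma continuous_on_hsinh: "continuous_on {0..<1} hsinh"
  by (rule DERIV_continuous_on, rule has_field_derivative_at_within, rule DERIV_hsinh) auto

lemma continuous_on_hcosh: "continuous_on {0..<1} hcosh"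
  by (rule DERIV_continuous_on, rule has_field_derivative_at_within, rule DERIV_hcosh) auto

lemma continuous_on_hvol_density: "continuous_on {0..<1} (\<lambda>t. real n * hsinh t ^ (n - 1) * conf t)"
  by (intro continuous_intros continuous_on_conf continuous_on_hsinh)

lemma hvol_0 [simp]: "hvol n 0 = 0"
  by (simp add: hvol_def)

lemma has_integral_hvol:
  assumes "r < 1"
  shows "((\<lambda>t. real n * hsinh t ^ (n - 1) * conf t) has_integral hvol n r) {0..r}"
proof -
  have "continuous_on {0..r} (\<lambda>t. real n * hsinh t ^ (n - 1) * conf t)"
    by (rule continuous_on_subset[OF continuous_on_hvol_density]) (use assms in auto)
  hence "(\<lambda>t. real n * hsinh t ^ (n - 1) * conf t) integrable_on {0..r}"
    by (rule integrable_continuous_real)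
  thus ?thesis using assms unfolding hvol_def by (simp add: integrable_integral)
qed

lemma DERIV_hvol_within:
  assumes "0 \<le> r" "r < 1"
  shows "(hvol n has_real_derivative real n * hsinh r ^ (n - 1) * conf r) (at r within {0..<1})"
proof -
  define R where "R = (1 + r) / 2"
  have R: "r < R" "R < 1" using assms by (auto simp: R_def)
  have "continuous_on {0..R} (\<lambda>t. real n * hsinh t ^ (n - 1) * conf t)"
    by (rule continuous_on_subset[OF continuous_on_hvol_density]) (use R in auto)
  hence "((\<lambda>r. integral {0..r} (\<lambda>t. real n * hsinh t ^ (n - 1) * conf t))
      has_real_derivative real n * hsinh r ^ (n - 1) * conf r) (at r within {0..R})"
    using assms R by (intro integral_has_real_derivative) auto
  hence "(hvol n has_real_derivative real n * hsinh r ^ (n - 1) * conf r) (at r within {0..R})"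
    by (rule has_field_derivative_transform_within[of _ _ _ _ 1]) (use assms R in \<open>auto simp: hvol_def\<close>)
  moreover have "at r within {0..R} = at r within {0..<1}"
    by (rule at_within_nhd[of _ "{..<R}"]) (use R in auto)
  ultimately show ?thesis by simp
qed

lemma DERIV_hvol:
  assumes "0 < r" "r < 1"
  shows "(hvol n has_real_derivative real n * hsinh r ^ (n - 1) * conf r) (at r)"
  using DERIV_hvol_within[of r n] at_within_interior[of r "{0..<1}"] assms by simp

lemma continuous_on_hvol: "continuous_on {0..<1} (hvol n)"
  by (rule DERIV_continuous_on[OF DERIV_hvol_within]) auto

lemma hvol_borel_measurable [measurable]: "hvol n \<in> borel_measurable borel"
proof -
  have "(\<lambda>r. if r \<in> {0..<1} then hvol n r else 0) \<in> borel_measurable borel"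
    by (intro borel_measurable_continuous_on_if continuous_on_hvol) auto
  also have "(\<lambda>r. if r \<in> {0..<1} then hvol n r else 0) = hvol n"
    by (auto simp: fun_eq_iff hvol_def)
  finally show ?thesis .
qed

lemma nonneg_if_DERIV_nonneg:
  fixes F F' :: "real \<Rightarrow> real"
  assumes r: "0 \<le> r" "r < 1" and "F 0 = 0" and continuous: "continuous_on {0..<1} F"
    and DERIV: "\<And>x. 0 < x \<Longrightarrow> x < 1 \<Longrightarrow> (F has_real_derivative F' x) (at x)"
    and nonneg: "\<And>x. 0 < x \<Longrightarrow> x < 1 \<Longrightarrow> F' x \<ge> 0"
  shows "0 \<le> F r"
proof -
  have "F 0 \<le> F r"
  proof (rule DERIV_nonneg_imp_increasing_open[of 0 r F])
    show "continuous_on {0..r} F"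
      by (rule continuous_on_subset[OF continuous]) (use r in auto)
    show "\<exists>y. (F has_real_derivative y) (at x) \<and> 0 \<le> y" if "0 < x" "x < r" for x
      using that r by (intro exI[of _ "F' x"] conjI DERIV nonneg) auto
  qed (rule r)
  thus ?thesis using \<open>F 0 = 0\<close> by simp
qed

lemma hvol_ge:
  assumes "0 \<le> r" "r < 1" "n > 0"
  shows "hsinh r ^ n / hcosh r \<le> hvol n r"
proof -
  define F where "F r = hvol n r - hsinh r ^ n / hcosh r" for r
  have "0 \<le> F r"
  proof (rule nonneg_if_DERIV_nonneg[OF assms(1,2)])
    show "F 0 = 0" using assms(3) by (simp add: F_def hsinh_def power_0_left)
    show "continuous_on {0..<1} F"
      unfolding F_def
      by (intro continuous_intros continuous_on_hvol continuous_on_hsinh continuous_on_hcosh)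
        (use hcosh_ge_1 in force)
  next
    fix x :: real assume x: "0 < x" "x < 1"
    have hcosh_ne_0: "hcosh x \<noteq> 0" using hcosh_ge_1[of x] x by auto
    have "(F has_real_derivative real n * hsinh x ^ (n - 1) * conf x -
       ((real n * hsinh x ^ (n - 1) * (conf x * hcosh x)) * hcosh x - hsinh x ^ n * (conf x * hsinh x))
         / (hcosh x * hcosh x)) (at x)"
      unfolding F_def[abs_def] using x hcosh_ne_0
      by (auto intro!: derivative_eq_intros DERIV_hvol DERIV_hsinh DERIV_hcosh)
    also have "real n * hsinh x ^ (n - 1) * conf x -
       ((real n * hsinh x ^ (n - 1) * (conf x * hcosh x)) * hcosh x - hsinh x ^ n * (conf x * hsinh x))
         / (hcosh x * hcosh x)
       = hsinh x ^ n * (conf x * hsinh x) / (hcosh x * hcosh x)"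
      using hcosh_ne_0 by (simp add: field_simps)
    finally show "(F has_real_derivative hsinh x ^ n * (conf x * hsinh x) / (hcosh x * hcosh x)) (at x)" .
    show "0 \<le> hsinh x ^ n * (conf x * hsinh x) / (hcosh x * hcosh x)"
      using x hsinh_nonneg[of x] conf_pos[of x] by simp
  qed
  thus ?thesis by (simp add: F_def)
qed

lemma hvol_strict_mono:
  assumes "0 \<le> r" "r < r'" "r' < 1" "n > 0"
  shows "hvol n r < hvol n r'"
proof (rule DERIV_pos_imp_increasing_open[OF assms(2)])
  show "\<exists>y. (hvol n has_real_derivative y) (at x) \<and> y > 0" if "r < x" "x < r'" for x
    using that assms hsinh_pos[of x] conf_pos[of x]
    by (intro exI[of _ "real n * hsinh x ^ (n - 1) * conf x"] conjI DERIV_hvol) auto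
  show "continuous_on {r..r'} (hvol n)"
    by (rule continuous_on_subset[OF continuous_on_hvol]) (use assms in auto)
qed

lemma hvol_less_iff:
  assumes "0 \<le> r" "r < 1" "0 \<le> r'" "r' < 1" "n > 0"
  shows "hvol n r < hvol n r' \<longleftrightarrow> r < r'"
  using hvol_strict_mono[of r r' n] hvol_strict_mono[of r' r n] assms
  by (cases r r' rule: linorder_cases) auto

lemma hvol_pos: "0 < r \<Longrightarrow> r < 1 \<Longrightarrow> n > 0 \<Longrightarrow> hvol n r > 0"
  using hvol_strict_mono[of 0 r n] by simp

lemma hvol_nonneg: "0 \<le> r \<Longrightarrow> r < 1 \<Longrightarrow> hvol n r \<ge> 0"
  using hvol_pos[of r n] by (cases "r = 0"; cases "n = 0") (auto simp: hvol_def)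

lemma hvol_le_perimeter:
  assumes "0 \<le> r" "r < 1" "n \<ge> 2"
  shows "(real n - 1) * hvol n r \<le> real n * hsinh r ^ (n - 1)"
proof -
  define F where "F r = real n * hsinh r ^ (n - 1) - (real n - 1) * hvol n r" for r
  have "0 \<le> F r"
  proof (rule nonneg_if_DERIV_nonneg[OF assms(1,2)])
    show "F 0 = 0" using assms(3) by (simp add: F_def hsinh_def power_0_left)
    show "continuous_on {0..<1} F"
      unfolding F_def by (intro continuous_intros continuous_on_hvol continuous_on_hsinh)
  next
    fix x :: real assume x: "0 < x" "x < 1"
    have "(F has_real_derivative real n * (real (n - 1) * hsinh x ^ (n - 1 - 1) * (conf x * hcosh x)) -
        (real n - 1) * (real n * hsinh x ^ (n - 1) * conf x)) (at x)"
      unfolding F_def[abs_def] using x by (auto intro!: derivative_eq_intros DERIV_hvol DERIV_hsinh)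
    also have "hsinh x ^ (n - 1) = hsinh x ^ (n - 2) * hsinh x"
      using assms(3) by (metis One_nat_def Suc_1 Suc_diff_Suc Suc_le_lessD power_Suc2)
    hence "real n * (real (n - 1) * hsinh x ^ (n - 1 - 1) * (conf x * hcosh x)) -
        (real n - 1) * (real n * hsinh x ^ (n - 1) * conf x)
        = real n * (real n - 1) * hsinh x ^ (n - 2) * conf x * (hcosh x - hsinh x)"
      using assms(3) by (simp add: of_nat_diff algebra_simps numeral_2_eq_2)
    finally show "(F has_real_derivative
        real n * (real n - 1) * hsinh x ^ (n - 2) * conf x * (hcosh x - hsinh x)) (at x)" .
    show "0 \<le> real n * (real n - 1) * hsinh x ^ (n - 2) * conf x * (hcosh x - hsinh x)"
      using x hsinh_nonneg[of x] conf_pos[of x] hsinh_le_hcosh[of x] assms(3) by simp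
  qed
  thus ?thesis by (simp add: F_def)
qed

lemma hvol_2:
  assumes "0 \<le> r" "r < 1"
  shows "hvol 2 r = 2 * (hcosh r - 1)"
proof -
  have "((\<lambda>t. real 2 * hsinh t ^ (2 - 1) * conf t) has_integral (2 * hcosh r - 2 * hcosh 0)) {0..r}"
  proof (rule fundamental_theorem_of_calculus[OF assms(1)])
    fix x assume "x \<in> {0..r}"
    hence "((\<lambda>r. 2 * hcosh r) has_real_derivative real 2 * hsinh x ^ (2 - 1) * conf x) (at x within {0..r})"
      using assms by (auto intro!: derivative_eq_intros has_field_derivative_at_within[OF DERIV_hcosh])
    thus "((\<lambda>r. 2 * hcosh r) has_vector_derivative
        real 2 * hsinh x ^ (2 - 1) * conf x) (at x within {0..r})"
      by (simp add: has_real_derivative_iff_has_vector_derivative)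
  qed
  thus ?thesis using has_integral_unique[OF has_integral_hvol[OF assms(2), of 2]] by (simp add: hcosh_def)
qed

lemma hvol_powr_le_hsinh_square:
  assumes "0 \<le> r" "r < 1" "n \<ge> 2"
  shows "((real n - 1) / real n * hvol n r) powr (2 / (real n - 1)) \<le> (hsinh r)\<^sup>2"
proof -
  have "((real n - 1) / real n * hvol n r) powr (2 / (real n - 1))
      \<le> (hsinh r ^ (n - 1)) powr (2 / (real n - 1))"
  proof (rule powr_mono2)
    show "0 \<le> (real n - 1) / real n * hvol n r"
      using hvol_nonneg[OF assms(1,2), of n] assms(3) by simp
    show "(real n - 1) / real n * hvol n r \<le> hsinh r ^ (n - 1)"
      using hvol_le_perimeter[OF assms] assms(3) by (simp add: pos_divide_le_eq mult.commute)
  qed (use assms(3) in simp)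
  also have "\<dots> = hsinh r powr (real (n - 1) * (2 / (real n - 1)))"
    using hsinh_nonneg[OF assms(1,2)] assms(3) by (intro powr_of_power) auto
  also have "real (n - 1) * (2 / (real n - 1)) = 2"
    using assms(3) by (simp add: of_nat_diff field_simps)
  finally show ?thesis using hsinh_nonneg[OF assms(1,2)] by simp
qed

lemma hvol_plus_powr_le:
  fixes n :: nat
  assumes "0 \<le> r" "r < 1" "n \<ge> 2"
  defines "a \<equiv> (real n - 1) / real n" and "m \<equiv> (real n + 1) / (real n - 1)"
  shows "hvol n r + (a * hvol n r) powr m \<le> hsinh r ^ n * hcosh r"
proof -
  have dim: "real n \<ge> 2" using assms(3) by simp
  have a_pos: "a > 0" using dim by (simp add: a_def)
  have exponent: "m > 1" "m - 1 = 2 / (real n - 1)" "real n * (m * a) = real n + 1"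
    using dim by (simp_all add: m_def a_def field_simps)
  define F where "F r = hsinh r ^ n * hcosh r - (hvol n r + (a * hvol n r) powr m)" for r
  define F' where "F' x = hsinh x ^ (n - 1) * conf x * (real n + 1)
      * ((hsinh x)\<^sup>2 - (a * hvol n x) powr (m - 1))" for x
  have "0 \<le> F r"
  proof (rule nonneg_if_DERIV_nonneg[OF assms(1,2)])
    show "F 0 = 0" using assms(3) by (simp add: F_def hsinh_def power_0_left)
    show "continuous_on {0..<1} F"
      unfolding F_def
      by (intro continuous_intros continuous_on_hvol continuous_on_hsinh continuous_on_hcosh continuous_on_powr')
        (use exponent a_pos hvol_nonneg in auto)
  next
    fix x :: real assume x: "0 < x" "x < 1"
    define y c w q where "y = hsinh x" "c = hcosh x" "w = conf x" "q = hvol n x"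
    have "q > 0" "c\<^sup>2 = 1 + y\<^sup>2" "y ^ n = y ^ (n - 1) * y"
      using x hvol_pos[of x n] assms(3) hcosh_square[of x] by (auto simp: y_c_w_q_def power_eq_if)
    have "(F has_real_derivative (real n * y ^ (n - 1) * (w * c)) * c + y ^ n * (w * y)
        - (real n * y ^ (n - 1) * w + m * (a * q) powr (m - 1) * (a * (real n * y ^ (n - 1) * w)))) (at x)"
      using x a_pos \<open>q > 0\<close> unfolding F_def[abs_def] y_c_w_q_def
      by (auto intro!: derivative_eq_intros DERIV_hvol DERIV_hsinh DERIV_hcosh)
    also have "(real n * y ^ (n - 1) * (w * c)) * c + y ^ n * (w * y)
        - (real n * y ^ (n - 1) * w + m * (a * q) powr (m - 1) * (a * (real n * y ^ (n - 1) * w)))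
        = y ^ (n - 1) * w * (real n * c\<^sup>2 + y\<^sup>2 - real n - real n * (m * a) * (a * q) powr (m - 1))"
      by (simp add: \<open>y ^ n = y ^ (n - 1) * y\<close> algebra_simps power2_eq_square)
    also have "\<dots> = F' x"
      unfolding exponent(3) F'_def y_c_w_q_def[symmetric] by (simp add: \<open>c\<^sup>2 = 1 + y\<^sup>2\<close> algebra_simps)
    finally show "(F has_real_derivative F' x) (at x)" .
    show "0 \<le> F' x"
      using hvol_powr_le_hsinh_square[of x n] x assms(3) hsinh_nonneg[of x] conf_pos[of x]
      unfolding F'_def exponent(2) a_def by simp
  qed
  thus ?thesis by (simp add: F_def)
qed

lemma hvol_square_plus_powr_le:
  fixes n :: nat
  assumes "0 \<le> r" "r < 1" "n \<ge> 2"
  defines "a \<equiv> (real n - 1) / real n" and "m \<equiv> 2 * real n / (real n - 1)"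
  shows "(hvol n r)\<^sup>2 + (a * hvol n r) powr m \<le> hsinh r ^ (2 * n)"
proof -
  have dim: "real n \<ge> 2" using assms(3) by simp
  have a_pos: "a > 0" using dim by (simp add: a_def)
  have exponent: "m > 0" "m - 1 = (real n + 1) / (real n - 1)" "m * a = 2"
    using dim by (simp_all add: m_def a_def field_simps)
  define F where "F r = hsinh r ^ (2 * n) - ((hvol n r)\<^sup>2 + (a * hvol n r) powr m)" for r
  define F' where "F' x = 2 * real n * hsinh x ^ (n - 1) * conf x
      * (hsinh x ^ n * hcosh x - (hvol n x + (a * hvol n x) powr (m - 1)))" for x
  have "0 \<le> F r"
  proof (rule nonneg_if_DERIV_nonneg[OF assms(1,2)])
    show "F 0 = 0" using assms(3) by (simp add: F_def hsinh_def power_0_left)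
    show "continuous_on {0..<1} F"
      unfolding F_def
      by (intro continuous_intros continuous_on_hvol continuous_on_hsinh continuous_on_powr')
        (use exponent a_pos hvol_nonneg in auto)
  next
    fix x :: real assume x: "0 < x" "x < 1"
    define y c w q where "y = hsinh x" "c = hcosh x" "w = conf x" "q = hvol n x"
    have "q > 0" "y ^ (2 * n - 1) = y ^ (n - 1) * y ^ n"
      using x hvol_pos[of x n] assms(3) by (auto simp: y_c_w_q_def mult_2 simp flip: power_add)
    have "(F has_real_derivative (real (2 * n) * y ^ (2 * n - 1) * (w * c))
        - (2 * q * (real n * y ^ (n - 1) * w) + m * (a * q) powr (m - 1) * (a * (real n * y ^ (n - 1) * w)))) (at x)"
      using x a_pos \<open>q > 0\<close> unfolding F_def[abs_def] y_c_w_q_def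
      by (auto intro!: derivative_eq_intros DERIV_hvol DERIV_hsinh DERIV_hcosh)
    also have "(real (2 * n) * y ^ (2 * n - 1) * (w * c))
        - (2 * q * (real n * y ^ (n - 1) * w) + m * (a * q) powr (m - 1) * (a * (real n * y ^ (n - 1) * w)))
        = real n * y ^ (n - 1) * w * (2 * y ^ n * c - 2 * q - (m * a) * (a * q) powr (m - 1))"
      unfolding \<open>y ^ (2 * n - 1) = y ^ (n - 1) * y ^ n\<close> by (simp add: algebra_simps)
    also have "\<dots> = F' x"
      unfolding exponent(3) F'_def y_c_w_q_def by (simp add: algebra_simps)
    finally show "(F has_real_derivative F' x) (at x)" .
    show "0 \<le> F' x"
      using hvol_plus_powr_le[of x n] x assms(3) hsinh_nonneg[of x] conf_pos[of x]
      unfolding F'_def exponent(2) a_def by simp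
  qed
  thus ?thesis by (simp add: F_def)
qed

lemma powr_superadditive_mono_exponent:
  fixes A B C :: real
  assumes "A \<ge> 0" "0 < p0" "p0 \<le> p" and superadditive: "B powr p0 + C powr p0 \<le> A powr p0"
  shows "B powr p + C powr p \<le> A powr p"
proof -
  define t where "t = p / p0 - 1"
  have t: "t \<ge> 0" "p = p0 + p0 * t" using assms by (auto simp: t_def field_simps)
  have powr_p: "X powr p = X powr p0 * (X powr p0) powr t" for X :: real
    by (simp add: t(2) powr_add powr_powr)
  have "B powr p0 \<le> A powr p0" "C powr p0 \<le> A powr p0"
    using superadditive powr_ge_zero[of B p0] powr_ge_zero[of C p0] by linarith+
  hence "B powr p + C powr p \<le> B powr p0 * (A powr p0) powr t + C powr p0 * (A powr p0) powr t"
    unfolding powr_p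
    by (intro add_mono mult_left_mono powr_mono2[OF t(1)]) simp_all
  also have "\<dots> = (B powr p0 + C powr p0) * (A powr p0) powr t" by (simp add: algebra_simps)
  also have "\<dots> \<le> A powr p" unfolding powr_p using superadditive by (intro mult_right_mono) auto
  finally show ?thesis .
qed

lemma perimeter_comparison_critical:
  fixes n :: nat
  assumes r: "0 \<le> r" "r < 1" and "n \<ge> 2"
  defines "m \<equiv> if n = 2 then 2 else 2 * real n / (real n - 1)"
  shows "(hvol n r powr ((real n - 1) / real n)) powr m + ((real n - 1) / real n * hvol n r) powr m
     \<le> (hsinh r ^ (n - 1)) powr m"
proof (cases "n = 2")
  case True
  have "hvol n r + (hvol n r / 2)\<^sup>2 = (hcosh r)\<^sup>2 - 1"
    unfolding True hvol_2[OF r] by (simp add: power2_eq_square field_simps)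
  hence "hvol n r + (hvol n r / 2)\<^sup>2 = (hsinh r)\<^sup>2"
    using hcosh_square[OF r] by simp
  thus ?thesis
    using True hvol_nonneg[OF r, of n] hsinh_nonneg[OF r] by (simp add: m_def powr_powr)
next
  case False
  have dim: "real n > 1" using \<open>n \<ge> 2\<close> by simp
  have "(real n - 1) / real n * m = 2" using False dim by (simp add: m_def field_simps)
  hence "(hvol n r powr ((real n - 1) / real n)) powr m = (hvol n r)\<^sup>2"
    using hvol_nonneg[OF r, of n] by (simp only: powr_powr) simp
  moreover have "real (n - 1) * m = real (2 * n)"
    using False dim by (simp add: m_def of_nat_diff)
  hence "(hsinh r ^ (n - 1)) powr m = hsinh r ^ (2 * n)"
    using hsinh_nonneg[OF r] \<open>n \<ge> 2\<close> by (subst powr_of_power) (simp_all add: powr_realpow' del: of_nat_mult)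
  ultimately show ?thesis
    using hvol_square_plus_powr_le[OF r \<open>n \<ge> 2\<close>] False by (simp add: m_def)
qed

lemma perimeter_comparison:
  fixes n :: nat and p :: real
  assumes r: "0 \<le> r" "r < 1"
    and exponent: "(n = 2 \<and> p \<ge> 2) \<or> (n \<ge> 3 \<and> p \<ge> 2 * real n / (real n - 1))"
  shows "(real n * hvol n r powr ((real n - 1) / real n)) powr p + ((real n - 1) * hvol n r) powr p
     \<le> (real n * hsinh r ^ (n - 1)) powr p"
proof -
  define m where "m = (if n = 2 then 2 else 2 * real n / (real n - 1))"
  have dim: "n \<ge> 2" "real n > 1" and m: "0 < m" "m \<le> p" using exponent by (auto simp: m_def)
  have "(hvol n r powr ((real n - 1) / real n)) powr p + ((real n - 1) / real n * hvol n r) powr p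
      \<le> (hsinh r ^ (n - 1)) powr p"
    by (rule powr_superadditive_mono_exponent[OF _ m])
      (use perimeter_comparison_critical[OF r dim(1)] hsinh_nonneg[OF r] in \<open>auto simp: m_def\<close>)
  hence "real n powr p * ((hvol n r powr ((real n - 1) / real n)) powr p
      + ((real n - 1) / real n * hvol n r) powr p)
      \<le> real n powr p * (hsinh r ^ (n - 1)) powr p"
    by (rule mult_left_mono) simp
  also have "real n powr p * ((real n - 1) / real n * hvol n r) powr p = ((real n - 1) * hvol n r) powr p"
    using dim by (simp flip: powr_mult)
  hence "real n powr p * ((hvol n r powr ((real n - 1) / real n)) powr p
      + ((real n - 1) / real n * hvol n r) powr p)
      = (real n * hvol n r powr ((real n - 1) / real n)) powr p + ((real n - 1) * hvol n r) powr p"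
    by (simp add: distrib_left powr_mult)
  finally show ?thesis by (simp add: powr_mult)
qed

lemma hsinh_power_le:
  assumes r: "0 \<le> r" "r < 1" and "n \<ge> 2"
  shows "hsinh r ^ (n - 1) \<le> 2 * (hvol n r + hvol n r powr (1 - 1 / real n))"
proof -
  define q y where "q = hvol n r" "y = hsinh r"
  have nonneg: "q \<ge> 0" "y \<ge> 0" using r hvol_nonneg[of r n] hsinh_nonneg[of r] by (auto simp: q_y_def)
  have "y ^ n / (1 + y) \<le> y ^ n / hcosh r"
    using hcosh_le_1_plus_hsinh[OF r] hcosh_ge_1[OF r] nonneg
      by (intro divide_left_mono) (auto simp: q_y_def)
  also have "\<dots> \<le> q"
    using hvol_ge[OF r, of n] \<open>n \<ge> 2\<close> by (simp add: q_y_def)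
  finally have quotient_le: "y ^ n / (1 + y) \<le> q" .
  show ?thesis
  proof (cases "y \<ge> 1")
    case True
    have "y ^ n = y ^ (n - 1) * y" using \<open>n \<ge> 2\<close> by (cases n) auto
    hence "y ^ (n - 1) \<le> 2 * (y ^ n / (1 + y))" using True by (simp add: field_simps)
    also have "\<dots> \<le> 2 * q" using quotient_le by simp
    also have "\<dots> \<le> 2 * (q + q powr (1 - 1 / real n))" by simp
    finally show ?thesis by (simp add: q_y_def)
  next
    case False
    have "y ^ n / 2 \<le> y ^ n / (1 + y)" using False nonneg by (intro divide_left_mono) auto
    hence "y ^ n \<le> 2 * q" using quotient_le by linarith
    hence "(y ^ n) powr (1 - 1 / real n) \<le> (2 * q) powr (1 - 1 / real n)"
      using nonneg \<open>n \<ge> 2\<close> by (intro powr_mono2) simp_all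
    also have "\<dots> = 2 powr (1 - 1 / real n) * q powr (1 - 1 / real n)" by (simp add: powr_mult)
    also have "\<dots> \<le> 2 powr 1 * q powr (1 - 1 / real n)" by (intro mult_right_mono powr_mono) simp_all
    also have "(y ^ n) powr (1 - 1 / real n) = y powr (real n * (1 - 1 / real n))"
      using nonneg \<open>n \<ge> 2\<close> by (intro powr_of_power) auto
    also have "real n * (1 - 1 / real n) = real (n - 1)" using \<open>n \<ge> 2\<close>
      by (simp add: of_nat_diff field_simps)
    also have "y powr real (n - 1) = y ^ (n - 1)"
      using nonneg \<open>n \<ge> 2\<close> by (intro powr_realpow') auto
    finally show ?thesis using nonneg unfolding q_y_def by simp
  qed
qed

lemma hsinh_unbounded:
  assumes "M > 0"
  obtains r where "0 < r" "r < 1" "M \<le> hsinh r"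
proof -
  define r where "r = M / (1 + M)"
  have r: "0 < r" "r < 1" using assms by (auto simp: r_def)
  have "M = r / (1 - r)" using assms by (simp add: r_def field_simps)
  also have "\<dots> = r * (1 + r) / (1 - r\<^sup>2)"
  proof -
    have "1 - r\<^sup>2 = (1 - r) * (1 + r)" by (simp add: power2_eq_square algebra_simps)
    thus ?thesis using r by simp
  qed
  also have "\<dots> \<le> hsinh r"
    unfolding hsinh_def using r one_minus_square_pos[of r] by (intro divide_right_mono) auto
  finally show ?thesis using r that by blast
qed

lemma hvol_unbounded:
  assumes "n \<ge> 2"
  obtains r where "0 < r" "r < 1" "S \<le> hvol n r"
proof -
  define M where "M = max 1 (4 * S + 2)"
  obtain r where r: "0 < r" "r < 1" "M \<le> hsinh r"
    by (rule hsinh_unbounded[of M]) (simp add: M_def)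
  define q where "q = hvol n r"
  have "q \<ge> 0" using hvol_nonneg[of r n] r by (simp add: q_def)
  have "M \<le> hsinh r ^ (n - 1)"
    using r assms by (intro order_trans[OF r(3)] self_le_power) (auto simp: M_def)
  also have "\<dots> \<le> 2 * (q + q powr (1 - 1 / real n))"
    unfolding q_def using r assms by (intro hsinh_power_le) auto
  also have "q powr (1 - 1 / real n) \<le> (1 + q) powr (1 - 1 / real n)"
    using \<open>q \<ge> 0\<close> assms by (intro powr_mono2) auto
  also have "\<dots> \<le> (1 + q) powr 1"
    using \<open>q \<ge> 0\<close> by (intro powr_mono) auto
  finally have "S \<le> q" using \<open>q \<ge> 0\<close> by (simp add: M_def)
  thus ?thesis using r that by (simp add: q_def)
qed

lemma hvol_surj:
  assumes "n \<ge> 2" "s > 0"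
  obtains r where "0 < r" "r < 1" "hvol n r = s"
proof -
  obtain R where R: "0 < R" "R < 1" "s \<le> hvol n R"
    using hvol_unbounded[OF assms(1)] .
  have "\<exists>r\<ge>0. r \<le> R \<and> hvol n r = s"
    using R assms by (intro IVT' continuous_on_subset[OF continuous_on_hvol]) auto
  then obtain r where r: "0 \<le> r" "r \<le> R" "hvol n r = s" by blast
  moreover have "r \<noteq> 0" using r assms by auto
  ultimately show ?thesis using that[of r] R by auto
qed

section \<open>Volume coordinates\<close>

lemma measure_eqI_lessThan_finite:
  fixes M N :: "real measure"
  assumes borel: "sets M = sets borel" "sets N = sets borel"
    and finite: "\<And>x. emeasure M {..<x} < \<infinity>"
    and same: "\<And>x. emeasure M {..<x} = emeasure N {..<x}"
  shows "M = N"
proof (rule measure_eqI_generator_eq[where E = "range lessThan" and \<Omega> = UNIV and A = "\<lambda>i. {..<real i}"])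
  show "Int_stable (range (lessThan :: real \<Rightarrow> real set))"
  proof (rule Int_stableI, clarify)
    fix a b :: real
    have "{..<a} \<inter> {..<b} = {..<min a b}" by auto
    thus "{..<a} \<inter> {..<b} \<in> range lessThan" by blast
  qed
  show "(\<Union>i. {..<real i}) = UNIV"
    using reals_Archimedean2 by auto
  have "sets (borel :: real measure) = sigma_sets UNIV (range lessThan)"
    by (subst borel_Iio) simp
  thus "sets M = sigma_sets UNIV (range lessThan)" "sets N = sigma_sets UNIV (range lessThan)"
    by (simp_all only: borel)
qed (use finite same in \<open>auto simp: less_top[symmetric]\<close>)

lemma nn_integral_compose_density:
  fixes \<Phi> :: "'a \<Rightarrow> real" and D g :: "real \<Rightarrow> ennreal"
  assumes [measurable]: "\<Phi> \<in> borel_measurable M" "D \<in> borel_measurable borel" "g \<in> borel_measurable borel"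
    and sublevel: "\<And>s. emeasure M {x \<in> space M. \<Phi> x < s} = (\<integral>\<^sup>+t. D t * indicator {..<s} t \<partial>lborel)"
    and finite: "\<And>s. emeasure M {x \<in> space M. \<Phi> x < s} < \<infinity>"
  shows "(\<integral>\<^sup>+x. g (\<Phi> x) \<partial>M) = (\<integral>\<^sup>+t. g t * D t \<partial>lborel)"
proof -
  have "distr M borel \<Phi> = density lborel D"
  proof (rule measure_eqI_lessThan_finite)
    fix s :: real
    have "emeasure (distr M borel \<Phi>) {..<s} = emeasure M {x \<in> space M. \<Phi> x < s}"
      by (subst emeasure_distr) (auto intro!: arg_cong[where f = "emeasure M"])
    thus "emeasure (distr M borel \<Phi>) {..<s} < \<infinity>"
      "emeasure (distr M borel \<Phi>) {..<s} = emeasure (density lborel D) {..<s}"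
      using finite[of s] by (simp_all add: sublevel emeasure_density)
  qed auto
  hence "integral\<^sup>N (distr M borel \<Phi>) g = integral\<^sup>N (density lborel D) g" by simp
  thus ?thesis by (simp add: nn_integral_distr nn_integral_density mult.commute)
qed

lemma nn_integral_volume_coordinate:
  fixes \<Phi> :: "'a \<Rightarrow> real" and g :: "real \<Rightarrow> ennreal"
  assumes "\<Phi> \<in> borel_measurable M" "g \<in> borel_measurable borel"
    and volume: "\<And>s. s > 0 \<Longrightarrow> emeasure M {x \<in> space M. \<Phi> x < s} = ennreal s"
    and nonneg: "\<And>x. x \<in> space M \<Longrightarrow> \<Phi> x \<ge> 0"
  shows "(\<integral>\<^sup>+x. g (\<Phi> x) \<partial>M) = (\<integral>\<^sup>+s. g s * indicator {0<..} s \<partial>lborel)"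
proof (rule nn_integral_compose_density)
  fix s :: real
  have "(\<integral>\<^sup>+t. indicator {0<..} t * indicator {..<s} t \<partial>lborel) = (\<integral>\<^sup>+t. indicator {0<..<s} t \<partial>lborel)"
    by (intro nn_integral_cong) (auto simp: indicator_def)
  moreover have "{x \<in> space M. \<Phi> x < s} = {}" if "s \<le> 0" using that nonneg by fastforce
  hence "emeasure M {x \<in> space M. \<Phi> x < s} = ennreal s"
    using volume[of s] by (cases "s > 0") (auto simp: ennreal_neg simp del: Collect_empty_eq)
  ultimately show "emeasure M {x \<in> space M. \<Phi> x < s}
      = (\<integral>\<^sup>+t. indicator {0<..} t * indicator {..<s} t \<partial>lborel)"
    "emeasure M {x \<in> space M. \<Phi> x < s} < \<infinity>"
    by (cases "s > 0"; simp add: ennreal_neg)+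
qed (use assms in auto)

lemma emeasure_ball_0:
  assumes "r \<ge> 0"
  shows "emeasure lborel (ball (0::'a::euclidean_space) r)
    = ennreal (measure lborel (ball (0::'a) 1) * r ^ DIM('a))"
  using content_ball_conv_unit_ball[OF assms, of "0::'a"] emeasure_lborel_ball_finite[of "0::'a" r]
  by (simp add: emeasure_eq_ennreal_measure less_top mult.commute)

lemmas [measurable] = borel_open[OF open_ball]

lemma integrable_indicator_ball:
    "integrable lborel (indicator (ball (c::'a::euclidean_space) r) :: 'a \<Rightarrow> real)"
  using emeasure_lborel_ball_finite[of c r] by (intro integrable_real_indicator) auto

definition sphere_area :: "'a::euclidean_space itself \<Rightarrow> real \<Rightarrow> real" where
  "sphere_area _ r = real DIM('a) * measure lborel (ball (0::'a) 1) * r ^ (DIM('a) - 1)"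

lemma sphere_area_nonneg: "r \<ge> 0 \<Longrightarrow> sphere_area TYPE('a::euclidean_space) r \<ge> 0"
  by (simp add: sphere_area_def)

lemma sphere_area_borel_measurable [measurable]:
  "sphere_area TYPE('a::euclidean_space) \<in> borel_measurable borel"
  unfolding sphere_area_def[abs_def] by measurable

lemma nn_integral_sphere_area:
  assumes "x \<ge> 0"
  shows "(\<integral>\<^sup>+r. ennreal (sphere_area TYPE('a::euclidean_space) r) * indicator {0<..<x} r \<partial>lborel)
    = emeasure lborel (ball (0::'a) x)"
proof -
  have "(\<integral>\<^sup>+r. ennreal (sphere_area TYPE('a) r) * indicator {0<..<x} r \<partial>lborel)
      = (\<integral>\<^sup>+r. ennreal (sphere_area TYPE('a) r) * indicator {0..x} r \<partial>lborel)"
  proof (rule nn_integral_cong_AE)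
    show "AE r in lborel. ennreal (sphere_area TYPE('a) r) * indicator {0<..<x} r
        = ennreal (sphere_area TYPE('a) r) * indicator {0..x} r"
      using AE_lborel_singleton[of "0::real"] AE_lborel_singleton[of x]
      by eventually_elim (auto simp: indicator_def)
  qed
  also have "\<dots> = ennreal (measure lborel (ball (0::'a) 1) * x ^ DIM('a)
      - measure lborel (ball (0::'a) 1) * 0 ^ DIM('a))"
    using assms unfolding sphere_area_def
    by (intro nn_integral_FTC_Icc) (auto intro!: derivative_eq_intros simp: mult_ac)
  finally show ?thesis by (simp add: emeasure_ball_0[OF assms] zero_power)
qed

lemma nn_integral_radial:
  fixes k :: "real \<Rightarrow> ennreal"
  assumes "k \<in> borel_measurable borel"
  shows "(\<integral>\<^sup>+x. k (norm (x::'a::euclidean_space)) \<partial>lborel)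
     = (\<integral>\<^sup>+r. k r * (ennreal (sphere_area TYPE('a) r) * indicator {0<..} r) \<partial>lborel)"
proof (rule nn_integral_compose_density)
  fix s :: real
  have "(\<integral>\<^sup>+t. ennreal (sphere_area TYPE('a) t) * indicator {0<..} t * indicator {..<s} t \<partial>lborel)
      = (\<integral>\<^sup>+t. ennreal (sphere_area TYPE('a) t) * indicator {0<..<max 0 s} t \<partial>lborel)"
    by (intro nn_integral_cong) (auto simp: indicator_def)
  also have "\<dots> = emeasure lborel (ball (0::'a) (max 0 s))"
    by (rule nn_integral_sphere_area) simp
  also have "ball (0::'a) (max 0 s) = {x \<in> space lborel. norm x < s}"
    using norm_ge_zero order.strict_trans1 by (fastforce simp: less_max_iff_disj)
  finally show "emeasure lborel {x \<in> space lborel. norm (x::'a) < s}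
      = (\<integral>\<^sup>+t. ennreal (sphere_area TYPE('a) t) * indicator {0<..} t * indicator {..<s} t \<partial>lborel)" ..
  have "{x \<in> space lborel. norm (x::'a) < s} = ball 0 s" by auto
  thus "emeasure lborel {x \<in> space lborel. norm (x::'a) < s} < \<infinity>"
    using emeasure_lborel_ball_finite[of "0::'a" s] by simp
qed (use assms in measurable)

lemma AE_norm:
  assumes "AE r in lborel. P r"
  shows "AE x::'a::euclidean_space in lborel. P (norm x)"
proof -
  obtain N where N: "{r \<in> space lborel. \<not> P r} \<subseteq> N" "emeasure lborel N = 0" "N \<in> sets lborel"
    using AE_E[OF assms] .
  have [measurable]: "N \<in> sets borel" using N(3) by simp
  have "AE r in lborel. r \<notin> N" using N by (intro AE_not_in) (simp add: null_sets_def)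
  hence "AE r in lborel. indicator N r * (ennreal (sphere_area TYPE('a) r) * indicator {0<..} r) = 0"
    by eventually_elim simp
  hence "(\<integral>\<^sup>+x. indicator N (norm (x::'a)) \<partial>lborel) = 0"
    by (subst nn_integral_radial) (auto simp: nn_integral_0_iff_AE)
  hence "AE x::'a in lborel. indicator N (norm x) = (0::ennreal)"
    by (simp add: nn_integral_0_iff_AE)
  thus ?thesis by eventually_elim (use N(1) in \<open>auto simp: indicator_def split: if_splits\<close>)
qed

lemma hyp_weight_conf: "hyp_weight (x::real^'n::finite) = conf (norm x) ^ CARD('n)"
  by (simp add: hyp_weight_def conf_def)

lemma conf_borel_measurable [measurable]: "conf \<in> borel_measurable borel"
  unfolding conf_def[abs_def] by measurable

lemma hsinh_borel_measurable [measurable]: "hsinh \<in> borel_measurable borel"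
  unfolding hsinh_def[abs_def] by measurable

lemma hyp_weight_borel_measurable [measurable]: "hyp_weight \<in> borel_measurable borel"
  unfolding hyp_weight_conf[abs_def] by measurable

lemma space_hypV [simp]: "space (hypV :: (real^'n::finite) measure) = ball 0 1"
  by (simp add: hypV_def space_restrict_space)

lemma sets_hypV: "sets (hypV :: (real^'n::finite) measure) = sets (lebesgue_on (ball 0 1))"
  by (simp add: hypV_def)

lemma borel_measurable_hypV:
  "f \<in> borel_measurable borel \<Longrightarrow> f \<in> borel_measurable (hypV :: (real^'n::finite) measure)"
  unfolding hypV_def by (simp add: measurable_completion measurable_restrict_space1)

lemma borel_subset_sets_hypV:
  assumes "S \<in> sets borel" "S \<subseteq> ball 0 1"
  shows "S \<in> sets (hypV :: (real^'n::finite) measure)"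
proof -
  have "S = ball 0 1 \<inter> S" "S \<in> sets lebesgue" using assms by auto
  thus ?thesis unfolding sets_hypV sets_restrict_space by blast
qed

lemma hyp_weight_borel_measurable_lebesgue_on [measurable]:
  "(\<lambda>x. ennreal (hyp_weight x)) \<in> borel_measurable (lebesgue_on (ball (0::real^'n::finite) 1))"
  by (intro measurable_restrict_space1 measurable_completion) measurable

lemma AE_hypV_if_AE_lborel:
  assumes "AE x in lborel. P x"
  shows "AE x in (hypV :: (real^'n::finite) measure). P x"
proof -
  have "AE x in lebesgue. P x" using assms by (rule AE_completion)
  hence "AE x in lebesgue_on (ball 0 1). P x" by (subst AE_restrict_space_iff) auto
  thus ?thesis unfolding hypV_def by (subst AE_density) auto
qed

lemma nn_integral_hypV:
  fixes f :: "real^'n::finite \<Rightarrow> ennreal"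
  assumes "f \<in> borel_measurable hypV"
  shows "(\<integral>\<^sup>+x. f x \<partial>hypV) = (\<integral>\<^sup>+x. f x * ennreal (hyp_weight x) * indicator (ball 0 1) x \<partial>lborel)"
proof -
  have [measurable]: "f \<in> borel_measurable (lebesgue_on (ball 0 1))"
    using assms measurable_cong_sets[OF sets_hypV refl] by blast
  have "(\<integral>\<^sup>+x. f x \<partial>hypV) = (\<integral>\<^sup>+x. ennreal (hyp_weight x) * f x \<partial>lebesgue_on (ball 0 1))"
    unfolding hypV_def by (subst nn_integral_density) auto
  also have "\<dots> = (\<integral>\<^sup>+x. ennreal (hyp_weight x) * f x * indicator (ball 0 1) x \<partial>lebesgue)"
    by (subst nn_integral_restrict_space) auto
  also have "\<dots> = (\<integral>\<^sup>+x. ennreal (hyp_weight x) * f x * indicator (ball 0 1) x \<partial>lborel)"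
    by (rule nn_integral_completion)
  finally show ?thesis by (simp add: mult_ac)
qed

definition euc_vol :: "'n::finite itself \<Rightarrow> real \<Rightarrow> real" where
  "euc_vol _ r = unit_ball_vol TYPE('n) * r ^ CARD('n)"

definition hyp_vol :: "'n::finite itself \<Rightarrow> real \<Rightarrow> real" where
  "hyp_vol _ r = unit_ball_vol TYPE('n) * hvol CARD('n) r"

lemma unit_ball_vol_pos: "unit_ball_vol TYPE('n::finite) > 0"
  by (simp add: unit_ball_vol_def content_ball_pos)

lemma hyp_vol_borel_measurable [measurable]: "hyp_vol TYPE('n::finite) \<in> borel_measurable borel"
  unfolding hyp_vol_def[abs_def] by measurable

lemma euc_vol_borel_measurable [measurable]: "euc_vol TYPE('n::finite) \<in> borel_measurable borel"
  unfolding euc_vol_def[abs_def] by measurable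

lemma hyp_vol_nonneg: "0 \<le> r \<Longrightarrow> r < 1 \<Longrightarrow> hyp_vol TYPE('n::finite) r \<ge> 0"
  using hvol_nonneg[of r "CARD('n)"] unit_ball_vol_pos[where 'n='n] by (simp add: hyp_vol_def)

lemma hyp_vol_pos: "0 < r \<Longrightarrow> r < 1 \<Longrightarrow> hyp_vol TYPE('n::finite) r > 0"
  using hvol_pos[of r "CARD('n)"] unit_ball_vol_pos[where 'n='n] by (simp add: hyp_vol_def)

lemma hyp_weight_mult_sphere_area:
  "conf r ^ CARD('n::finite) * sphere_area TYPE(real^'n) r
    = unit_ball_vol TYPE('n) * (real CARD('n) * hsinh r ^ (CARD('n) - 1) * conf r)"
proof -
  have "conf r ^ CARD('n) = conf r ^ (CARD('n) - 1) * conf r"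
    by (simp add: power_eq_if)
  thus ?thesis
    by (simp add: sphere_area_def unit_ball_vol_def hsinh_eq_conf_mult power_mult_distrib)
qed

lemma emeasure_hypV_ball:
  assumes r: "0 \<le> r" "r < 1"
  shows "emeasure (hypV :: (real^'n::finite) measure) (ball 0 r) = ennreal (hyp_vol TYPE('n) r)"
proof -
  define D where "D t = unit_ball_vol TYPE('n) * (real CARD('n) * hsinh t ^ (CARD('n) - 1) * conf t)" for t
  have "ball (0::real^'n) r \<in> sets hypV"
    using r by (intro borel_subset_sets_hypV) auto
  hence "emeasure (hypV :: (real^'n) measure) (ball 0 r)
      = (\<integral>\<^sup>+x. indicator (ball 0 r) x \<partial>(hypV :: (real^'n) measure))"
    by simp
  also have "\<dots> = (\<integral>\<^sup>+x. indicator (ball 0 r) x * ennreal (hyp_weight x)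
      * indicator (ball 0 1) (x::real^'n) \<partial>lborel)"
    by (rule nn_integral_hypV, rule borel_measurable_hypV, rule borel_measurable_indicator) simp
  also have "\<dots> = (\<integral>\<^sup>+x. (\<lambda>t. ennreal (conf t ^ CARD('n)) * indicator {..<r} t) (norm (x::real^'n)) \<partial>lborel)"
    using r by (intro nn_integral_cong) (auto simp: hyp_weight_conf indicator_def)
  also have "\<dots> = (\<integral>\<^sup>+t. ennreal (conf t ^ CARD('n)) * indicator {..<r} t
      * (ennreal (sphere_area TYPE(real^'n) t) * indicator {0<..} t) \<partial>lborel)"
    by (rule nn_integral_radial) measurable
  also have "\<dots> = (\<integral>\<^sup>+t. ennreal (D t) * indicator {0..r} t \<partial>lborel)"
  proof (rule nn_integral_cong_AE)
    show "AE t in lborel. ennreal (conf t ^ CARD('n)) * indicator {..<r} t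
      * (ennreal (sphere_area TYPE(real^'n) t) * indicator {0<..} t) = ennreal (D t) * indicator {0..r} t"
      using AE_lborel_singleton[of "0::real"] AE_lborel_singleton[of r]
    proof eventually_elim
      case (elim t)
      have "ennreal (conf t ^ CARD('n)) * ennreal (sphere_area TYPE(real^'n) t) = ennreal (D t)"
        if "0 < t" "t < r"
        using that r conf_pos[of t] unfolding D_def hyp_weight_mult_sphere_area[symmetric]
        by (simp add: ennreal_mult')
      thus ?case using elim by (auto simp: indicator_def)
    qed
  qed
  also have "\<dots> = ennreal (hyp_vol TYPE('n) r)"
  proof (rule nn_integral_has_integral_lebesgue')
    show "(D has_integral hyp_vol TYPE('n) r) {0..r}"
      unfolding D_def hyp_vol_def by (intro has_integral_mult_right has_integral_hvol r)
    show "0 \<le> D t" if "t \<in> {0..r}" for t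
      using that r unit_ball_vol_pos[where 'n='n] hsinh_nonneg[of t] conf_pos[of t] by (simp add: D_def)
  qed
  finally show ?thesis .
qed

lemma hyp_dist0_less_iff:
  fixes x y :: "real^'n::finite"
  assumes "norm x < 1" "norm y < 1"
  shows "hyp_dist0 x < hyp_dist0 y \<longleftrightarrow> norm x < norm y"
proof -
  have "hyp_dist0 x < hyp_dist0 y \<longleftrightarrow> (1 + norm x) / (1 - norm x) < (1 + norm y) / (1 - norm y)"
    unfolding hyp_dist0_def using assms
    by (subst ln_less_cancel_iff) (auto intro!: divide_pos_pos add_pos_nonneg)
  also have "\<dots> \<longleftrightarrow> norm x < norm y" using assms by (simp add: divide_simps algebra_simps)
  finally show ?thesis .
qed

lemma hyp_ball_vol_dist0:
  fixes x :: "real^'n::finite"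
  assumes "norm x < 1"
  shows "hyp_ball_vol TYPE('n) (hyp_dist0 x) = hyp_vol TYPE('n) (norm x)"
proof -
  have "{y \<in> ball 0 1. hyp_dist0 y < hyp_dist0 x} = ball (0::real^'n) (norm x)"
    using assms hyp_dist0_less_iff[of _ x] by auto
  thus ?thesis
    using assms hyp_vol_nonneg[of "norm x", where 'n='n]
    by (simp add: hyp_ball_vol_def measure_def emeasure_hypV_ball)
qed

lemma hyp_sym_rearr_eq:
  "norm x < 1 \<Longrightarrow> hyp_sym_rearr u x = decr_rearr u (hyp_vol TYPE('n) (norm x))" for x :: "real^'n::finite"
  by (simp add: hyp_sym_rearr_def hyp_ball_vol_dist0)

lemma euc_sym_rearr_eq: "euc_sym_rearr u x = decr_rearr u (euc_vol TYPE('n) (norm x))"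
  for x :: "real^'n::finite"
  by (simp add: euc_sym_rearr_def euc_vol_def)

lemma euc_volume_coordinate:
  fixes g :: "real \<Rightarrow> ennreal"
  assumes "g \<in> borel_measurable borel"
  shows "(\<integral>\<^sup>+x. g (euc_vol TYPE('n) (norm x)) \<partial>(lborel :: (real^'n::finite) measure))
     = (\<integral>\<^sup>+s. g s * indicator {0<..} s \<partial>lborel)"
proof (rule nn_integral_volume_coordinate)
  let ?\<sigma> = "unit_ball_vol TYPE('n)"
  fix s :: real assume s: "s > 0"
  define r where "r = root CARD('n) (s / ?\<sigma>)"
  have r: "r > 0" "r ^ CARD('n) = s / ?\<sigma>" using s unit_ball_vol_pos[where 'n='n] by (auto simp: r_def)
  have "euc_vol TYPE('n) (norm x) < s \<longleftrightarrow> norm x ^ CARD('n) < r ^ CARD('n)" for x :: "real^'n"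
    using unit_ball_vol_pos[where 'n='n] by (simp add: r(2) euc_vol_def field_simps)
  also have "norm x ^ CARD('n) < r ^ CARD('n) \<longleftrightarrow> norm x < r" for x :: "real^'n"
    using r(1) power_mono_iff[of r "norm x" "CARD('n)"] by (simp flip: not_le)
  finally have "{x \<in> space lborel. euc_vol TYPE('n) (norm (x::real^'n)) < s} = ball 0 r"
    by (simp add: set_eq_iff)
  thus "emeasure lborel {x \<in> space lborel. euc_vol TYPE('n) (norm (x::real^'n)) < s} = ennreal s"
    using emeasure_ball_0[of r, where 'a="real^'n"] r unit_ball_vol_pos[where 'n='n]
    by (simp add: unit_ball_vol_def)
qed (use assms unit_ball_vol_pos[where 'n='n] in \<open>auto simp: euc_vol_def\<close>)

lemma hyp_volume_coordinate:
  fixes g :: "real \<Rightarrow> ennreal"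
  assumes dim: "CARD('n::finite) \<ge> 2" and "g \<in> borel_measurable borel"
  shows "(\<integral>\<^sup>+x. g (hyp_vol TYPE('n) (norm x)) \<partial>(hypV :: (real^'n) measure))
     = (\<integral>\<^sup>+s. g s * indicator {0<..} s \<partial>lborel)"
proof (rule nn_integral_volume_coordinate)
  show "(\<lambda>x. hyp_vol TYPE('n) (norm x)) \<in> borel_measurable (hypV :: (real^'n) measure)"
    by (rule borel_measurable_hypV) measurable
  let ?\<sigma> = "unit_ball_vol TYPE('n)"
  fix s :: real assume s: "s > 0"
  obtain r where r: "0 < r" "r < 1" "hvol CARD('n) r = s / ?\<sigma>"
    using hvol_surj[OF dim, of "s / ?\<sigma>"] s unit_ball_vol_pos[where 'n='n] by auto
  have "hyp_vol TYPE('n) (norm x) < s \<longleftrightarrow> norm x < r" if "norm x < 1" for x :: "real^'n"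
    using hvol_less_iff[of "norm x" r "CARD('n)"] that r unit_ball_vol_pos[where 'n='n]
    by (simp add: hyp_vol_def field_simps)
  hence "{x \<in> space hypV. hyp_vol TYPE('n) (norm x) < s} = ball (0::real^'n) r" using r by auto
  thus "emeasure hypV {x \<in> space hypV. hyp_vol TYPE('n) (norm (x::real^'n)) < s} = ennreal s"
    using emeasure_hypV_ball[of r, where 'n='n] r unit_ball_vol_pos[where 'n='n] by (simp add: hyp_vol_def)
qed (use assms hyp_vol_nonneg[where 'n='n] in auto)

section \<open>Compactly supported functions of class C1\<close>

definition C1c :: "('a::euclidean_space \<Rightarrow> real) \<Rightarrow> ('a \<Rightarrow> 'a) \<Rightarrow> bool" where
  "C1c f D \<longleftrightarrow> (\<forall>x. (f has_derivative (\<lambda>h. D x \<bullet> h)) (at x)) \<and> continuous_on UNIV D \<and> bounded {x. f x \<noteq> 0}"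

lemma C1c_derivative: "C1c f D \<Longrightarrow> (f has_derivative (\<lambda>h. D x \<bullet> h)) (at x)"
  by (simp add: C1c_def)

lemma C1c_continuous: "C1c f D \<Longrightarrow> continuous_on S f"
  by (meson C1c_derivative has_derivative_continuous continuous_at_imp_continuous_on)

lemma C1c_continuous_grad: "C1c f D \<Longrightarrow> continuous_on S D"
  by (auto simp: C1c_def intro: continuous_on_subset)

lemma C1c_borel_measurable: "C1c f D \<Longrightarrow> f \<in> borel_measurable borel" "C1c f D \<Longrightarrow> D \<in> borel_measurable borel"
  by (auto intro: borel_measurable_continuous_onI C1c_continuous C1c_continuous_grad)

lemma C1c_grad_eq_0:
  assumes f: "C1c f D" and K: "closed K" "\<And>x. x \<notin> K \<Longrightarrow> f x = 0" and x: "x \<notin> K"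
  shows "D x = 0"
proof -
  have "((\<lambda>_. 0) has_derivative (\<lambda>h. D x \<bullet> h)) (at x)"
    by (rule has_derivative_transform_within_open[OF C1c_derivative[OF f], where s = "- K"])
        (use K x in auto)
  hence "(\<lambda>h. D x \<bullet> h) = (\<lambda>h. 0)"
    using has_derivative_unique[OF _ has_derivative_const] by blast
  hence "D x \<bullet> D x = 0" by metis
  thus ?thesis by simp
qed

lemma C1c_support:
  assumes "C1c f D"
  obtains b where "b > 0" "\<And>x. norm x \<ge> b \<Longrightarrow> f x = 0" "\<And>x. norm x \<ge> b \<Longrightarrow> D x = 0"
proof -
  obtain b where b: "\<And>x. f x \<noteq> 0 \<Longrightarrow> norm x \<le> b"
    using assms by (auto simp: C1c_def bounded_iff)
  have f_outside: "f x = 0" if "x \<notin> cball 0 b" for x using b[of x] that by auto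
  have "D x = 0" if "x \<notin> cball 0 b" for x
    by (rule C1c_grad_eq_0[OF assms closed_cball f_outside that])
  thus ?thesis using f_outside by (intro that[of "\<bar>b\<bar> + 1"]) auto
qed

lemma bounded_if_continuous_bounded_support:
  fixes g :: "'a::euclidean_space \<Rightarrow> 'b::real_normed_vector"
  assumes continuous: "continuous_on UNIV g" and support: "\<And>x. norm x \<ge> b \<Longrightarrow> g x = 0"
  shows "\<exists>B>0. \<forall>x. norm (g x) \<le> B"
proof -
  have "bounded (g ` cball 0 b)"
    by (intro compact_imp_bounded compact_continuous_image continuous_on_subset[OF continuous]) auto
  then obtain B where B: "\<And>x. x \<in> cball 0 b \<Longrightarrow> norm (g x) \<le> B"
    unfolding bounded_iff by blast
  have "norm (g x) \<le> \<bar>B\<bar> + 1" for x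
    using B[of x] support[of x] by (cases "norm x \<le> b") auto
  thus ?thesis by (intro exI[of _ "\<bar>B\<bar> + 1"]) auto
qed

lemma C1c_bounded:
  assumes "C1c f D"
  obtains B where "B > 0" "\<And>x. \<bar>f x\<bar> \<le> B"
  using C1c_support[OF assms] bounded_if_continuous_bounded_support[OF C1c_continuous[OF assms]]
  by (metis real_norm_def)

lemma C1c_grad_bounded:
  assumes "C1c f D"
  obtains B where "B > 0" "\<And>x. norm (D x) \<le> B"
  using C1c_support[OF assms] bounded_if_continuous_bounded_support[OF C1c_continuous_grad[OF assms]]
  by metis

lemma integrable_bounded_support:
  fixes f :: "'a::euclidean_space \<Rightarrow> 'b::{banach, second_countable_topology}"
  assumes "f \<in> borel_measurable borel" and bound: "\<And>x. norm (f x) \<le> B"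
    and support: "\<And>x. norm x \<ge> b \<Longrightarrow> f x = 0"
  shows "integrable lborel f"
proof (rule Bochner_Integration.integrable_bound)
  show "integrable lborel (\<lambda>x::'a. B * indicator (ball 0 b) x)"
    by (intro integrable_mult_right integrable_indicator_ball)
  show "AE x in lborel. norm (f x) \<le> norm (B * indicator (ball 0 b) x)"
    using support order_trans[OF norm_ge_zero bound] bound
      by (intro AE_I2) (auto simp: indicator_def not_less)
qed (use assms(1) in auto)

lemma C1c_integrable:
  assumes "C1c f D"
  shows "integrable lborel f" "integrable lborel (\<lambda>x. D x \<bullet> e)"
proof -
  obtain b where b: "\<And>x. norm x \<ge> b \<Longrightarrow> f x = 0" "\<And>x. norm x \<ge> b \<Longrightarrow> D x = 0"
    using C1c_support[OF assms] by metis
  obtain B where "\<And>x. norm (f x) \<le> B" using C1c_bounded[OF assms] by (metis real_norm_def)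
  thus "integrable lborel f"
    using b by (intro integrable_bounded_support C1c_borel_measurable[OF assms])
  obtain B' where "\<And>x. norm (D x) \<le> B'" using C1c_grad_bounded[OF assms] by metis
  hence "integrable lborel D"
    using b by (intro integrable_bounded_support C1c_borel_measurable[OF assms])
  thus "integrable lborel (\<lambda>x. D x \<bullet> e)" by simp
qed

lemma C1c_Lipschitz:
  assumes "C1c f D" "\<And>x. norm (D x) \<le> B"
  shows "\<bar>f (x + z) - f x\<bar> \<le> B * norm z"
proof -
  have "norm (f (x + z) - f x) \<le> B * norm (x + z - x)"
  proof (rule differentiable_bound[of UNIV f "\<lambda>x h. D x \<bullet> h"])
    show "onorm (\<lambda>h. D x \<bullet> h) \<le> B" for x
    proof (rule onorm_le)
      fix h show "norm (D x \<bullet> h) \<le> B * norm h"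
        using Cauchy_Schwarz_ineq2[of "D x" h] mult_right_mono[OF assms(2)[of x] norm_ge_zero[of h]] by simp
    qed
  qed (use C1c_derivative[OF assms(1)] in \<open>auto simp: has_derivative_at_withinI\<close>)
  thus ?thesis by simp
qed

lemma nn_integral_translation:
  fixes g :: "'a::euclidean_space \<Rightarrow> ennreal"
  assumes "g \<in> borel_measurable borel"
  shows "(\<integral>\<^sup>+x. g (x + z) \<partial>lborel) = (\<integral>\<^sup>+x. g x \<partial>lborel)"
proof -
  have "(\<integral>\<^sup>+x. g x \<partial>lborel) = (\<integral>\<^sup>+x. g x \<partial>distr lborel borel ((+) z))"
    by (simp add: lborel_distr_plus)
  also have "\<dots> = (\<integral>\<^sup>+x. g (x + z) \<partial>lborel)"
    using assms by (subst nn_integral_distr) (auto simp: add.commute)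
  finally show ?thesis ..
qed

lemma C1c_integral_translation:
  fixes f :: "'a::euclidean_space \<Rightarrow> real"
  assumes f: "C1c f D"
  shows "integrable lborel (\<lambda>x. f (x + z))" "(\<integral>x. f (x + z) \<partial>lborel) = (\<integral>x. f x \<partial>lborel)"
proof -
  note [measurable] = C1c_borel_measurable(1)[OF f]
  have "integrable (distr lborel borel ((+) z)) f"
    using C1c_integrable(1)[OF f] by (simp add: lborel_distr_plus)
  thus "integrable lborel (\<lambda>x. f (x + z))"
    by (subst (asm) integrable_distr_eq) (auto simp: add.commute)
  have "(\<integral>x. f x \<partial>lborel) = (\<integral>x. f x \<partial>distr lborel borel ((+) z))"
    by (simp add: lborel_distr_plus)
  thus "(\<integral>x. f (x + z) \<partial>lborel) = (\<integral>x. f x \<partial>lborel)"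
    by (subst (asm) integral_distr) (auto simp: add.commute)
qed

lemma C1c_directional_difference_quotient:
  fixes f :: "'a::euclidean_space \<Rightarrow> real"
  assumes f: "C1c f D"
  shows "(\<lambda>k. (f (x + e /\<^sub>R real (Suc k)) - f x) * real (Suc k)) \<longlonglongrightarrow> D x \<bullet> e"
proof -
  have "((\<lambda>t. f (x + t *\<^sub>R e)) has_derivative (\<lambda>t. D (x + 0 *\<^sub>R e) \<bullet> (t *\<^sub>R e))) (at 0)"
    by (rule has_derivative_compose[of _ "\<lambda>t. t *\<^sub>R e" _ _ f])
      (use C1c_derivative[OF f] in \<open>auto intro!: derivative_eq_intros\<close>)
  hence "((\<lambda>t. f (x + t *\<^sub>R e)) has_real_derivative (D x \<bullet> e)) (at 0)"
    by (simp add: has_field_derivative_def mult_commute_abs)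
  hence "((\<lambda>t. (f (x + t *\<^sub>R e) - f x) / t) \<longlongrightarrow> D x \<bullet> e) (at 0)"
    by (simp add: DERIV_def)
  moreover have "filterlim (\<lambda>k. inverse (real (Suc k))) (at 0) sequentially"
    unfolding filterlim_at using LIMSEQ_inverse_real_of_nat by (auto intro!: always_eventually)
  ultimately have "(\<lambda>k. (f (x + inverse (real (Suc k)) *\<^sub>R e) - f x) / inverse (real (Suc k))) \<longlonglongrightarrow> D x \<bullet> e"
    by (rule filterlim_compose)
  thus ?thesis by (simp add: divide_inverse)
qed

lemma C1c_integral_grad:
  fixes f :: "'a::euclidean_space \<Rightarrow> real"
  assumes f: "C1c f D"
  shows "(\<integral>x. D x \<bullet> e \<partial>lborel) = 0"
proof -
  define quotient where "quotient k x = (f (x + e /\<^sub>R real (Suc k)) - f x) * real (Suc k)" for k x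
  note [measurable] = C1c_borel_measurable[OF f]
  obtain b where b: "\<And>x. norm x \<ge> b \<Longrightarrow> f x = 0" using C1c_support[OF f] by metis
  obtain B where B: "B > 0" "\<And>x. norm (D x) \<le> B" using C1c_grad_bounded[OF f] by metis
  have quotient_bound: "\<bar>quotient k x\<bar> \<le> B * norm e * indicator (ball 0 (b + norm e)) x" for k x
  proof (cases "norm x < b + norm e")
    case True
    have "\<bar>quotient k x\<bar> \<le> B * norm (e /\<^sub>R real (Suc k)) * real (Suc k)"
      using C1c_Lipschitz[OF f B(2), of x "e /\<^sub>R real (Suc k)"]
      by (simp add: quotient_def abs_mult mult_right_mono del: norm_scaleR of_nat_Suc)
    also have "\<dots> = B * norm e" by (simp del: of_nat_Suc)
    finally show ?thesis using True by simp
  next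
    case False
    have "norm (e /\<^sub>R real (Suc k)) \<le> norm e"
      by (simp add: divide_le_eq mult_le_cancel_left1 flip: divide_inverse_commute)
    moreover have "norm x \<le> norm (x + e /\<^sub>R real (Suc k)) + norm (e /\<^sub>R real (Suc k))"
      by (metis add_diff_cancel_right' norm_triangle_ineq4)
    ultimately have "norm (x + e /\<^sub>R real (Suc k)) \<ge> b" "norm x \<ge> b"
      using False norm_ge_zero[of e] by linarith+
    thus ?thesis using False by (simp add: quotient_def b)
  qed
  have "(\<lambda>k. \<integral>x. quotient k x \<partial>lborel) \<longlonglongrightarrow> (\<integral>x. D x \<bullet> e \<partial>lborel)"
  proof (rule integral_dominated_convergence)
    show "integrable lborel (\<lambda>x. B * norm e * indicator (ball 0 (b + norm e)) x)"
      by (intro integrable_mult_right integrable_indicator_ball)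
    show "AE x in lborel. (\<lambda>k. quotient k x) \<longlonglongrightarrow> D x \<bullet> e"
      unfolding quotient_def using C1c_directional_difference_quotient[OF f] by (intro AE_I2)
    show "AE x in lborel. norm (quotient k x) \<le> B * norm e * indicator (ball 0 (b + norm e)) x" for k
      using quotient_bound[of k] by (intro AE_I2) simp
  qed (auto simp: quotient_def)
  moreover have "(\<integral>x. quotient k x \<partial>lborel) = 0" for k
    using C1c_integral_translation[OF f] C1c_integrable(1)[OF f] by (simp add: quotient_def)
  ultimately show ?thesis by (simp add: LIMSEQ_const_iff)
qed

lemma C1c_abs_diff_le_line_integral:
  fixes f :: "'a::euclidean_space \<Rightarrow> real"
  assumes f: "C1c f D"
  shows "ennreal \<bar>f (x + z) - f x\<bar>
      \<le> (\<integral>\<^sup>+t. ennreal (norm z * norm (D (x + t *\<^sub>R z))) * indicator {0..1} t \<partial>lborel)"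
proof -
  have "continuous_on {0..1} (\<lambda>t. D (x + t *\<^sub>R z))"
    by (rule continuous_on_compose2[OF C1c_continuous_grad[OF f, of UNIV]]) (auto intro!: continuous_intros)
  hence norm_integrable: "(\<lambda>t. norm z * norm (D (x + t *\<^sub>R z))) integrable_on {0..1}"
    by (intro integrable_continuous_real continuous_intros)
  have "((\<lambda>t. D (x + t *\<^sub>R z) \<bullet> z) has_integral (f (x + 1 *\<^sub>R z) - f (x + 0 *\<^sub>R z))) {0..1}"
  proof (rule fundamental_theorem_of_calculus)
    fix t :: real
    have "((\<lambda>t. x + t *\<^sub>R z) has_derivative (\<lambda>s. s *\<^sub>R z)) (at t within {0..1})"
      by (auto intro!: derivative_eq_intros)
    from has_derivative_compose[OF this C1c_derivative[OF f]]
    have "((\<lambda>t. f (x + t *\<^sub>R z)) has_derivative (\<lambda>s. D (x + t *\<^sub>R z) \<bullet> (s *\<^sub>R z))) (at t within {0..1})" .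
    thus "((\<lambda>t. f (x + t *\<^sub>R z)) has_vector_derivative (D (x + t *\<^sub>R z) \<bullet> z)) (at t within {0..1})"
      by (simp add: has_vector_derivative_def)
  qed simp
  hence line_integral: "integral {0..1} (\<lambda>t. D (x + t *\<^sub>R z) \<bullet> z) = f (x + z) - f x"
    "(\<lambda>t. D (x + t *\<^sub>R z) \<bullet> z) integrable_on {0..1}"
    by (auto simp: has_integral_iff)
  have "\<bar>f (x + z) - f x\<bar> \<le> integral {0..1} (\<lambda>t. norm z * norm (D (x + t *\<^sub>R z)))"
    unfolding line_integral(1)[symmetric] real_norm_def[symmetric]
    by (rule integral_norm_bound_integral[OF line_integral(2) norm_integrable])
      (simp add: mult.commute[of "norm z"] Cauchy_Schwarz_ineq2)
  also have "ennreal \<dots> = (\<integral>\<^sup>+t. ennreal (norm z * norm (D (x + t *\<^sub>R z))) * indicator {0..1} t \<partial>lborel)"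
    using integrable_integral[OF norm_integrable]
    by (intro nn_integral_has_integral_lebesgue'[symmetric]) simp_all
  finally show ?thesis by (simp add: ennreal_leI)
qed

lemma C1c_mult:
  fixes v h :: "'a::euclidean_space \<Rightarrow> real"
  assumes v: "C1c v Dv" and K: "closed K" "K \<subseteq> U" "\<And>x. x \<notin> K \<Longrightarrow> v x = 0" and U: "open U"
    and h: "\<And>x. x \<in> U \<Longrightarrow> (h has_derivative (\<lambda>t. Dh x \<bullet> t)) (at x)" and Dh: "continuous_on U Dh"
  shows "C1c (\<lambda>x. v x * h x) (\<lambda>x. v x *\<^sub>R Dh x + h x *\<^sub>R Dv x)"
proof -
  let ?G = "\<lambda>x. v x *\<^sub>R Dh x + h x *\<^sub>R Dv x"
  have Dv_outside: "Dv x = 0" if "x \<notin> K" for x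
    by (rule C1c_grad_eq_0[OF v K(1,3) that])
  have "((\<lambda>x. v x * h x) has_derivative (\<lambda>t. ?G x \<bullet> t)) (at x)" for x
  proof (cases "x \<in> U")
    case True
    show ?thesis
      by (rule has_derivative_eq_rhs[OF has_derivative_mult[OF C1c_derivative[OF v] h[OF True]]])
        (auto simp: fun_eq_iff inner_add_left)
  next
    case False
    hence "x \<in> - K" using K(2) by blast
    moreover have "((\<lambda>_. 0) has_derivative (\<lambda>t. ?G x \<bullet> t)) (at x)"
      using K(3)[of x] Dv_outside[of x] \<open>x \<in> - K\<close> by simp
    ultimately show ?thesis
      using K by (elim has_derivative_transform_within_open[of _ _ _ _ "- K"]) auto
  qed
  moreover have "continuous_on UNIV ?G"
  proof -
    have "continuous_on U h"
      using h by (auto intro!: continuous_at_imp_continuous_on has_derivative_continuous)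
    hence "continuous_on U ?G"
      by (intro continuous_intros Dh C1c_continuous[OF v] C1c_continuous_grad[OF v])
    moreover have "continuous_on (- K) ?G"
      by (rule continuous_on_eq[OF continuous_on_const[of _ 0]]) (use K(3) Dv_outside in auto)
    ultimately have "continuous_on (U \<union> - K) ?G"
      using U K(1) by (intro continuous_on_open_Un) auto
    moreover have "U \<union> - K = UNIV" using K(2) by auto
    ultimately show ?thesis by simp
  qed
  moreover have "bounded {x. v x * h x \<noteq> 0}"
    using v by (auto simp: C1c_def intro: bounded_subset)
  ultimately show ?thesis by (simp add: C1c_def)
qed

lemma frechet_derivative_eq_egrad:
  assumes "f differentiable (at x)"
  shows "frechet_derivative f (at x) h = egrad f x \<bullet> h"
proof -
  interpret linear "frechet_derivative f (at x)"
    by (rule linear_frechet_derivative[OF assms])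
  have "frechet_derivative f (at x) h = frechet_derivative f (at x) (\<Sum>i\<in>UNIV. (h $ i) *\<^sub>R axis i 1)"
    by (simp add: basis_expansion flip: scalar_mult_eq_scaleR)
  also have "\<dots> = (\<Sum>i\<in>UNIV. (h $ i) * frechet_derivative f (at x) (axis i 1))"
    by (simp add: sum scale)
  also have "\<dots> = egrad f x \<bullet> h" by (simp add: egrad_def partial_deriv_def inner_vec_def mult.commute)
  finally show ?thesis .
qed

lemma partial_deriv_eq_inner: "partial_deriv i f x = egrad f x \<bullet> axis i 1"
  by (simp add: egrad_def inner_axis)

lemma C1c_test_fun:
  assumes "test_fun U \<phi>"
  shows "C1c \<phi> (egrad \<phi>)"
proof -
  have smooth: "iter_partial is \<phi> differentiable (at x)" "continuous_on UNIV (iter_partial is \<phi>)" for "is" x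
    using assms by (auto simp: test_fun_def smooth_fun_def)
  have "\<phi> differentiable (at x)" for x using smooth(1)[of "[]"] by simp
  hence "(\<phi> has_derivative (\<lambda>h. egrad \<phi> x \<bullet> h)) (at x)" for x
    using frechet_derivative_works frechet_derivative_eq_egrad by (metis ext)
  moreover have "continuous_on UNIV (partial_deriv i \<phi>)" for i using smooth(2)[of "[i]"] by simp
  hence "continuous_on UNIV (egrad \<phi>)"
    unfolding egrad_def[abs_def] by (intro continuous_on_vec_lambda) auto
  moreover have "bounded {x. \<phi> x \<noteq> 0}"
    using assms unfolding test_fun_def by (meson bounded_subset closure_subset compact_imp_bounded)
  ultimately show ?thesis by (auto simp: C1c_def)
qed

lemma compact_subset_ball_ereal:
  fixes K :: "'a::euclidean_space set" and R :: ereal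
  assumes "compact K" "K \<subseteq> {x. ereal (norm x) < R}" "0 < R"
  obtains b where "0 < b" "ereal b < R" "K \<subseteq> ball 0 b"
proof -
  obtain a where a: "0 \<le> a" "ereal a < R" "K \<subseteq> cball 0 a"
  proof (cases "K = {}")
    case True
    thus ?thesis using that[of 0] assms(3) by (simp add: zero_ereal_def)
  next
    case False
    then obtain x where "x \<in> K" "\<And>y. y \<in> K \<Longrightarrow> norm y \<le> norm x"
      using continuous_attains_sup[OF assms(1), of norm] by (auto intro: continuous_on_norm_id)
    thus ?thesis using assms(2) by (intro that[of "norm x"]) auto
  qed
  obtain b where "ereal a < ereal b" "ereal b < R"
    using ereal_dense2[OF a(2)] by (metis ereal_less_eq(1) less_ereal.simps not_less)
  thus ?thesis using a that[of b] by (auto simp: subset_eq intro: le_less_trans)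
qed

lemma test_fun_support:
  assumes "test_fun {x. ereal (norm x) < R} \<phi>" "0 < R"
  obtains b where "0 < b" "ereal b < R" "\<And>x. norm x \<ge> b \<Longrightarrow> \<phi> x = 0"
proof -
  obtain b where "0 < b" "ereal b < R" "closure {x. \<phi> x \<noteq> 0} \<subseteq> ball 0 b"
    using compact_subset_ball_ereal[of "closure {x. \<phi> x \<noteq> 0}" R] assms by (auto simp: test_fun_def)
  thus ?thesis using that[of b] closure_subset[of "{x. \<phi> x \<noteq> 0}"] by force
qed

section \<open>Weak gradients of radial functions\<close>

definition radial_tail :: "(real \<Rightarrow> real) \<Rightarrow> real \<Rightarrow> 'a::euclidean_space \<Rightarrow> real" where
  "radial_tail k b x = (\<integral>t. (if norm x < t \<and> t < b then k t else 0) \<partial>lborel)"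

definition radial_parts ::
  "('a::euclidean_space \<Rightarrow> real) \<Rightarrow> ('a \<Rightarrow> 'a) \<Rightarrow> 'a \<Rightarrow> real \<Rightarrow> (real \<Rightarrow> real) \<Rightarrow> bool" where
  "radial_parts f D e b k \<longleftrightarrow> (\<integral>x. radial_tail k b x * (D x \<bullet> e) \<partial>lborel)
     = (\<integral>x. k (norm x) * (x \<bullet> e / norm x) * f x \<partial>lborel)"

definition radial_field :: "(real \<Rightarrow> real) \<Rightarrow> 'a::euclidean_space \<Rightarrow> 'a" where
  "radial_field k x = (- k (norm x) / norm x) *\<^sub>R x"

lemma radial_tail_borel_measurable [measurable]:
  assumes [measurable]: "k \<in> borel_measurable borel"
  shows "radial_tail k b \<in> borel_measurable (borel :: 'a::euclidean_space measure)"
  unfolding radial_tail_def[abs_def] by measurable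

lemma radial_tail_eq_0: "b \<le> norm x \<Longrightarrow> radial_tail k b x = 0"
  unfolding radial_tail_def by (rule integral_eq_zero_AE) (auto intro!: AE_I2)

lemma radial_tail_eq_enn2real:
  assumes [measurable]: "k \<in> borel_measurable borel" and "\<And>t. k t \<ge> 0"
  shows "radial_tail k b x = enn2real (\<integral>\<^sup>+t. (if norm x < t \<and> t < b then ennreal (k t) else 0) \<partial>lborel)"
  using assms(2) unfolding radial_tail_def
  by (subst integral_eq_nn_integral) (auto intro!: arg_cong[where f = enn2real] nn_integral_cong)

lemma radial_field_borel_measurable [measurable]:
  assumes [measurable]: "k \<in> borel_measurable borel"
  shows "radial_field k \<in> borel_measurable (borel :: 'a::euclidean_space measure)"
  unfolding radial_field_def[abs_def] by measurable

lemma norm_radial_field: "x \<noteq> 0 \<Longrightarrow> norm (radial_field k x) = \<bar>k (norm x)\<bar>"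
  by (simp add: radial_field_def)

lemma nn_integral_radial_tail:
  fixes k :: "real \<Rightarrow> ennreal"
  assumes [measurable]: "k \<in> borel_measurable borel"
  shows "(\<integral>\<^sup>+x. (\<integral>\<^sup>+t. (if norm (x::'a::euclidean_space) < t \<and> t < b then k t else 0) \<partial>lborel) \<partial>lborel)
    \<le> ennreal b * (\<integral>\<^sup>+x. k (norm x) * indicator (ball (0::'a) b) x \<partial>lborel)"
proof -
  have "(\<integral>\<^sup>+x. (\<integral>\<^sup>+t. (if norm (x::'a) < t \<and> t < b then k t else 0) \<partial>lborel) \<partial>lborel)
      = (\<integral>\<^sup>+t. (\<integral>\<^sup>+x. (if norm (x::'a) < t \<and> t < b then k t else 0) \<partial>lborel) \<partial>lborel)"
    by (rule lborel_pair.Fubini') measurable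
  also have "\<dots> \<le> (\<integral>\<^sup>+t. ennreal b * (k t * indicator {..<b} t
      * (ennreal (sphere_area TYPE('a) t) * indicator {0<..} t)) \<partial>lborel)"
  proof (rule nn_integral_mono)
    fix t :: real
    have "(\<integral>\<^sup>+x. (if norm (x::'a) < t \<and> t < b then k t else 0) \<partial>lborel)
        = (\<integral>\<^sup>+x. k t * indicator {..<b} t * indicator (ball (0::'a) t) x \<partial>lborel)"
      by (intro nn_integral_cong) (auto simp: indicator_def)
    also have "\<dots> = k t * indicator {..<b} t * emeasure lborel (ball (0::'a) t)"
      by (rule nn_integral_cmult_indicator) simp
    also have "\<dots> \<le> ennreal b * (k t * indicator {..<b} t
        * (ennreal (sphere_area TYPE('a) t) * indicator {0<..} t))"
    proof (cases "0 < t \<and> t < b")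
      case True
      have "t * 1 \<le> b * real DIM('a)" using True DIM_positive[where 'a='a] by (intro mult_mono) auto
      moreover have "t ^ DIM('a) = t * t ^ (DIM('a) - 1)" by (simp add: power_eq_if)
      ultimately have "measure lborel (ball (0::'a) 1) * t ^ DIM('a) \<le> b * sphere_area TYPE('a) t"
        using True by (auto simp: sphere_area_def mult.assoc[symmetric] mult.commute[of _ t] mult.commute[of _ b] intro!: mult_right_mono)
      hence "emeasure lborel (ball (0::'a) t) \<le> ennreal b * ennreal (sphere_area TYPE('a) t)"
        using True by (simp add: emeasure_ball_0 ennreal_leI flip: ennreal_mult')
      hence "k t * emeasure lborel (ball (0::'a) t) \<le> k t * (ennreal b * ennreal (sphere_area TYPE('a) t))"
        by (rule mult_left_mono) simp
      thus ?thesis using True by (simp add: mult.left_commute)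
    qed (auto simp: ball_empty)
    finally show "(\<integral>\<^sup>+x. (if norm (x::'a) < t \<and> t < b then k t else 0) \<partial>lborel) \<le> \<dots>" .
  qed
  also have "\<dots> = ennreal b * (\<integral>\<^sup>+x. k (norm x) * indicator {..<b} (norm (x::'a)) \<partial>lborel)"
    by (subst nn_integral_radial[of "\<lambda>t. k t * indicator {..<b} t"])
        (auto simp: nn_integral_cmult mult.assoc)
  also have "(\<integral>\<^sup>+x. k (norm x) * indicator {..<b} (norm (x::'a)) \<partial>lborel)
      = (\<integral>\<^sup>+x. k (norm x) * indicator (ball (0::'a) b) x \<partial>lborel)"
    by (intro nn_integral_cong) (auto simp: indicator_def)
  finally show ?thesis .
qed

lemma integrable_radial_on_ball:
  fixes w :: "real \<Rightarrow> real"
  assumes [measurable]: "w \<in> borel_measurable borel" and "\<And>t. w t \<ge> 0"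
    and "(\<integral>\<^sup>+x. ennreal (w (norm x)) * indicator (ball (0::'a::euclidean_space) b) x \<partial>lborel) < \<infinity>"
  shows "integrable lborel (\<lambda>x::'a. w (norm x) * indicator (ball 0 b) x)"
  using assms by (intro integrableI_bounded) (auto simp: ennreal_mult'' ennreal_indicator abs_mult)

lemma DERIV_primitive_vanishing_near_0:
  fixes k :: "real \<Rightarrow> real"
  assumes "continuous_on UNIV k" "\<delta> > 0" "\<And>t. t \<le> \<delta> \<Longrightarrow> k t = 0"
  shows "((\<lambda>r. integral {0..r} k) has_real_derivative k r) (at r)"
proof (cases "r < \<delta>")
  case True
  have "integral {0..r'} k = 0" if "r' < \<delta>" for r'
  proof -
    have "integral {0..r'} k = integral {0..r'} (\<lambda>_. 0)"
      using that assms(3) by (intro integral_cong) auto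
    thus ?thesis by simp
  qed
  hence "((\<lambda>r. integral {0..r} k) has_real_derivative 0) (at r)"
    using True
    by (intro has_field_derivative_transform_within_open[OF DERIV_const, where S = "{..<\<delta>}"]) simp_all
  thus ?thesis using True assms(3) by simp
next
  case False
  have "((\<lambda>r. integral {0..r} k) has_real_derivative k r) (at r within {0..r + 1})"
    using False assms(1,2) by (intro integral_has_real_derivative continuous_on_subset[OF assms(1)]) auto
  moreover have "r \<in> interior {0..r + 1}" using False assms(2) by auto
  ultimately show ?thesis using at_within_interior by metis
qed

lemma C1_radial:
  fixes P k :: "real \<Rightarrow> real" and x :: "'a::euclidean_space"
  assumes "\<And>r. (P has_real_derivative k r) (at r)" "continuous_on UNIV k"
    and "\<delta> > 0" "\<And>t. t \<le> \<delta> \<Longrightarrow> k t = 0"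
  shows "((\<lambda>x. P (norm x)) has_derivative (\<lambda>h. ((k (norm x) / norm x) *\<^sub>R x) \<bullet> h)) (at x)"
    and "continuous_on UNIV (\<lambda>x::'a. (k (norm x) / norm x) *\<^sub>R x)"
proof -
  have "(P has_real_derivative 0) (at r within {0..\<delta>})" if "r \<in> {0..\<delta>}" for r
    using assms(1)[of r] assms(4)[of r] that by (auto intro: has_field_derivative_at_within)
  hence "\<exists>c. \<forall>r\<in>{0..\<delta>}. P r = c"
    by (intro has_field_derivative_zero_constant) auto
  hence P_const: "P r = P 0" if "0 \<le> r" "r \<le> \<delta>" for r
    using that assms(3) by (metis atLeastAtMost_iff less_imp_le order_refl)
  show "((\<lambda>x. P (norm x)) has_derivative (\<lambda>h. ((k (norm x) / norm x) *\<^sub>R x) \<bullet> h)) (at x)"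
  proof (cases "x = 0")
    case True
    have "((\<lambda>_. P 0) has_derivative (\<lambda>h. ((k (norm x) / norm x) *\<^sub>R x) \<bullet> h)) (at x)"
      using True by simp
    moreover have "P 0 = P (norm y)" if "y \<in> ball 0 \<delta>" for y :: 'a
      using P_const[of "norm y"] that by simp
    ultimately show ?thesis
      using True assms(3) by (elim has_derivative_transform_within_open[where s = "ball 0 \<delta>"]) auto
  next
    case False
    have "(norm has_derivative (\<lambda>h. sgn x \<bullet> h)) (at x)"
      using has_derivative_norm[OF False] by (simp add: inner_commute)
    from has_derivative_compose[OF this] assms(1)[of "norm x"]
    have "((\<lambda>x. P (norm x)) has_derivative (\<lambda>h. k (norm x) * (sgn x \<bullet> h))) (at x)"
      by (simp add: has_field_derivative_def)
    thus ?thesis by (simp add: sgn_div_norm divide_inverse mult.assoc)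
  qed
  have "continuous_on (ball 0 \<delta>) (\<lambda>x::'a. (k (norm x) / norm x) *\<^sub>R x)"
    by (rule continuous_on_eq[OF continuous_on_const[of _ 0]]) (use assms(4) in auto)
  moreover have "continuous_on (- {0}) (\<lambda>x::'a. (k (norm x) / norm x) *\<^sub>R x)"
    by (intro continuous_intros continuous_on_compose2[OF assms(2)]) auto
  ultimately have "continuous_on (ball 0 \<delta> \<union> - {0}) (\<lambda>x::'a. (k (norm x) / norm x) *\<^sub>R x)"
    by (intro continuous_on_open_Un) auto
  moreover have "ball 0 \<delta> \<union> - {0} = (UNIV :: 'a set)" using assms(3) by auto
  ultimately show "continuous_on UNIV (\<lambda>x::'a. (k (norm x) / norm x) *\<^sub>R x)" by simp
qed

lemma radial_tail_eq_primitive: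
  assumes "\<And>r. (P has_real_derivative k r) (at r)" "continuous_on UNIV k" "norm x \<le> b"
  shows "radial_tail k b x = P b - P (norm x)"
proof -
  have "radial_tail k b x = (\<integral>t. k t * indicator {norm x..b} t \<partial>lborel)"
    unfolding radial_tail_def
  proof (rule integral_cong_AE)
    show "AE t in lborel. (if norm x < t \<and> t < b then k t else 0) = k t * indicator {norm x..b} t"
      using AE_lborel_singleton[of "norm x"] AE_lborel_singleton[of b]
      by eventually_elim (auto simp: indicator_def)
  qed (use borel_measurable_continuous_onI[OF assms(2)] in measurable)
  also have "\<dots> = P b - P (norm x)"
    using assms by (intro integral_FTC_Icc_real) (auto simp: continuous_on_eq_continuous_at)
  finally show ?thesis .
qed

lemma radial_parts_continuous:
  fixes f :: "'a::euclidean_space \<Rightarrow> real"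
  assumes f: "C1c f D" and support: "\<And>x. norm x \<ge> b \<Longrightarrow> f x = 0"
    and k: "continuous_on UNIV k" "\<delta> > 0" "\<And>t. t \<le> \<delta> \<Longrightarrow> k t = 0"
  shows "radial_parts f D e b k"
proof -
  define P where "P r = integral {0..r} k" for r
  define Dg where "Dg x = (k (norm x) / norm x) *\<^sub>R x" for x :: 'a
  have DERIV_P: "(P has_real_derivative k r) (at r)" for r
    unfolding P_def by (rule DERIV_primitive_vanishing_near_0[OF k])
  have product: "C1c (\<lambda>x. f x * P (norm x)) (\<lambda>x. f x *\<^sub>R Dg x + P (norm x) *\<^sub>R D x)"
    unfolding Dg_def using C1_radial[OF DERIV_P k] by (intro C1c_mult[OF f closed_UNIV]) auto
  have D_outside: "D x = 0" if "norm x > b" for x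
    by (rule C1c_grad_eq_0[OF f closed_cball[of 0 b]]) (use support that in auto)
  have "continuous_on UNIV (\<lambda>x::'a. P (norm x))"
    by (rule continuous_on_compose2[OF DERIV_continuous_on[OF has_field_derivative_at_within[OF DERIV_P]] continuous_on_norm_id]) auto
  hence continuous: "continuous_on UNIV (\<lambda>x. P (norm x) * (D x \<bullet> e))"
    by (intro continuous_intros C1c_continuous_grad[OF f])
  have "\<exists>B>0. \<forall>x. norm (P (norm x) * (D x \<bullet> e)) \<le> B"
    by (rule bounded_if_continuous_bounded_support[OF continuous, of "b + 1"]) (use D_outside in auto)
  then obtain B where "\<And>x. norm (P (norm x) * (D x \<bullet> e)) \<le> B" by blast
  hence PD_integrable: "integrable lborel (\<lambda>x. P (norm x) * (D x \<bullet> e))"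
    using D_outside borel_measurable_continuous_onI[OF continuous]
    by (intro integrable_bounded_support[of _ B "b + 1"]) auto
  have "radial_tail k b x * (D x \<bullet> e) = P b * (D x \<bullet> e) - P (norm x) * (D x \<bullet> e)" for x
    using radial_tail_eq_primitive[OF DERIV_P k(1), of x b] D_outside[of x]
    by (cases "norm x \<le> b") (auto simp: left_diff_distrib)
  hence "(\<integral>x. radial_tail k b x * (D x \<bullet> e) \<partial>lborel) = - (\<integral>x. P (norm x) * (D x \<bullet> e) \<partial>lborel)"
    using PD_integrable C1c_integrable(2)[OF f, of e] C1c_integral_grad[OF f, of e] by simp
  also have "\<dots> = (\<integral>x. (f x *\<^sub>R Dg x + P (norm x) *\<^sub>R D x) \<bullet> e \<partial>lborel)
      - (\<integral>x. P (norm x) * (D x \<bullet> e) \<partial>lborel)"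
    using C1c_integral_grad[OF product, of e] by simp
  also have "\<dots> = (\<integral>x. (f x *\<^sub>R Dg x + P (norm x) *\<^sub>R D x) \<bullet> e - P (norm x) * (D x \<bullet> e) \<partial>lborel)"
    using C1c_integrable(2)[OF product, of e] PD_integrable by simp
  also have "\<dots> = (\<integral>x. k (norm x) * (x \<bullet> e / norm x) * f x \<partial>lborel)"
    by (simp add: inner_add_left Dg_def mult_ac)
  finally show ?thesis by (simp add: radial_parts_def)
qed

lemma radial_tail_dominated:
  fixes w :: "real \<Rightarrow> real"
  assumes [measurable]: "w \<in> borel_measurable borel" and nonneg: "\<And>t. w t \<ge> 0"
    and finite: "(\<integral>\<^sup>+x. ennreal (w (norm x)) * indicator (ball (0::'a::euclidean_space) b) x \<partial>lborel) < \<infinity>"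
  shows "integrable lborel (radial_tail w b :: 'a \<Rightarrow> real)"
    and "AE x::'a in lborel. integrable lborel (\<lambda>t. if norm x < t \<and> t < b then w t else 0)"
proof -
  define W where "W x = (\<integral>\<^sup>+t. (if norm x < t \<and> t < b then ennreal (w t) else 0) \<partial>lborel)" for x :: 'a
  have [measurable]: "W \<in> borel_measurable borel" unfolding W_def by measurable
  have "(\<integral>\<^sup>+x. W x \<partial>lborel)
      \<le> ennreal b * (\<integral>\<^sup>+x. ennreal (w (norm x)) * indicator (ball (0::'a) b) x \<partial>lborel)"
    unfolding W_def by (rule nn_integral_radial_tail) measurable
  also have "\<dots> < \<infinity>" using finite by (simp add: ennreal_mult_less_top)
  finally have W_integral: "(\<integral>\<^sup>+x. W x \<partial>lborel) < \<infinity>" .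
  hence W_finite: "AE x in lborel. W x < \<infinity>"
    using nn_integral_PInf_AE[of W lborel] by (auto simp: less_top elim: eventually_mono)
  have tail_eq: "radial_tail w b x = enn2real (W x)" for x
    unfolding W_def by (rule radial_tail_eq_enn2real[OF assms(1) nonneg])
  have "(\<integral>\<^sup>+x. ennreal (radial_tail w b (x::'a)) \<partial>lborel) \<le> (\<integral>\<^sup>+x. W x \<partial>lborel)"
    by (intro nn_integral_mono) (simp add: tail_eq ennreal_enn2real_if)
  hence "(\<integral>\<^sup>+x. ennreal (radial_tail w b (x::'a)) \<partial>lborel) < \<infinity>"
    using W_integral by (rule le_less_trans)
  thus "integrable lborel (radial_tail w b :: 'a \<Rightarrow> real)"
    by (intro integrableI_nonneg) (auto simp: tail_eq)
  show "AE x::'a in lborel. integrable lborel (\<lambda>t. if norm x < t \<and> t < b then w t else 0)"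
    using W_finite
  proof eventually_elim
    case (elim x)
    thus ?case using nonneg unfolding W_def
      by (intro integrableI_bounded) (auto simp: if_distrib cong: if_cong)
  qed
qed

lemma abs_radial_tail_le:
  assumes [measurable]: "k \<in> borel_measurable borel" and bound: "\<And>t. \<bar>k t\<bar> \<le> w t"
    and w: "integrable lborel (\<lambda>t. if norm x < t \<and> t < b then w t else 0)"
  shows "\<bar>radial_tail k b x\<bar> \<le> radial_tail w b x"
proof -
  have "norm (if norm x < t \<and> t < b then k t else 0) \<le> norm (if norm x < t \<and> t < b then w t else 0)" for t
    using bound[of t] by auto
  hence "integrable lborel (\<lambda>t. if norm x < t \<and> t < b then k t else 0)"
    by (intro Bochner_Integration.integrable_bound[OF w] AE_I2) measurable
  thus ?thesis unfolding radial_tail_def using bound w by (intro integral_abs_bound_integral) auto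
qed

lemma radial_tail_tendsto:
  assumes [measurable]: "\<And>j. kj j \<in> borel_measurable borel" "k \<in> borel_measurable borel"
    and limit: "AE t in lborel. 0 < t \<longrightarrow> (\<lambda>j. kj j t) \<longlonglongrightarrow> k t"
    and bound: "\<And>j t. \<bar>kj j t\<bar> \<le> w t"
    and w: "integrable lborel (\<lambda>t. if norm x < t \<and> t < b then w t else 0)"
  shows "(\<lambda>j. radial_tail (kj j) b x) \<longlonglongrightarrow> radial_tail k b x"
  unfolding radial_tail_def
proof (rule integral_dominated_convergence[OF _ _ w])
  show "AE t in lborel. (\<lambda>j. if norm x < t \<and> t < b then kj j t else 0)
      \<longlonglongrightarrow> (if norm x < t \<and> t < b then k t else 0)"
    using limit by eventually_elim (auto intro: le_less_trans[OF norm_ge_zero])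
qed (use bound in auto)

lemma integral_radial_component_tendsto:
  fixes f :: "'a::euclidean_space \<Rightarrow> real" and k w :: "real \<Rightarrow> real"
  assumes [measurable]: "f \<in> borel_measurable borel"
    and f_bound: "\<And>x. \<bar>f x\<bar> \<le> B" "B \<ge> 0" and support: "\<And>x. norm x \<ge> b \<Longrightarrow> f x = 0"
    and [measurable]: "\<And>j. kj j \<in> borel_measurable borel" "k \<in> borel_measurable borel"
        "w \<in> borel_measurable borel"
    and limit: "AE t in lborel. 0 < t \<longrightarrow> (\<lambda>j. kj j t) \<longlonglongrightarrow> k t"
    and bound: "\<And>j t. \<bar>kj j t\<bar> \<le> w t" and w_nonneg: "\<And>t. w t \<ge> 0"
    and w_finite: "(\<integral>\<^sup>+x. ennreal (w (norm x)) * indicator (ball (0::'a) b) x \<partial>lborel) < \<infinity>"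
  shows "(\<lambda>j. \<integral>x. kj j (norm x) * (x \<bullet> e / norm x) * f x \<partial>lborel)
      \<longlonglongrightarrow> (\<integral>x. k (norm x) * (x \<bullet> e / norm x) * f x \<partial>lborel)"
proof (rule integral_dominated_convergence)
  have "integrable lborel (\<lambda>x::'a. w (norm x) * indicator (ball 0 b) x)"
    by (intro integrable_radial_on_ball w_nonneg w_finite) measurable
  thus "integrable lborel (\<lambda>x::'a. w (norm x) * indicator (ball 0 b) x * (norm e * B))" by simp
  have "AE x::'a in lborel. 0 < norm x \<longrightarrow> (\<lambda>j. kj j (norm x)) \<longlonglongrightarrow> k (norm x)"
    by (rule AE_norm[OF limit])
  thus "AE x in lborel. (\<lambda>j. kj j (norm x) * (x \<bullet> e / norm x) * f x) \<longlonglongrightarrow> k (norm x) * (x \<bullet> e / norm x) * f x"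
    using AE_lborel_singleton[of "0::'a"] by eventually_elim (intro tendsto_mult_right, simp)
  have component_bound: "\<bar>x \<bullet> e / norm x\<bar> \<le> norm e" for x :: 'a
    using Cauchy_Schwarz_ineq2[of x e] by (cases "x = 0") (auto simp: abs_mult divide_le_eq mult.commute)
  show "AE x in lborel. norm (kj j (norm x) * (x \<bullet> e / norm x) * f x)
      \<le> w (norm x) * indicator (ball 0 b) x * (norm e * B)" for j
  proof (intro AE_I2)
    fix x :: 'a
    have "\<bar>kj j (norm x)\<bar> * (\<bar>x \<bullet> e / norm x\<bar> * \<bar>f x\<bar>) \<le> w (norm x) * (norm e * B)"
      using bound f_bound w_nonneg component_bound[of x] by (intro mult_mono) auto
    thus "norm (kj j (norm x) * (x \<bullet> e / norm x) * f x)
        \<le> w (norm x) * indicator (ball 0 b) x * (norm e * B)"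
      using support[of x] by (auto simp: abs_mult indicator_def mult_ac not_less)
  qed
qed measurable

lemma radial_parts_limit:
  fixes f :: "'a::euclidean_space \<Rightarrow> real" and k w :: "real \<Rightarrow> real"
  assumes f: "C1c f D" and support: "\<And>x. norm x \<ge> b \<Longrightarrow> f x = 0"
    and kj [measurable]: "\<And>j. kj j \<in> borel_measurable borel"
    and k [measurable]: "k \<in> borel_measurable borel" and w [measurable]: "w \<in> borel_measurable borel"
    and limit: "AE t in lborel. 0 < t \<longrightarrow> (\<lambda>j. kj j t) \<longlonglongrightarrow> k t"
    and bound: "\<And>j t. \<bar>kj j t\<bar> \<le> w t"
    and w_finite: "(\<integral>\<^sup>+x. ennreal (w (norm x)) * indicator (ball (0::'a) b) x \<partial>lborel) < \<infinity>"
    and parts: "\<And>j. radial_parts f D e b (kj j)"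
  shows "radial_parts f D e b k"
proof -
  note [measurable] = C1c_borel_measurable[OF f]
  obtain B where B: "B > 0" "\<And>x. \<bar>f x\<bar> \<le> B" using C1c_bounded[OF f] by metis
  obtain B' where B': "B' > 0" "\<And>x. norm (D x) \<le> B'" using C1c_grad_bounded[OF f] by metis
  have De_bound: "\<bar>D x \<bullet> e\<bar> \<le> B' * norm e" for x
    using Cauchy_Schwarz_ineq2[of "D x" e] mult_right_mono[OF B'(2)[of x] norm_ge_zero[of e]] by linarith
  have w_nonneg: "w t \<ge> 0" for t using bound[of 0 t] by linarith
  note tail_dominated = radial_tail_dominated[OF w w_nonneg w_finite]
  have "(\<lambda>j. \<integral>x. radial_tail (kj j) b x * (D x \<bullet> e) \<partial>lborel) \<longlonglongrightarrow> (\<integral>x. radial_tail k b x * (D x \<bullet> e) \<partial>lborel)"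
  proof (rule integral_dominated_convergence)
    show "integrable lborel (\<lambda>x::'a. radial_tail w b x * (B' * norm e))" using tail_dominated(1) by simp
    show "AE x in lborel. (\<lambda>j. radial_tail (kj j) b x * (D x \<bullet> e)) \<longlonglongrightarrow> radial_tail k b x * (D x \<bullet> e)"
      using tail_dominated(2) by eventually_elim
          (intro tendsto_mult_right radial_tail_tendsto[OF kj k limit bound])
    show "AE x in lborel. norm (radial_tail (kj j) b x * (D x \<bullet> e)) \<le> radial_tail w b x * (B' * norm e)"
      for j
      using tail_dominated(2)
    proof eventually_elim
      case (elim x)
      have "\<bar>radial_tail (kj j) b x\<bar> \<le> radial_tail w b x" by (rule abs_radial_tail_le[OF kj bound elim])
      thus ?case using De_bound[of x]
        by (auto simp: abs_mult intro!: mult_mono intro: order_trans[OF abs_ge_zero])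
    qed
  qed measurable
  moreover have "(\<lambda>j. \<integral>x. kj j (norm x) * (x \<bullet> e / norm x) * f x \<partial>lborel)
      \<longlonglongrightarrow> (\<integral>x. k (norm x) * (x \<bullet> e / norm x) * f x \<partial>lborel)"
    by (rule integral_radial_component_tendsto[OF _ B(2) less_imp_le[OF B(1)] support kj k w limit bound w_nonneg w_finite]) measurable
  ultimately show ?thesis
    using parts unfolding radial_parts_def by (auto intro: LIMSEQ_unique)
qed

lemma radial_parts_bounded:
  fixes f :: "'a::euclidean_space \<Rightarrow> real" and k :: "real \<Rightarrow> real"
  assumes f: "C1c f D" and support: "\<And>x. norm x \<ge> b \<Longrightarrow> f x = 0"
    and [measurable]: "k \<in> borel_measurable borel" and bound: "\<And>t. 0 \<le> k t" "\<And>t. k t \<le> M"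
  shows "radial_parts f D e b k"
proof -
  have "k measurable_on UNIV"
    by (rule lebesgue_measurable_imp_measurable_on_real) (auto intro: measurable_completion)
  then obtain N g where N: "negligible N" and g: "\<And>j. continuous_on UNIV (g j)"
    and g_limit: "\<And>t. t \<notin> N \<Longrightarrow> (\<lambda>j. g j t) \<longlonglongrightarrow> k t"
    by (auto simp: measurable_on_def)
  define kj where "kj j t = min 1 (max 0 (real (Suc j) * t - 1)) * max 0 (min M (g j t))" for j t
  have kj_continuous: "continuous_on UNIV (kj j)" for j
    unfolding kj_def by (intro continuous_intros g)
  show ?thesis
  proof (rule radial_parts_limit[OF f support, where kj = kj and w = "\<lambda>_. M"])
    show "kj j \<in> borel_measurable borel" for j
      by (rule borel_measurable_continuous_onI[OF kj_continuous])
    have "AE t in lebesgue. t \<notin> N" using N by (auto simp: negligible_iff_null_sets intro: AE_not_in)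
    hence "AE t in lborel. t \<notin> N" by (rule AE_completion_iff[THEN iffD1])
    thus "AE t in lborel. 0 < t \<longrightarrow> (\<lambda>j. kj j t) \<longlonglongrightarrow> k t"
    proof eventually_elim
      case (elim t)
      have "(\<lambda>j. kj j t) \<longlonglongrightarrow> 1 * max 0 (min M (k t))" if "t > 0"
        unfolding kj_def
      proof (intro tendsto_mult tendsto_max tendsto_min tendsto_const g_limit[OF elim])
        have "\<forall>\<^sub>F j in sequentially. 2 / t \<le> real (Suc j)"
          by real_asymp
        hence "\<forall>\<^sub>F j in sequentially. min 1 (max 0 (real (Suc j) * t - 1)) = 1"
          by eventually_elim (use that in \<open>simp add: divide_le_eq del: of_nat_Suc\<close>)
        thus "(\<lambda>j. min 1 (max 0 (real (Suc j) * t - 1))) \<longlonglongrightarrow> 1" by (rule tendsto_eventually)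
      qed
      thus ?case using bound[of t] by simp
    qed
    have "0 \<le> M" using bound[of 0] by linarith
    thus "\<bar>kj j t\<bar> \<le> M" for j t
      using mult_mono[of "min 1 (max 0 (real (Suc j) * t - 1))" 1 "max 0 (min M (g j t))" M]
        by (simp add: kj_def abs_mult)
    show "(\<integral>\<^sup>+x. ennreal M * indicator (ball (0::'a) b) x \<partial>lborel) < \<infinity>"
      using emeasure_lborel_ball_finite[of "0::'a" b]
        by (simp add: nn_integral_cmult_indicator ennreal_mult_less_top)
    show "radial_parts f D e b (kj j)" for j
    proof (rule radial_parts_continuous[OF f support kj_continuous, where \<delta> = "1 / real (Suc j)"])
      show "kj j t = 0" if "t \<le> 1 / real (Suc j)" for t
        using that by (simp add: kj_def field_simps)
    qed auto
  qed auto
qed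

lemma radial_parts_nonneg:
  fixes f :: "'a::euclidean_space \<Rightarrow> real" and k :: "real \<Rightarrow> real"
  assumes f: "C1c f D" and support: "\<And>x. norm x \<ge> b \<Longrightarrow> f x = 0"
    and [measurable]: "k \<in> borel_measurable borel" and nonneg: "\<And>t. 0 \<le> k t"
    and finite: "(\<integral>\<^sup>+x. ennreal (k (norm x)) * indicator (ball (0::'a) b) x \<partial>lborel) < \<infinity>"
  shows "radial_parts f D e b k"
proof (rule radial_parts_limit[OF f support, where kj = "\<lambda>j t. min (real j) (k t)" and w = k])
  show "AE t in lborel. 0 < t \<longrightarrow> (\<lambda>j. min (real j) (k t)) \<longlonglongrightarrow> k t"
  proof (intro AE_I2 impI tendsto_eventually)
    fix t :: real
    show "\<forall>\<^sub>F j in sequentially. min (real j) (k t) = k t"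
      using eventually_ge_at_top[of "nat \<lceil>k t\<rceil>"] by eventually_elim (auto simp: min_def)
  qed
  show "radial_parts f D e b (\<lambda>t. min (real j) (k t))" for j
    by (rule radial_parts_bounded[OF f support, where M = "real j"]) (use nonneg in auto)
qed (use nonneg finite in auto)

lemma lebesgue_integral_punctured:
  fixes f g :: "'a::euclidean_space \<Rightarrow> real"
  assumes [measurable]: "g \<in> borel_measurable borel" and agree: "\<And>x. x \<noteq> 0 \<Longrightarrow> f x = g x"
  shows "integrable lebesgue f \<longleftrightarrow> integrable lborel g" "(\<integral>x. f x \<partial>lebesgue) = (\<integral>x. g x \<partial>lborel)"
proof -
  have "f = (\<lambda>x. if x = 0 then f 0 else g x)" using agree by auto
  moreover have "(\<lambda>x. if x = 0 then f 0 else g x) \<in> borel_measurable borel" by measurable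
  ultimately have [measurable]: "f \<in> borel_measurable borel" by metis
  have "AE x in lborel. f x = g x"
    using AE_lborel_singleton[of "0::'a"] by eventually_elim (rule agree)
  thus "integrable lebesgue f \<longleftrightarrow> integrable lborel g" "(\<integral>x. f x \<partial>lebesgue) = (\<integral>x. g x \<partial>lborel)"
    using integrable_cong_AE[of f lborel g] integral_cong_AE[of f lborel g]
    by (simp_all add: integrable_completion integral_completion)
qed

text \<open>The domain is the ball of radius \<open>R\<close>, or the whole space for \<open>R = \<infinity>\<close>.\<close>
locale radial_profile =
  fixes F k :: "real \<Rightarrow> real" and f :: "real^'n::finite \<Rightarrow> real" and R :: ereal
  assumes R_pos: "0 < R"
    and k_measurable [measurable]: "k \<in> borel_measurable borel"
    and f_eq: "\<And>x. x \<noteq> 0 \<Longrightarrow> ereal (norm x) < R \<Longrightarrow> f x = F (norm x)"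
    and k_nonneg: "\<And>r. 0 < r \<Longrightarrow> ereal r < R \<Longrightarrow> k r \<ge> 0"
    and k_finite: "\<And>b. 0 < b \<Longrightarrow> ereal b < R \<Longrightarrow>
      (\<integral>\<^sup>+x. ennreal (k (norm x)) * indicator (ball (0::real^'n) b) x \<partial>lborel) < \<infinity>"
    and F_diff: "\<And>r b. 0 < r \<Longrightarrow> r < b \<Longrightarrow> ereal b < R \<Longrightarrow>
      F b \<le> F r \<and> (\<integral>\<^sup>+t. ennreal (k t) * indicator {r<..<b} t \<partial>lborel) = ennreal (F r - F b)"
begin

definition trunc :: "real \<Rightarrow> real \<Rightarrow> real" where
  "trunc b t = (if 0 < t \<and> t < b then k t else 0)"

lemma trunc_measurable [measurable]: "trunc b \<in> borel_measurable borel"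
  unfolding trunc_def by measurable

lemma trunc_nonneg: "ereal b < R \<Longrightarrow> trunc b t \<ge> 0"
  using k_nonneg[of t] less_trans[of "ereal t" "ereal b" R] by (auto simp: trunc_def)

lemma trunc_finite:
  assumes "0 < b" "ereal b < R"
  shows "(\<integral>\<^sup>+x. ennreal (trunc b (norm x)) * indicator (ball (0::real^'n) b) x \<partial>lborel) < \<infinity>"
  by (rule le_less_trans[OF nn_integral_mono k_finite[OF assms]]) (auto simp: trunc_def indicator_def)

lemma radial_tail_trunc:
  assumes "x \<noteq> 0" "norm (x::real^'n) \<le> b" "ereal b < R"
  shows "radial_tail (trunc b) b x = f x - F b"
proof (cases "norm x < b")
  case True
  have "ereal (norm x) < R" using True assms(3) by (auto intro: less_trans[of _ "ereal b"])
  hence fx: "f x = F (norm x)" using f_eq assms(1) by blast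
  have "(\<integral>\<^sup>+t. (if norm x < t \<and> t < b then ennreal (trunc b t) else 0) \<partial>lborel)
      = (\<integral>\<^sup>+t. ennreal (k t) * indicator {norm x<..<b} t \<partial>lborel)"
    using norm_ge_zero[of x] by (intro nn_integral_cong)
        (auto simp: trunc_def indicator_def simp del: norm_ge_zero)
  also have "\<dots> = ennreal (F (norm x) - F b)" using F_diff[of "norm x" b] True assms by simp
  finally show ?thesis
    using F_diff[of "norm x" b] True assms
    by (simp add: fx radial_tail_eq_enn2real[OF trunc_measurable trunc_nonneg[OF assms(3)]])
qed (use assms f_eq[of x] in \<open>auto simp: radial_tail_eq_0\<close>)

lemma integrable_radial_tail_trunc:
  assumes "0 < b" "ereal b < R"
  shows "integrable lborel (\<lambda>x::real^'n. radial_tail (trunc b) b x)"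
proof (rule integrableI_bounded)
  have "(\<integral>\<^sup>+x. ennreal (norm (radial_tail (trunc b) b (x::real^'n))) \<partial>lborel)
      \<le> (\<integral>\<^sup>+x. (\<integral>\<^sup>+t. (if norm (x::real^'n) < t \<and> t < b then ennreal (trunc b t) else 0) \<partial>lborel) \<partial>lborel)"
    by (intro nn_integral_mono)
      (simp add: radial_tail_eq_enn2real[OF trunc_measurable trunc_nonneg[OF assms(2)]] ennreal_enn2real_if)
  also have "\<dots> < \<infinity>"
    by (rule le_less_trans[OF nn_integral_radial_tail[of "\<lambda>t. ennreal (trunc b t)" b]])
      (use trunc_finite[OF assms] in \<open>auto simp: ennreal_mult_less_top\<close>)
  finally show "(\<integral>\<^sup>+x. ennreal (norm (radial_tail (trunc b) b (x::real^'n))) \<partial>lborel) < \<infinity>" .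
qed measurable

lemma set_integrable_f:
  assumes K: "compact K" "K \<subseteq> {x. ereal (norm x) < R}"
  shows "set_integrable lebesgue K f"
proof -
  obtain b where b: "0 < b" "ereal b < R" "K \<subseteq> ball 0 b"
    using compact_subset_ball_ereal[OF K R_pos] .
  have K_borel [measurable]: "K \<in> sets borel" using K(1) by (simp add: compact_imp_closed borel_closed)
  define g where "g x = indicator K x * (radial_tail (trunc b) b x + F b)" for x
  have "integrable lborel (\<lambda>x. indicator K x *\<^sub>R (radial_tail (trunc b) b x
      + F b * indicator (ball 0 b) x))"
    using b by (intro integrable_mult_indicator Bochner_Integration.integrable_add
        integrable_radial_tail_trunc integrable_mult_right integrable_indicator_ball) auto
  also have "(\<lambda>x. indicator K x *\<^sub>R (radial_tail (trunc b) b x + F b * indicator (ball 0 b) x)) = g"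
    using b(3) by (auto simp: g_def fun_eq_iff indicator_def)
  finally have "integrable lborel g" .
  moreover have "indicator K x *\<^sub>R f x = g x" if "x \<noteq> 0" for x
    using radial_tail_trunc[OF that, of b] b by (auto simp: g_def indicator_def)
  moreover have "g \<in> borel_measurable borel" unfolding g_def by measurable
  ultimately show ?thesis
    unfolding set_integrable_def by (subst lebesgue_integral_punctured(1)[of g]) auto
qed

lemma set_integrable_radial_field:
  assumes K: "compact K" "K \<subseteq> {x::real^'n. ereal (norm x) < R}"
  shows "set_integrable lebesgue K (\<lambda>x. radial_field k x $ i)"
proof -
  obtain b where b: "0 < b" "ereal b < R" "K \<subseteq> ball 0 b"
    using compact_subset_ball_ereal[OF K R_pos] .
  have [measurable]: "K \<in> sets borel" using K(1) by (simp add: compact_imp_closed borel_closed)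
  have [measurable]: "(\<lambda>x::real^'n. radial_field k x $ i) \<in> borel_measurable borel"
    by (intro measurable_compose[OF radial_field_borel_measurable[OF k_measurable]]
        borel_measurable_continuous_onI continuous_intros)
  have "integrable lborel (\<lambda>x. indicator K x *\<^sub>R (radial_field k x $ i))"
  proof (rule Bochner_Integration.integrable_bound)
    show "integrable lborel (\<lambda>x::real^'n. trunc b (norm x) * indicator (ball 0 b) x)"
      using trunc_finite[OF b(1,2)] trunc_nonneg[OF b(2)] by (intro integrable_radial_on_ball) auto
    show "AE x in lborel. norm (indicator K x *\<^sub>R (radial_field k x $ i))
        \<le> norm (trunc b (norm x) * indicator (ball 0 b) x)"
      using AE_lborel_singleton[of "0::real^'n"]
    proof eventually_elim
      case (elim x)
      have "\<bar>radial_field k x $ i\<bar> \<le> \<bar>k (norm x)\<bar>"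
        using component_le_norm_cart[of "radial_field k x" i] elim by (simp add: norm_radial_field)
      thus ?case using b(3) elim by (auto simp: indicator_def trunc_def)
    qed
  qed measurable
  thus ?thesis unfolding set_integrable_def by (subst integrable_completion) auto
qed

lemma integral_f_partial_deriv:
  assumes \<phi>: "test_fun {x. ereal (norm x) < R} \<phi>"
  shows "(\<integral>x. f x * partial_deriv i \<phi> x \<partial>lebesgue) = - (\<integral>x. radial_field k x $ i * \<phi> x \<partial>lebesgue)"
proof -
  obtain b where b: "0 < b" "ereal b < R" "\<And>x. norm x \<ge> b \<Longrightarrow> \<phi> x = 0"
    using test_fun_support[OF \<phi> R_pos] by metis
  define e :: "real^'n" where "e = axis i 1"
  note \<phi>_C1c = C1c_test_fun[OF \<phi>]
  note [measurable] = C1c_borel_measurable[OF \<phi>_C1c]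
  have grad_outside: "egrad \<phi> x = 0" if "norm x > b" for x
    by (rule C1c_grad_eq_0[OF \<phi>_C1c closed_cball[of 0 b]]) (use b(3) that in auto)
  obtain B where B: "B > 0" "\<And>x. norm (egrad \<phi> x) \<le> B" using C1c_grad_bounded[OF \<phi>_C1c] by metis
  have grad_e_bound: "\<bar>egrad \<phi> x \<bullet> e\<bar> \<le> B" for x
    using Cauchy_Schwarz_ineq2[of "egrad \<phi> x" e] B(2)[of x] by (simp add: e_def)
  have product_integrable: "integrable lborel (\<lambda>x. radial_tail (trunc b) b x * (egrad \<phi> x \<bullet> e))"
  proof (rule Bochner_Integration.integrable_bound)
    show "integrable lborel (\<lambda>x::real^'n. radial_tail (trunc b) b x * B)"
      by (intro integrable_mult_left integrable_radial_tail_trunc b)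
    show "AE x in lborel. norm (radial_tail (trunc b) b x * (egrad \<phi> x \<bullet> e))
        \<le> norm (radial_tail (trunc b) b x * B)"
      using grad_e_bound B(1) by (intro AE_I2) (auto simp: abs_mult intro!: mult_left_mono)
  qed measurable
  have "(\<integral>x. f x * partial_deriv i \<phi> x \<partial>lebesgue)
      = (\<integral>x. (radial_tail (trunc b) b x + F b) * (egrad \<phi> x \<bullet> e) \<partial>lborel)"
  proof (rule lebesgue_integral_punctured(2))
    fix x :: "real^'n" assume "x \<noteq> 0"
    thus "f x * partial_deriv i \<phi> x = (radial_tail (trunc b) b x + F b) * (egrad \<phi> x \<bullet> e)"
      using radial_tail_trunc[of x b] grad_outside[of x] b(2)
      by (cases "norm x \<le> b") (auto simp: partial_deriv_eq_inner e_def)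
  qed measurable
  also have "\<dots> = (\<integral>x. radial_tail (trunc b) b x * (egrad \<phi> x \<bullet> e) \<partial>lborel)"
    using product_integrable C1c_integrable(2)[OF \<phi>_C1c, of e] C1c_integral_grad[OF \<phi>_C1c, of e]
    by (simp add: distrib_right)
  also have "\<dots> = (\<integral>x. trunc b (norm x) * (x \<bullet> e / norm x) * \<phi> x \<partial>lborel)"
    using radial_parts_nonneg[OF \<phi>_C1c b(3) trunc_measurable trunc_nonneg[OF b(2)] trunc_finite[OF b(1,2)], of e]
    by (simp add: radial_parts_def)
  also have "\<dots> = (\<integral>x. - (radial_field k x $ i * \<phi> x) \<partial>lborel)"
    using b(3) by (intro Bochner_Integration.integral_cong)
        (auto simp: radial_field_def trunc_def e_def inner_axis)
  also have "\<dots> = - (\<integral>x. radial_field k x $ i * \<phi> x \<partial>lebesgue)"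
    by (subst lebesgue_integral_punctured(2)[of "\<lambda>x. radial_field k x $ i * \<phi> x"])
      (auto simp: radial_field_def[abs_def]
          intro!: borel_measurable_times borel_measurable_continuous_onI continuous_intros)
  finally show ?thesis .
qed

lemma weak_grad_radial: "weak_grad {x. ereal (norm x) < R} f (radial_field k)"
  unfolding weak_grad_def
  using set_integrable_f set_integrable_radial_field integral_f_partial_deriv by blast

end

section \<open>Isoperimetric inequalities in the ball model\<close>

lemma emeasure_hypV:
  fixes S :: "(real^'n::finite) set"
  assumes [measurable]: "S \<in> sets borel" and "S \<subseteq> ball 0 1"
  shows "emeasure hypV S = (\<integral>\<^sup>+x. ennreal (hyp_weight x) * indicator S x \<partial>lborel)"
proof -
  have "emeasure hypV S = (\<integral>\<^sup>+x. indicator S x \<partial>(hypV :: (real^'n) measure))"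
    using borel_subset_sets_hypV[OF assms] by simp
  also have "\<dots> = (\<integral>\<^sup>+x. indicator S x * ennreal (hyp_weight x) * indicator (ball 0 1) x \<partial>lborel)"
    by (intro nn_integral_hypV borel_measurable_hypV) measurable
  also have "\<dots> = (\<integral>\<^sup>+x. ennreal (hyp_weight x) * indicator S x \<partial>lborel)"
    using assms(2) by (intro nn_integral_cong) (auto simp: indicator_def)
  finally show ?thesis .
qed

text \<open>The reciprocal of the conformal factor. It varies by a factor of at most two on the Euclidean ball
  of radius \<open>hyp_scale x / 2\<close> around \<open>x\<close>, which plays the role of a hyperbolic ball of fixed radius.\<close>
definition hyp_scale :: "'a::real_normed_vector \<Rightarrow> real" where
  "hyp_scale x = (1 - (norm x)\<^sup>2) / 2"

lemma hyp_norm_eq: "hyp_norm x G = hyp_scale x * norm G"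
  by (simp add: hyp_norm_def hyp_scale_def)

lemma conf_eq: "conf (norm x) = 1 / hyp_scale x"
  by (simp add: conf_def hyp_scale_def)

lemma hyp_weight_eq: "hyp_weight (x::real^'n::finite) = (1 / hyp_scale x) ^ CARD('n)"
  by (simp add: hyp_weight_conf conf_eq)

lemma hyp_scale_pos: "norm x < 1 \<Longrightarrow> hyp_scale x > 0"
  using one_minus_square_pos[of "norm x"] by (simp add: hyp_scale_def)

lemma hyp_scale_borel_measurable [measurable]:
  "hyp_scale \<in> borel_measurable (borel :: 'a::euclidean_space measure)"
  unfolding hyp_scale_def[abs_def] by measurable

lemma hyp_norm_nonneg: "norm x < 1 \<Longrightarrow> hyp_norm x G \<ge> 0"
  using hyp_scale_pos[of x] by (simp add: hyp_norm_eq)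

lemma hyp_scale_Lipschitz:
  assumes "norm x < 1" "norm y < 1"
  shows "\<bar>hyp_scale x - hyp_scale y\<bar> \<le> norm (x - y)"
proof -
  have "hyp_scale x - hyp_scale y = (norm y - norm x) * ((norm x + norm y) / 2)"
    by (simp add: hyp_scale_def power2_eq_square field_simps)
  hence "\<bar>hyp_scale x - hyp_scale y\<bar> = \<bar>norm x - norm y\<bar> * ((norm x + norm y) / 2)"
    by (simp only: abs_mult) (simp add: abs_minus_commute)
  also have "\<dots> \<le> norm (x - y) * 1"
    using assms by (intro mult_mono norm_triangle_ineq3) auto
  finally show ?thesis by simp
qed

lemma hyp_scale_comparable:
  assumes "norm x < 1" "norm z \<le> hyp_scale x / 2"
  shows "norm (x + z) < 1" "hyp_scale x \<le> 2 * hyp_scale (x + z)" "hyp_scale (x + z) \<le> 2 * hyp_scale x"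
proof -
  have "hyp_scale x = (1 - norm x) * ((1 + norm x) / 2)"
    by (simp add: hyp_scale_def power2_eq_square field_simps)
  also have "\<dots> \<le> (1 - norm x) * 1" using assms(1) by (intro mult_left_mono) auto
  finally show inside: "norm (x + z) < 1"
    using norm_triangle_ineq[of x z] assms by argo
  have "\<bar>hyp_scale x - hyp_scale (x + z)\<bar> \<le> hyp_scale x / 2"
    using hyp_scale_Lipschitz[OF assms(1) inside] assms(2) by simp
  thus "hyp_scale x \<le> 2 * hyp_scale (x + z)" "hyp_scale (x + z) \<le> 2 * hyp_scale x"
    using hyp_scale_pos[OF assms(1)] by linarith+
qed

lemma has_derivative_conf_norm:
  fixes x :: "'a::euclidean_space"
  assumes "norm x < 1"
  shows "((\<lambda>x. conf (norm x)) has_derivative (\<lambda>t. ((conf (norm x))\<^sup>2 *\<^sub>R x) \<bullet> t)) (at x)"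
proof -
  have "1 - x \<bullet> x > 0" using one_minus_square_pos[of "norm x"] assms by (simp add: power2_norm_eq_inner)
  hence "((\<lambda>x. 2 / (1 - x \<bullet> x)) has_derivative (\<lambda>t. ((2 / (1 - x \<bullet> x))\<^sup>2 *\<^sub>R x) \<bullet> t)) (at x)"
    by (auto intro!: derivative_eq_intros simp: fun_eq_iff field_simps inner_commute power2_eq_square)
  thus ?thesis by (simp add: conf_def power2_norm_eq_inner)
qed

lemma has_derivative_conf_norm_power:
  fixes x :: "'a::euclidean_space"
  assumes "norm x < 1"
  shows "((\<lambda>x. conf (norm x) ^ m)
    has_derivative (\<lambda>t. ((real m * conf (norm x) ^ (m + 1)) *\<^sub>R x) \<bullet> t)) (at x)"
  by (rule has_derivative_eq_rhs[OF has_derivative_power[OF has_derivative_conf_norm[OF assms]]])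
    (cases m; simp add: fun_eq_iff power2_eq_square mult_ac)

lemma continuous_on_conf_norm: "continuous_on (ball 0 1) (\<lambda>x::'a::euclidean_space. conf (norm x))"
  by (rule continuous_on_compose2[OF continuous_on_conf continuous_on_norm_id]) auto

lemma conf_norm_divergence:
  fixes x :: "'a::euclidean_space"
  assumes "norm x < 1" "n \<ge> 2"
  shows "real (n - 1) * conf (norm x) ^ n * (x \<bullet> x) + real n * conf (norm x) ^ (n - 1)
    = (real n - 1) * conf (norm x) ^ n - (real n - 2) * conf (norm x) ^ (n - 1)"
proof -
  have "conf (norm x) * (norm x)\<^sup>2 = conf (norm x) - 2"
    using one_minus_square_pos[of "norm x"] assms(1) by (simp add: conf_def field_simps)
  hence "conf (norm x) ^ n * (x \<bullet> x) = conf (norm x) ^ (n - 1) * (conf (norm x) - 2)"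
    using assms(2) by (simp add: power_eq_if[of _ n] power2_norm_eq_inner)
  hence "real (n - 1) * conf (norm x) ^ n * (x \<bullet> x)
      = (real n - 1) * (conf (norm x) ^ (n - 1) * (conf (norm x) - 2))"
    using assms(2) by (simp add: of_nat_diff)
  also have "\<dots> = (real n - 1) * conf (norm x) ^ n - 2 * (real n - 1) * conf (norm x) ^ (n - 1)"
    using assms(2) by (simp add: power_eq_if[of _ n] algebra_simps)
  finally show ?thesis by (simp add: algebra_simps)
qed

locale hyp_bump =
  fixes v :: "real^'n::finite \<Rightarrow> real" and Dv :: "real^'n \<Rightarrow> real^'n" and \<rho> :: real
  assumes v_C1c: "C1c v Dv"
    and v_outside: "\<And>x. norm x \<ge> \<rho> \<Longrightarrow> v x = 0" and \<rho>_less_1: "\<rho> < 1"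
    and v_nonneg: "\<And>x. v x \<ge> 0"
begin

lemmas v_measurable [measurable] = C1c_borel_measurable[OF v_C1c]

lemma Dv_outside: "norm x > \<rho> \<Longrightarrow> Dv x = 0"
  by (rule C1c_grad_eq_0[OF v_C1c closed_cball[of 0 \<rho>]]) (use v_outside in auto)

lemma C1c_mult_smooth:
  assumes "\<And>x. norm x < 1 \<Longrightarrow> (h has_derivative (\<lambda>t. Dh x \<bullet> t)) (at x)" "continuous_on (ball 0 1) Dh"
  shows "C1c (\<lambda>x. v x * h x) (\<lambda>x. v x *\<^sub>R Dh x + h x *\<^sub>R Dv x)"
  using assms v_outside \<rho>_less_1
    by (intro C1c_mult[OF v_C1c closed_cball[of 0 \<rho>], where U = "ball 0 1"]) auto

lemma nn_integral_v: "(\<integral>\<^sup>+x. ennreal (v x) \<partial>hypV)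
    = (\<integral>\<^sup>+x. ennreal (v x * conf (norm x) ^ CARD('n)) \<partial>lborel)"
proof -
  have "(\<integral>\<^sup>+x. ennreal (v x) \<partial>hypV)
      = (\<integral>\<^sup>+x. ennreal (v x) * ennreal (hyp_weight x) * indicator (ball 0 1) x \<partial>lborel)"
    by (intro nn_integral_hypV borel_measurable_hypV) measurable
  also have "\<dots> = (\<integral>\<^sup>+x. ennreal (v x * conf (norm x) ^ CARD('n)) \<partial>lborel)"
    using v_outside v_nonneg \<rho>_less_1
    by (intro nn_integral_cong) (auto simp: hyp_weight_conf ennreal_mult' indicator_def)
  finally show ?thesis .
qed

lemma nn_integral_hyp_norm_Dv:
  "(\<integral>\<^sup>+x. ennreal (hyp_norm x (Dv x)) \<partial>hypV)
      = (\<integral>\<^sup>+x. ennreal (norm (Dv x) * conf (norm x) ^ (CARD('n) - 1)) \<partial>lborel)"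
proof -
  have "(\<integral>\<^sup>+x. ennreal (hyp_norm x (Dv x)) \<partial>hypV)
      = (\<integral>\<^sup>+x. ennreal (hyp_norm x (Dv x)) * ennreal (hyp_weight x) * indicator (ball 0 1) x \<partial>lborel)"
    unfolding hyp_norm_eq by (intro nn_integral_hypV borel_measurable_hypV) measurable
  also have "\<dots> = (\<integral>\<^sup>+x. ennreal (norm (Dv x) * conf (norm x) ^ (CARD('n) - 1)) \<partial>lborel)"
  proof (rule nn_integral_cong)
    fix x
    have "hyp_norm x (Dv x) * hyp_weight x = norm (Dv x) * conf (norm x) ^ (CARD('n) - 1)" if "norm x < 1"
      using hyp_scale_pos[OF that]
        by (simp add: hyp_norm_eq hyp_weight_eq conf_eq power_eq_if[of _ "CARD('n)"])
    thus "ennreal (hyp_norm x (Dv x)) * ennreal (hyp_weight x) * indicator (ball 0 1) x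
        = ennreal (norm (Dv x) * conf (norm x) ^ (CARD('n) - 1))"
      using hyp_norm_nonneg[of x "Dv x"] Dv_outside[of x] \<rho>_less_1
      by (cases "norm x < 1") (auto simp flip: ennreal_mult')
  qed
  finally show ?thesis .
qed

text \<open>The divergence of the vector field \<open>v * conf ^ (n - 1) * x\<close>.\<close>
definition conf_div :: "real^'n \<Rightarrow> real" where
  "conf_div x = v x * ((real CARD('n) - 1) * conf (norm x) ^ CARD('n)
      - (real CARD('n) - 2) * conf (norm x) ^ (CARD('n) - 1)) + conf (norm x) ^ (CARD('n) - 1) * (Dv x \<bullet> x)"

lemma integral_conf_div:
  assumes "CARD('n) \<ge> 2"
  shows "integrable lborel conf_div" "(\<integral>x. conf_div x \<partial>lborel) = 0"
proof -
  define n where "n = CARD('n)"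
  define c where "c x = conf (norm x) ^ (n - 1)" for x :: "real^'n"
  define Dc where "Dc x = (real (n - 1) * conf (norm x) ^ n) *\<^sub>R x" for x :: "real^'n"
  define D where "D b x = v x *\<^sub>R ((x \<bullet> b) *\<^sub>R Dc x + c x *\<^sub>R b) + (c x * (x \<bullet> b)) *\<^sub>R Dv x" for b x
  have DERIV_c: "(c has_derivative (\<lambda>t. Dc x \<bullet> t)) (at x)" if "norm x < 1" for x
    using has_derivative_conf_norm_power[OF that, of "n - 1"] by (simp add: c_def[abs_def] Dc_def n_def)
  have C1c_D: "C1c (\<lambda>x. v x * (c x * (x \<bullet> b))) (D b)" for b
    unfolding D_def
  proof (rule C1c_mult_smooth)
    show "((\<lambda>x. c x * (x \<bullet> b)) has_derivative (\<lambda>t. ((x \<bullet> b) *\<^sub>R Dc x + c x *\<^sub>R b) \<bullet> t)) (at x)"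
      if "norm x < 1" for x
      by (rule has_derivative_eq_rhs[OF has_derivative_mult[OF DERIV_c[OF that] has_derivative_inner_left[OF has_derivative_ident]]])
        (simp add: fun_eq_iff inner_add_left inner_commute[of b] mult.commute)
    show "continuous_on (ball 0 1) (\<lambda>x. (x \<bullet> b) *\<^sub>R Dc x + c x *\<^sub>R b)"
      unfolding Dc_def c_def by (intro continuous_intros continuous_on_conf_norm)
  qed
  have "(\<Sum>b\<in>Basis. D b x \<bullet> b) = conf_div x" for x
  proof -
    have "(\<Sum>b\<in>Basis. D b x \<bullet> b)
        = v x * ((\<Sum>b\<in>Basis. (Dc x \<bullet> b) * (x \<bullet> b)) + c x * (\<Sum>b\<in>(Basis::(real^'n) set). b \<bullet> b))
        + c x * (\<Sum>b\<in>Basis. (Dv x \<bullet> b) * (x \<bullet> b))"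
      by (simp add: D_def inner_add_left sum.distrib sum_distrib_left algebra_simps)
    also have "\<dots> = v x * (Dc x \<bullet> x + c x * real n) + c x * (Dv x \<bullet> x)"
      by (simp add: euclidean_inner[symmetric] n_def)
    also have "\<dots> = conf_div x"
    proof (cases "norm x < 1")
      case True
      have "Dc x \<bullet> x + c x * real n = (real n - 1) * conf (norm x) ^ n - (real n - 2) * c x"
        using conf_norm_divergence[OF True, of n] assms(1) by (simp add: Dc_def c_def n_def mult.commute)
      thus ?thesis by (simp add: conf_div_def c_def n_def)
    next
      case False
      thus ?thesis using v_outside[of x] \<rho>_less_1 by (simp add: conf_div_def c_def n_def)
    qed
    finally show ?thesis .
  qed
  hence sum_D: "conf_div = (\<lambda>x. \<Sum>b\<in>Basis. D b x \<bullet> b)" by auto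
  show "integrable lborel conf_div"
    unfolding sum_D using C1c_integrable(2)[OF C1c_D] by auto
  show "(\<integral>x. conf_div x \<partial>lborel) = 0"
    unfolding sum_D using C1c_integral_grad[OF C1c_D] C1c_integrable(2)[OF C1c_D]
    by (subst Bochner_Integration.integral_sum) auto
qed

lemma Cheeger_pointwise:
  assumes "CARD('n) \<ge> 2"
  shows "real CARD('n) / 2 * (v x * conf (norm x) ^ CARD('n))
      \<le> conf_div x + norm (Dv x) * conf (norm x) ^ (CARD('n) - 1)"
proof (cases "norm x < 1")
  case True
  define n w where "n = CARD('n)" and "w = conf (norm x)"
  have w: "w \<ge> 2" using conf_ge_2[of "norm x"] True by (simp add: w_def)
  have "0 \<le> w ^ (n - 1) * ((real n / 2 - 1) * (w - 2))"
    using w assms(1) by (simp add: n_def)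
  also have "\<dots> = (real n - 1) * w ^ n - (real n - 2) * w ^ (n - 1) - real n / 2 * w ^ n"
    using assms(1) by (simp add: n_def power_eq_if[of _ "CARD('n)"] field_simps)
  finally have v_term: "v x * (real n / 2 * w ^ n)
      \<le> v x * ((real n - 1) * w ^ n - (real n - 2) * w ^ (n - 1))"
    using v_nonneg by (intro mult_left_mono) auto
  have "- (Dv x \<bullet> x) \<le> norm (Dv x) * norm x" using Cauchy_Schwarz_ineq2[of "Dv x" x] by linarith
  also have "\<dots> \<le> norm (Dv x) * 1" using True by (intro mult_left_mono) auto
  finally have "w ^ (n - 1) * (- (Dv x \<bullet> x)) \<le> w ^ (n - 1) * norm (Dv x)"
    using w by (intro mult_left_mono) auto
  thus ?thesis using v_term by (simp add: conf_div_def w_def n_def algebra_simps)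
next
  case False
  thus ?thesis using v_outside[of x] Dv_outside[of x] \<rho>_less_1 by (simp add: conf_div_def)
qed

lemma hyperbolic_Cheeger:
  assumes "CARD('n) \<ge> 2"
  shows "ennreal (real CARD('n)) * (\<integral>\<^sup>+x. ennreal (v x) \<partial>hypV)
      \<le> 2 * (\<integral>\<^sup>+x. ennreal (hyp_norm x (Dv x)) \<partial>hypV)"
proof (cases "(\<integral>\<^sup>+x. ennreal (hyp_norm x (Dv x)) \<partial>hypV) = \<infinity>")
  case True
  thus ?thesis by (simp add: ennreal_mult_top)
next
  case False
  define n where "n = CARD('n)"
  define P where "P x = norm (Dv x) * conf (norm x) ^ (n - 1)" for x
  define Q where "Q x = v x * conf (norm x) ^ n" for x
  have P_nonneg: "P x \<ge> 0" and Q_nonneg: "Q x \<ge> 0" for x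
    using conf_pos[of "norm x"] v_nonneg[of x] v_outside[of x] Dv_outside[of x] \<rho>_less_1
    by (cases "norm x < 1"; auto simp: P_def Q_def)+
  have "integrable lborel P"
    using False P_nonneg unfolding nn_integral_hyp_norm_Dv P_def n_def
    by (intro integrableI_bounded) (auto simp: less_top)
  have "C1c Q (\<lambda>x. v x *\<^sub>R ((real n * conf (norm x) ^ (n + 1)) *\<^sub>R x) + conf (norm x) ^ n *\<^sub>R Dv x)"
    unfolding Q_def
    by (intro C1c_mult_smooth has_derivative_conf_norm_power continuous_intros continuous_on_conf_norm)
  hence "integrable lborel Q" by (rule C1c_integrable)
  have "integrable lborel conf_div" by (rule integral_conf_div[OF assms])
  have "real n / 2 * (\<integral>x. Q x \<partial>lborel) = (\<integral>x. real n / 2 * Q x \<partial>lborel)" by simp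
  also have "\<dots> \<le> (\<integral>x. conf_div x + P x \<partial>lborel)"
  proof (rule integral_mono)
    show "integrable lborel (\<lambda>x. real n / 2 * Q x)"
      using \<open>integrable lborel Q\<close> by simp
    show "integrable lborel (\<lambda>x. conf_div x + P x)"
      using \<open>integrable lborel conf_div\<close> \<open>integrable lborel P\<close> by simp
    show "real n / 2 * Q x \<le> conf_div x + P x" for x
      using Cheeger_pointwise[OF assms, of x] by (simp add: P_def Q_def n_def)
  qed
  also have "\<dots> = (\<integral>x. P x \<partial>lborel)"
    using \<open>integrable lborel conf_div\<close> \<open>integrable lborel P\<close> by (simp add: integral_conf_div(2)[OF assms])
  finally have "real n * (\<integral>x. Q x \<partial>lborel) \<le> 2 * (\<integral>x. P x \<partial>lborel)" by simp
  moreover have "(\<integral>\<^sup>+x. ennreal (v x) \<partial>hypV) = ennreal (\<integral>x. Q x \<partial>lborel)"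
    using nn_integral_eq_integral[OF \<open>integrable lborel Q\<close>] Q_nonneg unfolding nn_integral_v Q_def n_def
      by simp
  moreover have "(\<integral>\<^sup>+x. ennreal (hyp_norm x (Dv x)) \<partial>hypV) = ennreal (\<integral>x. P x \<partial>lborel)"
    using nn_integral_eq_integral[OF \<open>integrable lborel P\<close>] P_nonneg
      unfolding nn_integral_hyp_norm_Dv P_def n_def by simp
  moreover have "0 \<le> (\<integral>x. P x \<partial>lborel)" "0 \<le> (\<integral>x. Q x \<partial>lborel)"
    using P_nonneg Q_nonneg by (auto intro: Bochner_Integration.integral_nonneg)
  ultimately show ?thesis
    by (simp add: n_def ennreal_leI flip: ennreal_mult' ennreal_numeral)
qed

lemma emeasure_support_near_le:
  assumes x: "norm x < 1" and r: "r \<le> 1 / 2"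
    and M: "emeasure hypV {x \<in> ball 0 1. v x > 0} \<le> ennreal M" "M \<ge> 0"
  shows "emeasure lborel {z \<in> ball 0 (r * hyp_scale x). v (x + z) > 0}
      \<le> ennreal ((2 * hyp_scale x) ^ CARD('n) * M)"
proof -
  define S where "S = {z \<in> ball 0 (r * hyp_scale x). v (x + z) > 0}"
  have [measurable]: "S \<in> sets borel" unfolding S_def by measurable
  have scale: "hyp_scale x > 0" by (rule hyp_scale_pos[OF x])
  have "ennreal ((1 / (2 * hyp_scale x)) ^ CARD('n)) * emeasure lborel S
      = (\<integral>\<^sup>+z. ennreal ((1 / (2 * hyp_scale x)) ^ CARD('n)) * indicator S z \<partial>lborel)"
    by (simp add: nn_integral_cmult_indicator)
  also have "\<dots> \<le> (\<integral>\<^sup>+z. ennreal (hyp_weight (z + x)) * indicator {x \<in> ball 0 1. v x > 0} (z + x) \<partial>lborel)"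
  proof (rule nn_integral_mono)
    fix z
    show "ennreal ((1 / (2 * hyp_scale x)) ^ CARD('n)) * indicator S z
        \<le> ennreal (hyp_weight (z + x)) * indicator {x \<in> ball 0 1. v x > 0} (z + x)"
    proof (cases "z \<in> S")
      case True
      have "norm z \<le> r * hyp_scale x" using True by (simp add: S_def)
      also have "\<dots> \<le> 1 / 2 * hyp_scale x" using r scale by (intro mult_right_mono) auto
      finally have "norm z \<le> hyp_scale x / 2" by simp
      note near = hyp_scale_comparable[OF x this]
      have "(1 / (2 * hyp_scale x)) ^ CARD('n) \<le> hyp_weight (x + z)"
        unfolding hyp_weight_eq using near(3) hyp_scale_pos[OF near(1)] scale
        by (intro power_mono divide_left_mono) auto
      thus ?thesis using True near(1) by (simp add: S_def add.commute ennreal_leI)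
    qed simp
  qed
  also have "\<dots> = (\<integral>\<^sup>+y. ennreal (hyp_weight y) * indicator {x \<in> ball 0 1. v x > 0} y \<partial>lborel)"
    by (rule nn_integral_translation) measurable
  also have "\<dots> = emeasure hypV {x \<in> ball 0 1. v x > 0}"
    by (rule emeasure_hypV[symmetric]) auto
  also note M(1)
  finally have "ennreal ((2 * hyp_scale x) ^ CARD('n))
      * (ennreal ((1 / (2 * hyp_scale x)) ^ CARD('n)) * emeasure lborel S)
      \<le> ennreal ((2 * hyp_scale x) ^ CARD('n)) * ennreal M"
    by (rule mult_left_mono) simp
  moreover have "ennreal ((2 * hyp_scale x) ^ CARD('n)) * ennreal ((1 / (2 * hyp_scale x)) ^ CARD('n)) = 1"
    using scale by (simp add: power_divide flip: ennreal_mult')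
  ultimately show ?thesis
    using M(2) scale by (simp add: S_def mult.assoc[symmetric] flip: ennreal_mult')
qed

text \<open>The ball is so large that the support of \<open>v\<close> covers at most half of it.\<close>
lemma average_difference_ge:
  assumes x: "norm x < 1" "v x = T" and r: "0 < r" "r \<le> 1 / 2"
    and M: "emeasure hypV {x \<in> ball 0 1. v x > 0} \<le> ennreal M" "0 \<le> M"
      "2 * 2 ^ CARD('n) * M \<le> unit_ball_vol TYPE('n) * r ^ CARD('n)"
  shows "ennreal (T * (unit_ball_vol TYPE('n) * (r * hyp_scale x) ^ CARD('n)))
    \<le> 2 * (\<integral>\<^sup>+z. ennreal \<bar>v (x + z) - v x\<bar> * indicator (ball 0 (r * hyp_scale x)) z \<partial>lborel)"
    (is "_ \<le> 2 * ?I")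
proof -
  define B where "B = ball (0::real^'n) (r * hyp_scale x)"
  define vol where "vol = unit_ball_vol TYPE('n) * (r * hyp_scale x) ^ CARD('n)"
  have T_nonneg: "T \<ge> 0" using v_nonneg[of x] x by simp
  have scale: "hyp_scale x > 0" by (rule hyp_scale_pos[OF x(1)])
  have vol_nonneg: "vol \<ge> 0" using unit_ball_vol_pos[where 'n='n] r scale by (simp add: vol_def)
  have [measurable]: "B \<in> sets borel" unfolding B_def by measurable
  have "(2 * hyp_scale x) ^ CARD('n) * M \<le> vol / 2"
    using mult_right_mono[OF M(3), of "hyp_scale x ^ CARD('n)"] scale
      by (simp add: vol_def power_mult_distrib mult_ac)
  hence support_le: "emeasure lborel {z \<in> B. v (x + z) > 0} \<le> ennreal (vol / 2)"
    unfolding B_def using order_trans[OF emeasure_support_near_le[OF x(1) r(2) M(1,2)] ennreal_leI] by blast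
  have "ennreal (T * vol / 2) + ennreal (T * vol / 2) = ennreal T * emeasure lborel B"
    using emeasure_ball_0[of "r * hyp_scale x", where 'a="real^'n"] r scale T_nonneg vol_nonneg
    by (simp add: B_def vol_def unit_ball_vol_def flip: ennreal_plus ennreal_mult')
  also have "\<dots> = (\<integral>\<^sup>+z. ennreal T * indicator B z \<partial>lborel)"
    by (simp add: nn_integral_cmult_indicator)
  also have "\<dots> \<le> (\<integral>\<^sup>+z. ennreal \<bar>v (x + z) - v x\<bar> * indicator B z
      + ennreal T * indicator {z \<in> B. v (x + z) > 0} z \<partial>lborel)"
    using x v_nonneg[of "x + z" for z] T_nonneg
    by (intro nn_integral_mono) (auto simp: indicator_def not_less antisym)
  also have "\<dots> = ?I + ennreal T * emeasure lborel {z \<in> B. v (x + z) > 0}"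
    unfolding B_def by (subst nn_integral_add) (auto simp: nn_integral_cmult_indicator)
  also have "\<dots> \<le> ?I + ennreal (T * vol / 2)"
    using mult_left_mono[OF support_le, of "ennreal T"] T_nonneg
      by (intro add_left_mono) (simp flip: ennreal_mult')
  finally have "ennreal (T * vol / 2) \<le> ?I"
    by (simp add: add.commute[of ?I] ennreal_add_left_cancel_le)
  hence "2 * ennreal (T * vol / 2) \<le> 2 * ?I" by (rule mult_left_mono) simp
  thus ?thesis using T_nonneg vol_nonneg by (simp add: vol_def flip: ennreal_mult' ennreal_numeral)
qed

lemma hyp_scale_weight_le:
  fixes x z :: "'a::real_normed_vector"
  assumes x: "norm x < 1" "norm z < r * hyp_scale x" and r: "0 < r" "r \<le> 1 / 2" and t: "t \<in> {0..1}"
    and a: "a \<ge> 0"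
  defines "y \<equiv> x + t *\<^sub>R z"
  shows "norm y < 1" "norm z < 2 * r * hyp_scale y"
    "(1 / hyp_scale x) ^ (2 * n) * (norm z * a)
        \<le> 4 ^ n * (1 / hyp_scale y) ^ (2 * n) * (2 * r * hyp_scale y * a)"
proof -
  have scale: "hyp_scale x > 0" by (rule hyp_scale_pos[OF x(1)])
  have "norm (t *\<^sub>R z) \<le> norm z" using t by (simp add: mult_left_le_one_le)
  also have "\<dots> \<le> r * hyp_scale x" using x(2) by simp
  also have "\<dots> \<le> 1 / 2 * hyp_scale x" using r scale by (intro mult_right_mono) auto
  finally have "norm (t *\<^sub>R z) \<le> hyp_scale x / 2" by simp
  note near = hyp_scale_comparable[OF x(1) this, folded y_def]
  show "norm y < 1" by (rule near(1))
  have "r * hyp_scale x \<le> r * (2 * hyp_scale y)" using near(2) r by (intro mult_left_mono) auto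
  thus z_less: "norm z < 2 * r * hyp_scale y" using x(2) by simp
  have "(1 / hyp_scale x) ^ (2 * n) \<le> (2 * (1 / hyp_scale y)) ^ (2 * n)"
    using near(3) scale hyp_scale_pos[OF near(1)] by (intro power_mono) (auto simp: field_simps)
  also have "\<dots> = 4 ^ n * (1 / hyp_scale y) ^ (2 * n)"
    by (simp add: power_mult_distrib power_mult power_divide)
  finally show "(1 / hyp_scale x) ^ (2 * n) * (norm z * a)
      \<le> 4 ^ n * (1 / hyp_scale y) ^ (2 * n) * (2 * r * hyp_scale y * a)"
    using z_less hyp_scale_pos[OF near(1)] r a by (intro mult_mono) auto
qed

definition weighted_difference :: "real \<Rightarrow> real^'n \<Rightarrow> real^'n \<Rightarrow> ennreal" where
  "weighted_difference r x z = (if norm x < 1 \<and> norm z < r * hyp_scale x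
      then ennreal ((1 / hyp_scale x) ^ (2 * CARD('n))) * ennreal \<bar>v (x + z) - v x\<bar> else 0)"

lemma weighted_difference_le_line_integral:
  assumes r: "0 < r" "r \<le> 1 / 2"
  shows "weighted_difference r x z
    \<le> (\<integral>\<^sup>+t. (if norm (x + t *\<^sub>R z) < 1 \<and> norm z < 2 * r * hyp_scale (x + t *\<^sub>R z)
        then ennreal (4 ^ CARD('n) * (1 / hyp_scale (x + t *\<^sub>R z)) ^ (2 * CARD('n))
          * (2 * r * hyp_scale (x + t *\<^sub>R z) * norm (Dv (x + t *\<^sub>R z)))) else 0) * indicator {0..1} t \<partial>lborel)"
    (is "_ \<le> (\<integral>\<^sup>+t. ?H t * indicator {0..1} t \<partial>lborel)")
proof (cases "norm x < 1 \<and> norm z < r * hyp_scale x")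
  case True
  hence scale: "hyp_scale x > 0" using hyp_scale_pos by auto
  have "weighted_difference r x z \<le> ennreal ((1 / hyp_scale x) ^ (2 * CARD('n)))
      * (\<integral>\<^sup>+t. ennreal (norm z * norm (Dv (x + t *\<^sub>R z))) * indicator {0..1} t \<partial>lborel)"
    using C1c_abs_diff_le_line_integral[OF v_C1c] True
      by (auto simp: weighted_difference_def intro!: mult_left_mono)
  also have "\<dots> = (\<integral>\<^sup>+t. ennreal ((1 / hyp_scale x) ^ (2 * CARD('n)) * (norm z * norm (Dv (x + t *\<^sub>R z))))
      * indicator {0..1} t \<partial>lborel)"
    using scale by (subst nn_integral_cmult[symmetric]) (auto simp: ennreal_mult' mult_ac)
  also have "\<dots> \<le> (\<integral>\<^sup>+t. ?H t * indicator {0..1} t \<partial>lborel)"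
  proof (rule nn_integral_mono)
    fix t :: real
    have "ennreal ((1 / hyp_scale x) ^ (2 * CARD('n)) * (norm z * norm (Dv (x + t *\<^sub>R z)))) \<le> ?H t"
      if "t \<in> {0..1}"
      using hyp_scale_weight_le[of x z r t "norm (Dv (x + t *\<^sub>R z))"] True r that by (simp add: ennreal_leI)
    thus "ennreal ((1 / hyp_scale x) ^ (2 * CARD('n)) * (norm z * norm (Dv (x + t *\<^sub>R z))))
        * indicator {0..1} t
        \<le> ?H t * indicator {0..1} t"
      by (cases "t \<in> {0..1}") auto
  qed
  finally show ?thesis .
next
  case False
  hence "weighted_difference r x z = 0" by (auto simp: weighted_difference_def)
  thus ?thesis by simp
qed

lemma nn_integral_weighted_difference_le:
  assumes r: "0 < r" "r \<le> 1 / 2"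
  shows "(\<integral>\<^sup>+x. weighted_difference r x z \<partial>lborel)
    \<le> (\<integral>\<^sup>+y. (if norm y < 1 \<and> norm z < 2 * r * hyp_scale y
        then ennreal (4 ^ CARD('n) * (1 / hyp_scale y) ^ (2 * CARD('n)) * (2 * r * hyp_scale y * norm (Dv y))) else 0) \<partial>lborel)"
    (is "_ \<le> (\<integral>\<^sup>+y. ?H y \<partial>lborel)")
proof -
  have "(\<integral>\<^sup>+x. weighted_difference r x z \<partial>lborel)
      \<le> (\<integral>\<^sup>+x. (\<integral>\<^sup>+t. ?H (x + t *\<^sub>R z) * indicator {0..1} t \<partial>lborel) \<partial>lborel)"
    by (intro nn_integral_mono weighted_difference_le_line_integral r)
  also have "\<dots> = (\<integral>\<^sup>+t. (\<integral>\<^sup>+x. ?H (x + t *\<^sub>R z) * indicator {0..1} t \<partial>lborel) \<partial>lborel)"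
    by (rule lborel_pair.Fubini') measurable
  also have "\<dots> = (\<integral>\<^sup>+t. (\<integral>\<^sup>+y. ?H y \<partial>lborel) * indicator {0..1::real} t \<partial>lborel)"
  proof (intro nn_integral_cong)
    fix t :: real
    have "(\<integral>\<^sup>+x. ?H (x + t *\<^sub>R z) * indicator {0..1} t \<partial>lborel)
        = (\<integral>\<^sup>+x. ?H (x + t *\<^sub>R z) \<partial>lborel) * indicator {0..1} t"
      by (rule nn_integral_multc) measurable
    also have "(\<integral>\<^sup>+x. ?H (x + t *\<^sub>R z) \<partial>lborel) = (\<integral>\<^sup>+y. ?H y \<partial>lborel)"
      by (rule nn_integral_translation) measurable
    finally show "(\<integral>\<^sup>+x. ?H (x + t *\<^sub>R z) * indicator {0..1} t \<partial>lborel)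
        = (\<integral>\<^sup>+y. ?H y \<partial>lborel) * indicator {0..1} t" .
  qed
  also have "\<dots> = (\<integral>\<^sup>+y. ?H y \<partial>lborel)"
    by (simp add: nn_integral_cmult_indicator)
  finally show ?thesis .
qed

lemma nn_integral_translation_weight:
  fixes y :: "real^'n"
  assumes y: "norm y < 1" and r: "0 < r" and a: "a \<ge> 0"
  shows "(\<integral>\<^sup>+z. (if norm (z::real^'n) < 2 * r * hyp_scale y
        then ennreal (4 ^ CARD('n) * (1 / hyp_scale y) ^ (2 * CARD('n)) * (2 * r * hyp_scale y * a)) else 0) \<partial>lborel)
    = ennreal (2 * 8 ^ CARD('n) * unit_ball_vol TYPE('n) * r ^ (CARD('n) + 1))
      * ennreal (a * conf (norm y) ^ (CARD('n) - 1))"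
proof -
  define n \<sigma> s where "n = CARD('n)" and "\<sigma> = unit_ball_vol TYPE('n)" and "s = hyp_scale y"
  define H where "H = 4 ^ n * (1 / s) ^ (2 * n) * (2 * r * s * a)"
  have s: "s > 0" using hyp_scale_pos[OF y] by (simp add: s_def)
  have "(\<integral>\<^sup>+z. (if norm (z::real^'n) < 2 * r * s then ennreal H else 0) \<partial>lborel)
      = (\<integral>\<^sup>+z. ennreal H * indicator (ball (0::real^'n) (2 * r * s)) z \<partial>lborel)"
    by (intro nn_integral_cong) (auto simp: indicator_def)
  also have "\<dots> = ennreal (H * (\<sigma> * (2 * r * s) ^ n))"
    using r s a emeasure_ball_0[of "2 * r * s", where 'a="real^'n"]
    by (simp add: nn_integral_cmult_indicator H_def n_def \<sigma>_def unit_ball_vol_def flip: ennreal_mult')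
  also have "H * (\<sigma> * (2 * r * s) ^ n) = (2 * 8 ^ n * \<sigma> * r ^ (n + 1)) * (a * (s * (1 / s) ^ n))"
  proof -
    have "(4::real) ^ n * 2 ^ n = 8 ^ n" by (simp flip: power_mult_distrib)
    moreover have "(1 / s) ^ (2 * n) * s ^ n = (1 / s) ^ n" using s
      by (simp add: mult_2 power_add power_divide)
    moreover have "H * (\<sigma> * (2 * r * s) ^ n)
        = (2 * (4 ^ n * 2 ^ n) * \<sigma> * r ^ (n + 1)) * (a * (s * ((1 / s) ^ (2 * n) * s ^ n)))"
      by (simp add: H_def power_mult_distrib)
    ultimately show ?thesis by simp
  qed
  also have "s * (1 / s) ^ n = conf (norm y) ^ (n - 1)"
    using s by (simp add: conf_eq s_def[symmetric] n_def power_eq_if[of _ "CARD('n)"])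
  also have "ennreal (2 * 8 ^ n * \<sigma> * r ^ (n + 1) * (a * conf (norm y) ^ (n - 1)))
      = ennreal (2 * 8 ^ n * \<sigma> * r ^ (n + 1)) * ennreal (a * conf (norm y) ^ (n - 1))"
    using r unit_ball_vol_pos[where 'n='n] by (intro ennreal_mult') (simp add: \<sigma>_def)
  finally show ?thesis unfolding H_def s_def n_def \<sigma>_def .
qed

lemma nn_integral_average_difference_le:
  assumes r: "0 < r" "r \<le> 1 / 2"
  shows "(\<integral>\<^sup>+x. (\<integral>\<^sup>+z. weighted_difference r x z \<partial>lborel) \<partial>lborel)
    \<le> ennreal (2 * 8 ^ CARD('n) * unit_ball_vol TYPE('n) * r ^ (CARD('n) + 1))
      * (\<integral>\<^sup>+x. ennreal (hyp_norm x (Dv x)) \<partial>hypV)"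
    (is "_ \<le> ?c * _")
proof -
  define H where "H y = 4 ^ CARD('n) * (1 / hyp_scale y) ^ (2 * CARD('n))
      * (2 * r * hyp_scale y * norm (Dv y))" for y
  have [measurable]: "H \<in> borel_measurable borel" unfolding H_def by measurable
  have "(\<integral>\<^sup>+x. (\<integral>\<^sup>+z. weighted_difference r x z \<partial>lborel) \<partial>lborel)
      = (\<integral>\<^sup>+z. (\<integral>\<^sup>+x. weighted_difference r x z \<partial>lborel) \<partial>lborel)"
    unfolding weighted_difference_def by (rule lborel_pair.Fubini') measurable
  also have "\<dots> \<le> (\<integral>\<^sup>+z. (\<integral>\<^sup>+y.
        (if norm y < 1 \<and> norm (z::real^'n) < 2 * r * hyp_scale y then ennreal (H y) else 0) \<partial>lborel) \<partial>lborel)"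
    unfolding H_def by (intro nn_integral_mono nn_integral_weighted_difference_le r)
  also have "\<dots> = (\<integral>\<^sup>+y. (\<integral>\<^sup>+z.
        (if norm y < 1 \<and> norm (z::real^'n) < 2 * r * hyp_scale y then ennreal (H y) else 0) \<partial>lborel) \<partial>lborel)"
    by (rule lborel_pair.Fubini') measurable
  also have "\<dots> = (\<integral>\<^sup>+y. ?c * ennreal (norm (Dv y) * conf (norm y) ^ (CARD('n) - 1)) \<partial>lborel)"
  proof (rule nn_integral_cong)
    fix y :: "real^'n"
    show "(\<integral>\<^sup>+z.
        (if norm y < 1 \<and> norm (z::real^'n) < 2 * r * hyp_scale y then ennreal (H y) else 0) \<partial>lborel)
        = ?c * ennreal (norm (Dv y) * conf (norm y) ^ (CARD('n) - 1))"
      unfolding H_def using nn_integral_translation_weight[of y r "norm (Dv y)"] r(1)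
          Dv_outside[of y] \<rho>_less_1
      by (cases "norm y < 1") simp_all
  qed
  also have "\<dots> = ?c * (\<integral>\<^sup>+x. ennreal (hyp_norm x (Dv x)) \<partial>hypV)"
    unfolding nn_integral_hyp_norm_Dv by (rule nn_integral_cmult) measurable
  finally show ?thesis .
qed

lemma weighted_average_difference_ge:
  assumes x: "norm x < 1" "v x = T" and r: "0 < r" "r \<le> 1 / 2"
    and M: "emeasure hypV {x \<in> ball 0 1. v x > 0} \<le> ennreal M" "0 \<le> M"
      "2 * 2 ^ CARD('n) * M \<le> unit_ball_vol TYPE('n) * r ^ CARD('n)"
  shows "ennreal (T * (unit_ball_vol TYPE('n) * r ^ CARD('n))) * ennreal (hyp_weight x)
    \<le> 2 * (\<integral>\<^sup>+z. weighted_difference r x z \<partial>lborel)"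
proof -
  define \<sigma> n s where "\<sigma> = unit_ball_vol TYPE('n)" and "n = CARD('n)" and "s = hyp_scale x"
  have s: "s > 0" using hyp_scale_pos[OF x(1)] by (simp add: s_def)
  have "T \<ge> 0" "\<sigma> > 0" using v_nonneg[of x] x(2) unit_ball_vol_pos[where 'n='n] by (auto simp: \<sigma>_def)
  hence "ennreal (T * (\<sigma> * r ^ n)) * ennreal (hyp_weight x) = ennreal (T * (\<sigma> * r ^ n) * hyp_weight x)"
    using r by (subst ennreal_mult') auto
  also have "T * (\<sigma> * r ^ n) * hyp_weight x = (1 / s) ^ (2 * n) * (T * (\<sigma> * (r * s) ^ n))"
    using s by (simp add: hyp_weight_eq s_def[symmetric] n_def[symmetric] power_mult_distrib mult_2 power_add power_divide)
  also have "ennreal \<dots> = ennreal ((1 / s) ^ (2 * n)) * ennreal (T * (\<sigma> * (r * s) ^ n))"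
    using s by (subst ennreal_mult') auto
  also have "\<dots> \<le> ennreal ((1 / s) ^ (2 * n))
      * (2 * (\<integral>\<^sup>+z. ennreal \<bar>v (x + z) - v x\<bar> * indicator (ball 0 (r * s)) z \<partial>lborel))"
    unfolding \<sigma>_def n_def s_def by (intro mult_left_mono average_difference_ge[OF x r M]) auto
  also have "\<dots> = 2 * (\<integral>\<^sup>+z. ennreal ((1 / s) ^ (2 * n))
      * (ennreal \<bar>v (x + z) - v x\<bar> * indicator (ball 0 (r * s)) z) \<partial>lborel)"
    by (subst nn_integral_cmult) (auto simp: mult.left_commute)
  also have "(\<integral>\<^sup>+z. ennreal ((1 / s) ^ (2 * n))
      * (ennreal \<bar>v (x + z) - v x\<bar> * indicator (ball 0 (r * s)) z) \<partial>lborel)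
      = (\<integral>\<^sup>+z. weighted_difference r x z \<partial>lborel)"
    using x by (intro nn_integral_cong) (auto simp: weighted_difference_def s_def n_def indicator_def)
  finally show ?thesis by (simp add: \<sigma>_def n_def)
qed

lemma isoperimetric_small_radius:
  assumes E: "E \<in> sets borel" "\<And>x. x \<in> E \<Longrightarrow> norm x < 1 \<and> v x = T"
    and r: "0 < r" "r \<le> 1 / 2"
    and M: "emeasure hypV {x \<in> ball 0 1. v x > 0} \<le> ennreal M" "0 \<le> M"
      "2 * 2 ^ CARD('n) * M \<le> unit_ball_vol TYPE('n) * r ^ CARD('n)"
  shows "ennreal T * emeasure hypV E
      \<le> ennreal (4 * 8 ^ CARD('n) * r) * (\<integral>\<^sup>+x. ennreal (hyp_norm x (Dv x)) \<partial>hypV)"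
proof (cases "E = {}")
  case False
  define \<sigma> n where "\<sigma> = unit_ball_vol TYPE('n)" and "n = CARD('n)"
  define P where "P = (\<integral>\<^sup>+x. ennreal (hyp_norm x (Dv x)) \<partial>hypV)"
  note [measurable] = E(1)
  have \<sigma>: "\<sigma> > 0" unfolding \<sigma>_def by (rule unit_ball_vol_pos)
  have T_nonneg: "T \<ge> 0" using False E(2) v_nonneg by fastforce
  have "ennreal (T * (\<sigma> * r ^ n)) * emeasure hypV E
      = (\<integral>\<^sup>+x. ennreal (T * (\<sigma> * r ^ n)) * (ennreal (hyp_weight x) * indicator E x) \<partial>lborel)"
    using E by (subst emeasure_hypV) (auto simp: nn_integral_cmult)
  also have "\<dots> \<le> (\<integral>\<^sup>+x. 2 * (\<integral>\<^sup>+z. weighted_difference r x z \<partial>lborel) \<partial>lborel)"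
    using weighted_average_difference_ge[OF _ _ r M] E(2)
    by (intro nn_integral_mono) (simp add: indicator_def \<sigma>_def n_def)
  also have "\<dots> = 2 * (\<integral>\<^sup>+x. (\<integral>\<^sup>+z. weighted_difference r x z \<partial>lborel) \<partial>lborel)"
    unfolding weighted_difference_def by (rule nn_integral_cmult) measurable
  also have "\<dots> \<le> 2 * (ennreal (2 * 8 ^ n * \<sigma> * r ^ (n + 1)) * P)"
    unfolding P_def n_def \<sigma>_def by (intro mult_left_mono nn_integral_average_difference_le[OF r]) auto
  finally have "ennreal (1 / (\<sigma> * r ^ n)) * (ennreal (T * (\<sigma> * r ^ n)) * emeasure hypV E)
      \<le> ennreal (1 / (\<sigma> * r ^ n)) * (2 * (ennreal (2 * 8 ^ n * \<sigma> * r ^ (n + 1)) * P))"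
    by (rule mult_left_mono) simp
  also have "\<dots> = ennreal (1 / (\<sigma> * r ^ n) * (2 * (2 * 8 ^ n * \<sigma> * r ^ (n + 1)))) * P"
    using \<sigma> r by (simp add: mult.assoc[symmetric] flip: ennreal_mult' ennreal_numeral)
  also have "1 / (\<sigma> * r ^ n) * (2 * (2 * 8 ^ n * \<sigma> * r ^ (n + 1))) = 4 * 8 ^ n * r"
    using \<sigma> r by simp
  also have "ennreal (1 / (\<sigma> * r ^ n)) * (ennreal (T * (\<sigma> * r ^ n)) * emeasure hypV E)
      = ennreal T * emeasure hypV E"
    using \<sigma> r T_nonneg by (simp add: mult.assoc[symmetric] flip: ennreal_mult')
  finally show ?thesis by (simp add: P_def n_def)
qed simp

lemma hyperbolic_Cheeger_level:
  assumes "CARD('n) \<ge> 2" and E: "E \<in> sets borel" "\<And>x. x \<in> E \<Longrightarrow> norm x < 1 \<and> v x = T"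
  shows "ennreal T * emeasure hypV E \<le> (\<integral>\<^sup>+x. ennreal (hyp_norm x (Dv x)) \<partial>hypV)"
proof -
  have "E \<in> sets hypV" using E by (intro borel_subset_sets_hypV) auto
  hence "ennreal T * emeasure hypV E = (\<integral>\<^sup>+x. ennreal T * indicator E x \<partial>hypV)"
    by (simp add: nn_integral_cmult_indicator)
  also have "\<dots> \<le> (\<integral>\<^sup>+x. ennreal (v x) \<partial>hypV)"
    using E(2) by (intro nn_integral_mono) (auto simp: indicator_def)
  finally have "2 * (ennreal T * emeasure hypV E) \<le> ennreal (real CARD('n)) * (\<integral>\<^sup>+x. ennreal (v x) \<partial>hypV)"
    using assms(1) by (intro mult_mono) (auto simp flip: ennreal_numeral intro!: ennreal_leI)
  hence "2 * (ennreal T * emeasure hypV E) \<le> 2 * (\<integral>\<^sup>+x. ennreal (hyp_norm x (Dv x)) \<partial>hypV)"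
    using hyperbolic_Cheeger[OF assms(1)] by (rule order_trans)
  thus ?thesis by (simp add: ennreal_mult_le_mult_iff)
qed

lemma hyperbolic_isoperimetric:
  assumes dim: "CARD('n) \<ge> 2" and E: "E \<in> sets borel" "\<And>x. x \<in> E \<Longrightarrow> norm x < 1 \<and> v x = T"
    and M: "emeasure hypV {x \<in> ball 0 1. v x > 0} \<le> ennreal M" "0 < M"
  shows "ennreal T * emeasure hypV E
    \<le> ennreal (8 ^ (CARD('n) + 1) * (2 * M / unit_ball_vol TYPE('n)) powr (1 / real CARD('n)))
      * (\<integral>\<^sup>+x. ennreal (hyp_norm x (Dv x)) \<partial>hypV)"
proof -
  define X where "X = 2 * M / unit_ball_vol TYPE('n)"
  define r where "r = 2 * X powr (1 / real CARD('n))"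
  have bound_eq: "8 ^ (CARD('n) + 1) * (2 * M / unit_ball_vol TYPE('n)) powr (1 / real CARD('n))
      = 4 * 8 ^ CARD('n) * r"
    by (simp add: r_def X_def)
  have X: "X > 0" "unit_ball_vol TYPE('n) * X = 2 * M"
    using M(2) unit_ball_vol_pos[where 'n='n] by (simp_all add: X_def)
  hence r_pos: "r > 0" by (simp add: r_def)
  have "(X powr (1 / real CARD('n))) ^ CARD('n) = X"
    using X(1) by (simp add: powr_powr flip: powr_realpow)
  hence "unit_ball_vol TYPE('n) * r ^ CARD('n) = 2 ^ CARD('n) * (unit_ball_vol TYPE('n) * X)"
    by (simp add: r_def power_mult_distrib)
  hence volume: "2 * 2 ^ CARD('n) * M \<le> unit_ball_vol TYPE('n) * r ^ CARD('n)"
    unfolding X(2) by simp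
  show ?thesis
  proof (cases "r \<le> 1 / 2")
    case True
    show ?thesis
      unfolding bound_eq using M volume by (intro isoperimetric_small_radius[OF E r_pos True]) auto
  next
    case False
    have "(1::real) \<le> 4 * 1 * r" using False by simp
    also have "\<dots> \<le> 4 * 8 ^ CARD('n) * r" using r_pos by (intro mult_right_mono mult_left_mono) auto
    finally have "1 \<le> ennreal (4 * 8 ^ CARD('n) * r)" by (simp add: ennreal_ge_1)
    hence "1 * (ennreal T * emeasure hypV E)
        \<le> ennreal (4 * 8 ^ CARD('n) * r) * (\<integral>\<^sup>+x. ennreal (hyp_norm x (Dv x)) \<partial>hypV)"
      using hyperbolic_Cheeger_level[OF dim E] by (intro mult_mono) auto
    thus ?thesis unfolding bound_eq by simp
  qed
qed

end

section \<open>Decreasing rearrangement\<close>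

definition rearrangeable :: "(real^'n::finite \<Rightarrow> real) \<Rightarrow> bool" where
  "rearrangeable u \<longleftrightarrow> u \<in> borel_measurable hypV \<and> (\<forall>t>0. distr_hyp u t < \<infinity>)"

lemma rearrangeable_measurable: "rearrangeable u \<Longrightarrow> u \<in> borel_measurable hypV"
  by (simp add: rearrangeable_def)

lemma rearrangeable_distr_hyp:
  assumes "rearrangeable u" "t > 0"
  obtains r where "distr_hyp u t = ennreal r" "r \<ge> 0"
proof -
  have "distr_hyp u t < \<infinity>" using assms by (simp add: rearrangeable_def)
  thus ?thesis by (cases "distr_hyp u t") (auto intro: that)
qed

lemma distr_hyp_eq_nn_integral:
  assumes [measurable]: "u \<in> borel_measurable hypV"
  shows "distr_hyp u t = (\<integral>\<^sup>+x. indicator {t<..} \<bar>u x\<bar> \<partial>hypV)"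
proof -
  have "distr_hyp u t = (\<integral>\<^sup>+x. indicator {x \<in> space hypV. \<bar>u x\<bar> > t} x \<partial>hypV)"
    unfolding distr_hyp_def by (subst nn_integral_indicator) (auto simp del: space_hypV)
  thus ?thesis by (auto intro!: nn_integral_cong simp: indicator_def)
qed

lemma distr_hyp_antimono:
  assumes "u \<in> borel_measurable hypV" and "t \<le> t'"
  shows "distr_hyp u t' \<le> distr_hyp u t"
  unfolding distr_hyp_eq_nn_integral[OF assms(1)] using assms(2)
  by (intro nn_integral_mono) (auto simp: indicator_def)

lemma distr_hyp_Markov:
  fixes u :: "real^'n::finite \<Rightarrow> real"
  assumes [measurable]: "u \<in> borel_measurable hypV" and t: "t > 0" and p: "p > 0"
  shows "distr_hyp u t \<le> ennreal (1 / t powr p) * (\<integral>\<^sup>+x. ennreal (\<bar>u x\<bar> powr p) \<partial>hypV)"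
proof -
  have "distr_hyp u t \<le> (\<integral>\<^sup>+x. ennreal (1 / t powr p) * ennreal (\<bar>u x\<bar> powr p) \<partial>hypV)"
    unfolding distr_hyp_eq_nn_integral[OF assms(1)]
  proof (rule nn_integral_mono)
    fix x
    have "1 \<le> ennreal (1 / t powr p * \<bar>u x\<bar> powr p)" if "\<bar>u x\<bar> > t"
    proof -
      have "t powr p \<le> \<bar>u x\<bar> powr p" using that t p by (intro powr_mono2) auto
      thus ?thesis using t by (simp add: ennreal_ge_1)
    qed
    thus "indicator {t<..} \<bar>u x\<bar> \<le> ennreal (1 / t powr p) * ennreal (\<bar>u x\<bar> powr p)"
      by (auto simp: indicator_def simp flip: ennreal_mult')
  qed
  also have "\<dots> = ennreal (1 / t powr p) * (\<integral>\<^sup>+x. ennreal (\<bar>u x\<bar> powr p) \<partial>hypV)"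
    by (rule nn_integral_cmult) measurable
  finally show ?thesis .
qed

lemma rearrangeable_if_Lp:
  fixes u :: "real^'n::finite \<Rightarrow> real"
  assumes "u \<in> borel_measurable hypV" "p > 0" "(\<integral>\<^sup>+x. ennreal (\<bar>u x\<bar> powr p) \<partial>hypV) < \<infinity>"
  shows "rearrangeable u"
  unfolding rearrangeable_def
proof (intro conjI allI impI)
  show "distr_hyp u t < \<infinity>" if "0 < t" for t
    by (rule le_less_trans[OF distr_hyp_Markov[OF assms(1) that assms(2)]])
      (use assms(3) in \<open>simp add: ennreal_mult_less_top\<close>)
qed (rule assms(1))

lemma distr_hyp_arbitrarily_small:
  assumes u: "rearrangeable u" and "s > 0"
  obtains t where "t > 0" "distr_hyp u t < ennreal s"
proof -
  note [measurable] = rearrangeable_measurable[OF u]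
  let ?A = "\<lambda>k. {x \<in> space hypV. \<bar>u x\<bar> > real (Suc k)}"
  have "(\<lambda>k. emeasure hypV (?A k)) \<longlonglongrightarrow> emeasure hypV (\<Inter>k. ?A k)"
  proof (rule Lim_emeasure_decseq)
    show "decseq ?A" by (intro decseq_SucI) auto
    show "emeasure hypV (?A k) \<noteq> \<infinity>" for k
      using u by (auto simp: rearrangeable_def distr_hyp_def less_top[symmetric] simp del: of_nat_Suc)
  qed (auto simp del: space_hypV)
  also have "(\<Inter>k. ?A k) = {}"
  proof (intro equals0I)
    fix x assume "x \<in> (\<Inter>k. ?A k)"
    hence larger: "real (Suc k) < \<bar>u x\<bar>" for k by blast
    have "real k < \<bar>u x\<bar>" for k using larger[of k] by simp
    thus False using reals_Archimedean2[of "\<bar>u x\<bar>"] less_asym by blast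
  qed
  finally have "(\<lambda>k. distr_hyp u (real (Suc k))) \<longlonglongrightarrow> 0" by (simp add: distr_hyp_def del: of_nat_Suc)
  hence "\<forall>\<^sub>F k in sequentially. distr_hyp u (real (Suc k)) < ennreal s"
    using \<open>s > 0\<close> by (intro order_tendstoD(2)) auto
  then obtain k where "distr_hyp u (real (Suc k)) < ennreal s"
    using eventually_happens'[OF sequentially_bot] by blast
  thus ?thesis by (intro that[of "real (Suc k)"]) auto
qed

lemma distr_hyp_gt_at_larger_level:
  assumes [measurable]: "u \<in> borel_measurable hypV" and gt: "s < distr_hyp u t"
  obtains t' where "t < t'" "s < distr_hyp u t'"
proof -
  let ?A = "\<lambda>k. {x \<in> space hypV. \<bar>u x\<bar> > t + inverse (real (Suc k))}"
  have "incseq ?A"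
  proof (intro incseq_SucI subsetI)
    fix k x assume "x \<in> ?A k"
    moreover have "inverse (real (Suc (Suc k))) \<le> inverse (real (Suc k))" by (intro le_imp_inverse_le) auto
    ultimately have "t + inverse (real (Suc (Suc k))) < \<bar>u x\<bar>" "x \<in> space hypV"
      unfolding mem_Collect_eq by linarith+
    thus "x \<in> ?A (Suc k)" by blast
  qed
  hence "(SUP k. emeasure hypV (?A k)) = emeasure hypV (\<Union>k. ?A k)"
    by (intro SUP_emeasure_incseq) (auto simp del: space_hypV)
  also have "(\<Union>k. ?A k) = {x \<in> space hypV. \<bar>u x\<bar> > t}"
  proof (intro equalityI subsetI)
    fix x assume x: "x \<in> {x \<in> space hypV. \<bar>u x\<bar> > t}"
    hence "0 < \<bar>u x\<bar> - t" by simp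
    then obtain k where "inverse (real (Suc k)) < \<bar>u x\<bar> - t" using reals_Archimedean by blast
    thus "x \<in> (\<Union>k. ?A k)" using x by (auto simp del: of_nat_Suc intro!: exI[of _ k])
  next
    fix x assume "x \<in> (\<Union>k. ?A k)"
    then obtain k where "x \<in> space hypV" "\<bar>u x\<bar> > t + inverse (real (Suc k))" by blast
    moreover have "inverse (real (Suc k)) > 0" by simp
    ultimately have "x \<in> space hypV" "\<bar>u x\<bar> > t" by linarith+
    thus "x \<in> {x \<in> space hypV. \<bar>u x\<bar> > t}" by blast
  qed
  finally have "s < (SUP k. distr_hyp u (t + inverse (real (Suc k))))"
    using gt by (simp add: distr_hyp_def)
  then obtain k where "s < distr_hyp u (t + inverse (real (Suc k)))" by (auto simp: less_SUP_iff)
  thus ?thesis by (intro that[of "t + inverse (real (Suc k))"]) auto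
qed

lemma decr_rearr_bdd_above:
  assumes u: "rearrangeable u" and s: "s > 0"
  shows "bdd_above (insert 0 {y. y > 0 \<and> distr_hyp u y > ennreal s})"
proof -
  obtain t where t: "t > 0" "distr_hyp u t < ennreal s"
    using distr_hyp_arbitrarily_small[OF u s] .
  have "y \<le> t" if "distr_hyp u y > ennreal s" for y
    using distr_hyp_antimono[OF rearrangeable_measurable[OF u], of t y] that t
      by (meson leI less_asym less_imp_le less_le_trans)
  thus ?thesis using t(1) by (intro bdd_aboveI[of _ t]) auto
qed

lemma decr_rearr_nonneg:
  assumes "rearrangeable u" "s > 0"
  shows "decr_rearr u s \<ge> 0"
  unfolding decr_rearr_def by (intro cSup_upper decr_rearr_bdd_above assms) simp

lemma decr_rearr_gt_iff:
  assumes u: "rearrangeable u" and s: "s > 0" and t: "t \<ge> 0"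
  shows "decr_rearr u s > t \<longleftrightarrow> distr_hyp u t > ennreal s"
proof -
  note um = rearrangeable_measurable[OF u]
  let ?S = "insert 0 {y. y > 0 \<and> distr_hyp u y > ennreal s}"
  have "decr_rearr u s > t \<longleftrightarrow> (\<exists>y\<in>?S. t < y)"
    unfolding decr_rearr_def by (rule less_cSup_iff[OF _ decr_rearr_bdd_above[OF u s]]) auto
  also have "\<dots> \<longleftrightarrow> distr_hyp u t > ennreal s"
  proof
    assume "\<exists>y\<in>?S. t < y"
    then obtain y where "y > t" "distr_hyp u y > ennreal s" using t by auto
    thus "distr_hyp u t > ennreal s" using distr_hyp_antimono[OF um, of t y] by simp
  next
    assume "distr_hyp u t > ennreal s"
    then obtain y where "t < y" "ennreal s < distr_hyp u y"
      using distr_hyp_gt_at_larger_level[OF um] by blast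
    thus "\<exists>y\<in>?S. t < y" using t by (intro bexI[of _ y]) auto
  qed
  finally show ?thesis .
qed

lemma decr_rearr_antimono:
  assumes u: "rearrangeable u" and s: "0 < s" "s \<le> t"
  shows "decr_rearr u t \<le> decr_rearr u s"
proof -
  have "\<not> distr_hyp u (decr_rearr u s) > ennreal s"
    using decr_rearr_gt_iff[OF u s(1) decr_rearr_nonneg[OF u s(1)]] by simp
  hence "\<not> distr_hyp u (decr_rearr u s) > ennreal t"
    using ennreal_leI[OF s(2)] by (meson le_less_trans)
  thus ?thesis
    using decr_rearr_gt_iff[OF u _ decr_rearr_nonneg[OF u s(1)], of t] s by simp
qed

lemma distr_hyp_decr_rearr_le:
  assumes u: "rearrangeable u" and s: "s > 0"
  shows "distr_hyp u (decr_rearr u s) \<le> ennreal s"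
  using decr_rearr_gt_iff[OF u s decr_rearr_nonneg[OF u s]] by simp

lemma decr_rearr_small_at_top:
  assumes u: "rearrangeable u" and e: "e > 0"
  obtains b where "b > 0" "\<And>s. s \<ge> b \<Longrightarrow> decr_rearr u s \<le> e"
proof -
  obtain r where r: "distr_hyp u e = ennreal r" "r \<ge> 0" using rearrangeable_distr_hyp[OF u e] .
  have "decr_rearr u s \<le> e" if "s \<ge> r + 1" for s
    using decr_rearr_gt_iff[OF u, of s e] e that r by (simp add: ennreal_less_iff not_less[symmetric])
  thus ?thesis using r by (intro that[of "r + 1"]) auto
qed

lemma sigma_finite_hypV: "sigma_finite_measure (hypV :: (real^'n::finite) measure)"
proof -
  interpret finite_measure "lebesgue_on (ball (0::real^'n) 1)"
    by (rule finite_measure_lebesgue_on) simp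
  show ?thesis
    unfolding hypV_def by (subst sigma_finite_iff_density_finite) auto
qed

lemma distr_hyp_borel_measurable:
  fixes u :: "real^'n::finite \<Rightarrow> real"
  assumes [measurable]: "u \<in> borel_measurable hypV"
  shows "distr_hyp u \<in> borel_measurable borel"
proof -
  interpret sigma_finite_measure "hypV :: (real^'n) measure" by (rule sigma_finite_hypV)
  have "(\<lambda>t. \<integral>\<^sup>+x. (if t < \<bar>u x\<bar> then 1 else 0) \<partial>hypV) \<in> borel_measurable borel"
    by measurable
  also have "(\<lambda>t. \<integral>\<^sup>+x. (if t < \<bar>u x\<bar> then 1 else 0) \<partial>hypV) = distr_hyp u"
    by (auto simp: fun_eq_iff distr_hyp_eq_nn_integral[OF assms] intro!: nn_integral_cong)
  finally show ?thesis .
qed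

text \<open>For \<open>s \<le> 0\<close> the rearrangement is constant, since \<open>ennreal s = 0\<close>.\<close>
lemma decr_rearr_borel_measurable:
  assumes u: "rearrangeable u"
  shows "decr_rearr u \<in> borel_measurable borel"
proof (rule borel_measurableI_greater)
  fix y :: real
  have nonpos: "decr_rearr u s = decr_rearr u 0" if "s \<le> 0" for s
    using that by (simp add: decr_rearr_def ennreal_neg)
  have "{s. 0 < s \<and> y < decr_rearr u s} \<in> sets borel"
  proof (cases "y \<ge> 0")
    case True
    have "{s. 0 < s \<and> y < decr_rearr u s} = {s. 0 < s \<and> ennreal s < distr_hyp u y}"
      using decr_rearr_gt_iff[OF u _ True] by auto
    also have "\<dots> \<in> sets borel" by measurable
    finally show ?thesis .
  next
    case False
    have "{s. 0 < s \<and> y < decr_rearr u s} = {0<..}"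
      using False decr_rearr_nonneg[OF u] by (force simp: not_le intro: less_le_trans)
    thus ?thesis by simp
  qed
  moreover have "{s. s \<le> 0 \<and> y < decr_rearr u s} = {s. s \<le> 0 \<and> y < decr_rearr u 0}"
    using nonpos by metis
  moreover have "{s \<in> space borel. y < decr_rearr u s}
      = {s. 0 < s \<and> y < decr_rearr u s} \<union> {s. s \<le> 0 \<and> y < decr_rearr u s}"
    by auto
  ultimately show "{s \<in> space borel. y < decr_rearr u s} \<in> sets borel" by simp
qed

lemma decr_rearr_shift:
  fixes a b :: "real^'n::finite \<Rightarrow> real"
  assumes a: "rearrangeable a" and b: "rearrangeable b" and pos: "s > 0" "\<eta> > 0" "\<epsilon> > 0"
    and close: "distr_hyp (\<lambda>x. a x - b x) \<epsilon> \<le> ennreal \<eta>"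
  shows "decr_rearr a (s + \<eta>) \<le> decr_rearr b s + \<epsilon>"
proof -
  note [measurable] = rearrangeable_measurable[OF a] rearrangeable_measurable[OF b]
  define t where "t = decr_rearr b s"
  have t: "t \<ge> 0" using decr_rearr_nonneg[OF b pos(1)] by (simp add: t_def)
  have "distr_hyp a (t + \<epsilon>) \<le> (\<integral>\<^sup>+x. indicator {t<..} \<bar>b x\<bar> + indicator {\<epsilon><..} \<bar>a x - b x\<bar> \<partial>hypV)"
    by (subst distr_hyp_eq_nn_integral, measurable, intro nn_integral_mono) (auto simp: indicator_def)
  also have "\<dots> = distr_hyp b t + distr_hyp (\<lambda>x. a x - b x) \<epsilon>"
    by (subst nn_integral_add) (simp_all add: distr_hyp_eq_nn_integral)
  also have "\<dots> \<le> ennreal s + ennreal \<eta>"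
    using distr_hyp_decr_rearr_le[OF b pos(1)] close by (intro add_mono) (auto simp: t_def)
  finally have "\<not> ennreal (s + \<eta>) < distr_hyp a (t + \<epsilon>)" using pos by (simp add: ennreal_plus)
  thus ?thesis
    using decr_rearr_gt_iff[OF a, of "s + \<eta>" "t + \<epsilon>"] pos t by (simp add: t_def)
qed

lemma decr_rearr_tendsto:
  fixes u :: "real^'n::finite \<Rightarrow> real" and \<phi> :: "nat \<Rightarrow> real^'n \<Rightarrow> real"
  assumes u: "rearrangeable u" and \<phi>: "\<And>k. rearrangeable (\<phi> k)"
    and conv: "\<And>\<epsilon>. \<epsilon> > 0 \<Longrightarrow> (\<lambda>k. distr_hyp (\<lambda>x. \<phi> k x - u x) \<epsilon>) \<longlonglongrightarrow> 0"
    and s: "s > 0" and cont: "isCont (decr_rearr u) s"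
  shows "(\<lambda>k. decr_rearr (\<phi> k) s) \<longlonglongrightarrow> decr_rearr u s"
proof (rule LIMSEQ_I)
  fix e :: real assume e: "e > 0"
  obtain d where d: "d > 0" "\<And>t. dist t s < d \<Longrightarrow> dist (decr_rearr u t) (decr_rearr u s) < e / 2"
    using cont e unfolding continuous_at_eps_delta dist_real_def by (metis half_gt_zero)
  define \<eta> where "\<eta> = min (d / 2) (s / 2)"
  have \<eta>: "\<eta> > 0" "\<eta> < d" "\<eta> < s" using d s by (auto simp: \<eta>_def)
  have near: "\<bar>decr_rearr u (s + \<eta>) - decr_rearr u s\<bar> < e / 2"
      "\<bar>decr_rearr u (s - \<eta>) - decr_rearr u s\<bar> < e / 2"
    using d(2)[of "s + \<eta>"] d(2)[of "s - \<eta>"] \<eta> by (auto simp: dist_real_def)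
  have "\<forall>\<^sub>F k in sequentially. distr_hyp (\<lambda>x. \<phi> k x - u x) (e / 2) < ennreal \<eta>"
    using conv[of "e / 2"] e \<eta> by (intro order_tendstoD(2)) auto
  hence "\<forall>\<^sub>F k in sequentially. norm (decr_rearr (\<phi> k) s - decr_rearr u s) < e"
  proof eventually_elim
    case (elim k)
    have "decr_rearr (\<phi> k) (s - \<eta> + \<eta>) \<le> decr_rearr u (s - \<eta>) + e / 2"
      by (rule decr_rearr_shift[OF \<phi> u]) (use elim \<eta> e in auto)
    moreover have "distr_hyp (\<lambda>x. u x - \<phi> k x) (e / 2) = distr_hyp (\<lambda>x. \<phi> k x - u x) (e / 2)"
      by (simp add: distr_hyp_def abs_minus_commute)
    hence "decr_rearr u (s + \<eta>) \<le> decr_rearr (\<phi> k) s + e / 2"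
      by (intro decr_rearr_shift[OF u \<phi>]) (use elim \<eta> e s in auto)
    ultimately have "decr_rearr (\<phi> k) s - decr_rearr u s < e" "decr_rearr u s - decr_rearr (\<phi> k) s < e"
      using near[unfolded abs_less_iff] unfolding diff_add_cancel by linarith+
    thus ?case by (simp add: abs_less_iff)
  qed
  thus "\<exists>k0. \<forall>k\<ge>k0. norm (decr_rearr (\<phi> k) s - decr_rearr u s) < e" by (simp add: eventually_sequentially)
qed

lemma AE_isCont_decr_rearr:
  assumes u: "rearrangeable u"
  shows "AE s in lborel. s > 0 \<longrightarrow> isCont (decr_rearr u) s"
proof -
  have "mono_on {0<..} (\<lambda>s. - decr_rearr u s)"
    by (auto intro!: mono_onI decr_rearr_antimono[OF u])
  hence "countable {s \<in> {0<..}. \<not> isCont (\<lambda>s. - decr_rearr u s) s}"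
    by (intro mono_on_ctble_discont_open) auto
  moreover have "isCont (\<lambda>s. - decr_rearr u s) s \<longleftrightarrow> isCont (decr_rearr u) s" for s
    by (simp add: isCont_def tendsto_minus_cancel_left[symmetric])
  ultimately have "countable {s. 0 < s \<and> \<not> isCont (decr_rearr u) s}" by simp
  hence "{s. 0 < s \<and> \<not> isCont (decr_rearr u) s} \<in> null_sets lborel" by (rule countable_imp_null_set_lborel)
  from AE_not_in[OF this] show ?thesis by eventually_elim auto
qed

text \<open>The Stieltjes measure of the rearrangement on \<open>{0<..}\<close> is the image of Lebesgue measure
  under the distribution function, its generalised inverse.\<close>
definition rearr_measure :: "(real^'n::finite \<Rightarrow> real) \<Rightarrow> real measure" where
  "rearr_measure u
    = distr (density lborel (indicator {t. 0 < t \<and> 0 < distr_hyp u t})) borel (\<lambda>t. enn2real (distr_hyp u t))"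

lemma sets_rearr_measure [simp]: "sets (rearr_measure u) = sets borel"
  by (simp add: rearr_measure_def)

lemma emeasure_rearr_measure:
  fixes u :: "real^'n::finite \<Rightarrow> real"
  assumes u: "rearrangeable u" and [measurable]: "A \<in> sets borel"
  shows "emeasure (rearr_measure u) A
    = emeasure lborel {t. 0 < t \<and> 0 < distr_hyp u t \<and> enn2real (distr_hyp u t) \<in> A}"
proof -
  note [measurable] = distr_hyp_borel_measurable[OF rearrangeable_measurable[OF u]]
  have preimage: "(\<lambda>t. enn2real (distr_hyp u t)) -` A \<in> sets borel"
    using measurable_sets[of "\<lambda>t. enn2real (distr_hyp u t)" borel borel A] by simp
  have "emeasure (rearr_measure u) A
      = (\<integral>\<^sup>+t. indicator {t. 0 < t \<and> 0 < distr_hyp u t} t * indicator ((\<lambda>t. enn2real (distr_hyp u t)) -` A) t \<partial>lborel)"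
    unfolding rearr_measure_def using preimage by (subst emeasure_distr) (auto simp: emeasure_density)
  also have "\<dots> = (\<integral>\<^sup>+t. indicator {t. 0 < t \<and> 0 < distr_hyp u t \<and> enn2real (distr_hyp u t) \<in> A} t \<partial>lborel)"
    by (intro nn_integral_cong) (auto simp: indicator_def)
  finally show ?thesis by simp
qed

lemma emeasure_rearr_measure_nonpos:
  assumes u: "rearrangeable u"
  shows "emeasure (rearr_measure u) {..0} = 0"
proof -
  have "enn2real (distr_hyp u t) > 0" if t: "0 < t" and "0 < distr_hyp u t" for t
    using rearrangeable_distr_hyp[OF u t] that(2) by (metis enn2real_ennreal ennreal_less_zero_iff)
  hence "{t. 0 < t \<and> 0 < distr_hyp u t \<and> enn2real (distr_hyp u t) \<in> {..0}} = {}"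
    by (auto simp: not_le[symmetric] simp del: not_gr_zero)
  thus ?thesis using emeasure_rearr_measure[OF u, of "{..0}"] by (simp only: emeasure_empty atMost_borel)
qed

lemma emeasure_rearr_measure_Ioc:
  assumes u: "rearrangeable u" and ab: "0 < a" "a \<le> b"
  shows "emeasure (rearr_measure u) {a<..b} = ennreal (decr_rearr u a - decr_rearr u b)"
proof -
  define fa fb where "fa = decr_rearr u a" and "fb = decr_rearr u b"
  have f: "0 \<le> fb" "fb \<le> fa"
    using decr_rearr_nonneg[OF u, of b] decr_rearr_antimono[OF u ab] ab by (auto simp: fa_def fb_def)
  have "0 < distr_hyp u t \<and> enn2real (distr_hyp u t) \<in> {a<..b} \<longleftrightarrow> fb \<le> t \<and> t < fa" if t: "0 < t" for t
  proof -
    obtain r where r: "distr_hyp u t = ennreal r" "r \<ge> 0" using rearrangeable_distr_hyp[OF u t] .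
    show ?thesis
      using decr_rearr_gt_iff[OF u, of a t] decr_rearr_gt_iff[OF u, of b t] ab t r
      by (auto simp: fa_def fb_def ennreal_less_iff not_less[symmetric])
  qed
  hence "{t. 0 < t \<and> 0 < distr_hyp u t \<and> enn2real (distr_hyp u t) \<in> {a<..b}} = {0<..} \<inter> {fb..<fa}"
    by (simp only: set_eq_iff Int_iff mem_Collect_eq greaterThan_iff atLeastLessThan_iff) blast
  hence "emeasure (rearr_measure u) {a<..b} = emeasure lborel ({0<..} \<inter> {fb..<fa})"
    using emeasure_rearr_measure[OF u, of "{a<..b}"] by (simp only: greaterThanAtMost_borel)
  also have "\<dots> = ennreal (fa - fb)"
  proof (cases "fb = 0")
    case True
    hence "{0<..} \<inter> {fb..<fa} = {0<..<fa}" by auto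
    thus ?thesis using True f by simp
  next
    case False
    hence "{0<..} \<inter> {fb..<fa} = {fb..<fa}" using f by auto
    thus ?thesis using f by simp
  qed
  finally show ?thesis by (simp add: fa_def fb_def)
qed

section \<open>Level sets of test functions\<close>

lemma DERIV_pos_part_square: "((\<lambda>u::real. (max 0 u)\<^sup>2) has_real_derivative 2 * max 0 u) (at u)"
proof (cases u "0::real" rule: linorder_cases)
  case less
  have "((\<lambda>u::real. 0) has_real_derivative 0) (at u)" by simp
  hence "((\<lambda>u::real. (max 0 u)\<^sup>2) has_real_derivative 0) (at u)"
    by (rule has_field_derivative_transform_within_open[of _ _ _ "{..<0}"]) (use less in auto)
  thus ?thesis using less by simp
next
  case greater
  have "((\<lambda>u::real. u\<^sup>2) has_real_derivative 2 * u) (at u)" by (auto intro!: derivative_eq_intros)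
  hence "((\<lambda>u::real. (max 0 u)\<^sup>2) has_real_derivative 2 * u) (at u)"
    by (rule has_field_derivative_transform_within_open[of _ _ _ "{0<..}"]) (use greater in auto)
  thus ?thesis using greater by simp
next
  case equal
  have "((\<lambda>h::real. (max 0 h)\<^sup>2 / h) \<longlongrightarrow> 0) (at 0)"
  proof (rule Lim_null_comparison)
    show "\<forall>\<^sub>F h in at (0::real). norm ((max 0 h)\<^sup>2 / h) \<le> \<bar>h\<bar>"
      by (intro always_eventually allI) (auto simp: max_def power2_eq_square)
    show "((\<lambda>h::real. \<bar>h\<bar>) \<longlongrightarrow> 0) (at 0)" by (auto intro!: tendsto_eq_intros)
  qed
  thus ?thesis using equal by (simp add: DERIV_def)
qed

definition smoothstep :: "real \<Rightarrow> real" where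
  "smoothstep u = 2 * ((max 0 u)\<^sup>2 - 2 * (max 0 (u - 1/2))\<^sup>2 + (max 0 (u - 1))\<^sup>2)"

definition smoothstep_deriv :: "real \<Rightarrow> real" where
  "smoothstep_deriv u = 4 * (max 0 u - 2 * max 0 (u - 1/2) + max 0 (u - 1))"

lemma DERIV_smoothstep: "(smoothstep has_real_derivative smoothstep_deriv u) (at u)"
proof -
  have shift: "((\<lambda>u::real. (max 0 (u - c))\<^sup>2) has_real_derivative 2 * max 0 (u - c) * 1) (at u)" for c
    by (rule DERIV_chain2[OF DERIV_pos_part_square]) (auto intro!: derivative_eq_intros)
  show ?thesis unfolding smoothstep_def[abs_def] smoothstep_deriv_def
    by (rule derivative_eq_intros DERIV_pos_part_square shift refl)+ (simp add: algebra_simps)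
qed

lemma continuous_on_smoothstep_deriv [continuous_intros]:
  "continuous_on S f \<Longrightarrow> continuous_on S (\<lambda>x. smoothstep_deriv (f x))"
  unfolding smoothstep_deriv_def by (intro continuous_intros)

lemma smoothstep_eq_0: "u \<le> 0 \<Longrightarrow> smoothstep u = 0"
  by (simp add: smoothstep_def)

lemma smoothstep_eq_1: "1 \<le> u \<Longrightarrow> smoothstep u = 1"
  by (simp add: smoothstep_def power2_eq_square algebra_simps)

lemma smoothstep_nonneg: "0 \<le> smoothstep u"
proof -
  consider "u \<le> 0" | "0 \<le> u" "u \<le> 1/2" | "1/2 \<le> u" "u \<le> 1" | "1 \<le> u" by linarith
  thus ?thesis
  proof cases
    case 3
    hence "smoothstep u = 1 - 2 * (1 - u)\<^sup>2" by (simp add: smoothstep_def power2_eq_square algebra_simps)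
    moreover have "(1 - u)\<^sup>2 \<le> (1/2)\<^sup>2" using 3 by (intro power_mono) auto
    ultimately show ?thesis by (simp add: power_divide)
  qed (simp_all add: smoothstep_eq_0 smoothstep_eq_1, simp add: smoothstep_def)
qed

lemma smoothstep_deriv_bounds: "0 \<le> smoothstep_deriv u" "smoothstep_deriv u \<le> 2"
  by (auto simp: smoothstep_deriv_def max_def)

lemma smoothstep_deriv_eq_0: "u \<le> 0 \<or> 1 \<le> u \<Longrightarrow> smoothstep_deriv u = 0"
  by (auto simp: smoothstep_deriv_def max_def)

lemma C1c_compose:
  assumes f: "C1c f D" and g: "\<And>y. (g has_real_derivative g' y) (at y)" "continuous_on UNIV g'" "g 0 = 0"
  shows "C1c (\<lambda>x. g (f x)) (\<lambda>x. g' (f x) *\<^sub>R D x)"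
  unfolding C1c_def
proof (intro conjI allI)
  show "((\<lambda>x. g (f x)) has_derivative (\<lambda>h. (g' (f x) *\<^sub>R D x) \<bullet> h)) (at x)" for x
    using has_derivative_compose[OF C1c_derivative[OF f] g(1)[unfolded has_field_derivative_def]] by simp
  show "continuous_on UNIV (\<lambda>x. g' (f x) *\<^sub>R D x)"
    by (intro continuous_intros continuous_on_compose2[OF g(2)] C1c_continuous[OF f] C1c_continuous_grad[OF f]) simp
  have "{x. g (f x) \<noteq> 0} \<subseteq> {x. f x \<noteq> 0}" using g(3) by auto
  thus "bounded {x. g (f x) \<noteq> 0}" using f by (auto simp: C1c_def intro: bounded_subset)
qed

text \<open>Cutting with a function of \<open>f\<^sup>2\<close> treats the levels of both signs at once.\<close>
lemma C1c_truncation: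
  fixes f :: "'a::euclidean_space \<Rightarrow> real"
  assumes f: "C1c f D" and \<tau>: "0 \<le> \<tau>" "\<tau> < t"
  obtains v Dv where "C1c v Dv" "\<And>x. 0 \<le> v x" "\<And>x. t \<le> \<bar>f x\<bar> \<Longrightarrow> v x = t - \<tau>"
    "\<And>x. v x \<noteq> 0 \<Longrightarrow> \<tau> < \<bar>f x\<bar>" "\<And>x. norm (Dv x) \<le> 4 * (norm (D x) * indicator {\<tau><..<t} \<bar>f x\<bar>)"
proof -
  define a where "a = t\<^sup>2 - \<tau>\<^sup>2"
  define w where "w y = (y\<^sup>2 - \<tau>\<^sup>2) / a" for y
  define g g' where "g y = (t - \<tau>) * smoothstep (w y)"
    and "g' y = (t - \<tau>) * (smoothstep_deriv (w y) * (2 * y / a))" for y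
  have a: "a > 0" using \<tau> by (simp add: a_def power_strict_mono)
  have w_le_0: "w y \<le> 0 \<longleftrightarrow> \<bar>y\<bar> \<le> \<tau>" for y
    using a \<tau> abs_le_square_iff[of y \<tau>] by (simp add: w_def divide_le_0_iff)
  have w_ge_1: "1 \<le> w y \<longleftrightarrow> t \<le> \<bar>y\<bar>" for y
    using a \<tau> abs_le_square_iff[of t y] by (simp add: w_def le_divide_eq_1_pos a_def)
  have "C1c (\<lambda>x. g (f x)) (\<lambda>x. g' (f x) *\<^sub>R D x)"
  proof (rule C1c_compose[OF f])
    show "(g has_real_derivative g' y) (at y)" for y
      unfolding g_def g'_def w_def
      using a by (intro DERIV_cmult DERIV_chain2[OF DERIV_smoothstep]) (auto intro!: derivative_eq_intros)
    show "continuous_on UNIV g'" unfolding g'_def w_def using a by (intro continuous_intros) auto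
    show "g 0 = 0" using w_le_0[of 0] \<tau> by (simp add: g_def smoothstep_eq_0)
  qed
  moreover have "norm (g' (f x) *\<^sub>R D x) \<le> 4 * (norm (D x) * indicator {\<tau><..<t} \<bar>f x\<bar>)" for x
  proof (cases "\<bar>f x\<bar> \<in> {\<tau><..<t}")
    case True
    have "\<bar>g' (f x)\<bar> = smoothstep_deriv (w (f x)) * (2 * \<bar>f x\<bar> / (t + \<tau>))"
      using \<tau> a smoothstep_deriv_bounds[of "w (f x)"]
      by (simp add: g'_def a_def abs_mult power2_eq_square square_diff_square_factored[symmetric] divide_simps) (simp add: algebra_simps)
    also have "\<dots> \<le> 2 * 2"
      using True \<tau> smoothstep_deriv_bounds[of "w (f x)"] by (intro mult_mono) (auto simp: divide_le_eq)
    finally show ?thesis using True mult_right_mono[of "\<bar>g' (f x)\<bar>" 4 "norm (D x)"] by simp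
  next
    case False
    hence "w (f x) \<le> 0 \<or> 1 \<le> w (f x)" unfolding w_le_0 w_ge_1 by auto
    thus ?thesis by (simp add: g'_def smoothstep_deriv_eq_0)
  qed
  moreover have "\<tau> < \<bar>f x\<bar>" if "g (f x) \<noteq> 0" for x
    using that w_le_0[of "f x"] by (cases "w (f x) \<le> 0") (auto simp: g_def smoothstep_eq_0)
  ultimately show ?thesis
    using \<tau> w_ge_1 smoothstep_nonneg smoothstep_eq_1
    by (intro that[of "\<lambda>x. g (f x)" "\<lambda>x. g' (f x) *\<^sub>R D x"]) (auto simp: g_def)
qed

lemma test_fun_unit_ball_support:
  fixes \<phi> :: "real^'n::finite \<Rightarrow> real"
  assumes "test_fun (ball 0 1) \<phi>"
  obtains \<rho> where "0 < \<rho>" "\<rho> < 1" "\<And>x. norm x \<ge> \<rho> \<Longrightarrow> \<phi> x = 0"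
proof -
  have "{x::real^'n. ereal (norm x) < 1} = ball 0 1" by auto
  thus ?thesis using test_fun_support[of 1 \<phi>] assms that by auto
qed

lemma test_fun_rearrangeable:
  fixes \<phi> :: "real^'n::finite \<Rightarrow> real"
  assumes \<phi>: "test_fun (ball 0 1) \<phi>"
  shows "rearrangeable \<phi>"
  unfolding rearrangeable_def
proof (intro conjI allI impI)
  show "\<phi> \<in> borel_measurable hypV"
    by (intro borel_measurable_hypV C1c_borel_measurable(1)[OF C1c_test_fun[OF \<phi>]])
  fix t :: real assume "0 < t"
  obtain \<rho> where \<rho>: "0 < \<rho>" "\<rho> < 1" "\<And>x. norm x \<ge> \<rho> \<Longrightarrow> \<phi> x = 0"
    using test_fun_unit_ball_support[OF \<phi>] by blast
  have "distr_hyp \<phi> t \<le> emeasure (hypV :: (real^'n) measure) (ball 0 \<rho>)"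
    unfolding distr_hyp_def using \<rho> \<open>0 < t\<close>
    by (intro emeasure_mono borel_subset_sets_hypV) (auto simp: not_le[symmetric])
  also have "\<dots> < \<infinity>" using \<rho> by (simp add: emeasure_hypV_ball)
  finally show "distr_hyp \<phi> t < \<infinity>" .
qed

text \<open>Up to a constant, a lower bound for the isoperimetric profile of hyperbolic space.\<close>
definition iso_profile :: "nat \<Rightarrow> real \<Rightarrow> real" where
  "iso_profile n s = s + s powr (1 - 1 / real n)"

lemma iso_profile_pos: "s > 0 \<Longrightarrow> iso_profile n s > 0"
  by (simp add: iso_profile_def add_pos_nonneg)

lemma iso_profile_mono: "n > 0 \<Longrightarrow> 0 < s \<Longrightarrow> s \<le> t \<Longrightarrow> iso_profile n s \<le> iso_profile n t"
  unfolding iso_profile_def by (intro add_mono powr_mono2) auto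

lemma iso_profile_borel_measurable [measurable]: "iso_profile n \<in> borel_measurable borel"
  unfolding iso_profile_def[abs_def] by measurable

definition iso_const :: "'n::finite itself \<Rightarrow> real" where
  "iso_const _ = 4 * (1 + 8 ^ (CARD('n) + 1) * (4 / unit_ball_vol TYPE('n)) powr (1 / real CARD('n)))"

lemma iso_const_pos: "iso_const TYPE('n::finite) > 0"
  by (simp add: iso_const_def add_pos_nonneg)

lemma (in hyp_bump) isoperimetric_profile_bound:
  assumes dim: "CARD('n) \<ge> 2" and E: "E \<in> sets borel" "\<And>x. x \<in> E \<Longrightarrow> norm x < 1 \<and> v x = T" and "T \<ge> 0"
    and s: "s > 0" "ennreal s \<le> emeasure hypV E" "emeasure hypV {x \<in> ball 0 1. v x > 0} \<le> ennreal (2 * s)"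
  shows "4 * ennreal (T * iso_profile CARD('n) s)
    \<le> ennreal (iso_const TYPE('n)) * (\<integral>\<^sup>+x. ennreal (hyp_norm x (Dv x)) \<partial>hypV)"
proof -
  define I where "I = (\<integral>\<^sup>+x. ennreal (hyp_norm x (Dv x)) \<partial>hypV)"
  define c where "c = 8 ^ (CARD('n) + 1) * (4 / unit_ball_vol TYPE('n)) powr (1 / real CARD('n))"
  define r where "r = s powr (1 / real CARD('n))"
  have r: "r > 0" "T * s powr (1 - 1 / real CARD('n)) = 1 / r * (T * s)"
    using s(1) by (simp_all add: r_def powr_diff)
  have c: "c \<ge> 0" by (simp add: c_def)
  have T_mult: "ennreal (T * s) \<le> ennreal T * emeasure hypV E"
    using s(1,2) \<open>T \<ge> 0\<close> by (simp add: ennreal_mult' mult_left_mono)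
  have linear: "ennreal (T * s) \<le> I"
    using T_mult hyperbolic_Cheeger_level[OF dim E] unfolding I_def by (rule order_trans)
  have "2 * (2 * s) / unit_ball_vol TYPE('n) = 4 / unit_ball_vol TYPE('n) * s" by simp
  hence "8 ^ (CARD('n) + 1) * (2 * (2 * s) / unit_ball_vol TYPE('n)) powr (1 / real CARD('n)) = c * r"
    using s(1) unit_ball_vol_pos[where 'n='n] by (simp only: powr_mult c_def r_def mult.assoc)
  hence "ennreal (T * s) \<le> ennreal (c * r) * I"
    using order_trans[OF T_mult hyperbolic_isoperimetric[OF dim E s(3)]] s(1) by (simp add: I_def)
  hence "ennreal (1 / r) * ennreal (T * s) \<le> ennreal (1 / r) * (ennreal (c * r) * I)"
    by (intro mult_left_mono) auto
  also have "ennreal (1 / r) * (ennreal (c * r) * I) = ennreal c * I"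
    using r(1) c by (simp flip: ennreal_mult' mult.assoc)
  also have "ennreal (1 / r) * ennreal (T * s) = ennreal (T * s powr (1 - 1 / real CARD('n)))"
    unfolding r(2) using r(1) by (simp only: ennreal_mult' zero_le_divide_1_iff less_imp_le)
  finally have "ennreal (T * s) + ennreal (T * s powr (1 - 1 / real CARD('n))) \<le> I + ennreal c * I"
    using linear by (intro add_mono)
  also have "ennreal (T * s) + ennreal (T * s powr (1 - 1 / real CARD('n)))
      = ennreal (T * iso_profile CARD('n) s)"
    using s(1) \<open>T \<ge> 0\<close> by (simp add: iso_profile_def distrib_left flip: ennreal_plus)
  also have "I + ennreal c * I = ennreal (1 + c) * I"
    using c by (simp add: ennreal_plus distrib_right)
  finally have "4 * ennreal (T * iso_profile CARD('n) s) \<le> ennreal 4 * (ennreal (1 + c) * I)"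
    by (simp add: mult_left_mono)
  also have "\<dots> = ennreal (4 * (1 + c)) * I"
    using c by (simp only: ennreal_mult' mult.assoc zero_le_numeral)
  also have "4 * (1 + c) = iso_const TYPE('n)" by (simp only: iso_const_def c_def)
  finally show ?thesis by (simp add: I_def)
qed

lemma level_gap_estimate:
  fixes \<phi> :: "real^'n::finite \<Rightarrow> real"
  assumes \<phi>: "test_fun (ball 0 1) \<phi>" and dim: "CARD('n) \<ge> 2"
    and s: "s > 0" and \<tau>: "0 \<le> \<tau>" "\<tau> < t"
    and volumes: "ennreal s \<le> distr_hyp \<phi> t" "distr_hyp \<phi> \<tau> \<le> ennreal (2 * s)"
  shows "ennreal ((t - \<tau>) * iso_profile CARD('n) s)
     \<le> ennreal (iso_const TYPE('n))
      * (\<integral>\<^sup>+x. ennreal (hyp_norm x (egrad \<phi> x) * indicator {\<tau><..<t} \<bar>\<phi> x\<bar>) \<partial>hypV)"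
    (is "_ \<le> _ * ?G")
proof -
  note \<phi>_C1c = C1c_test_fun[OF \<phi>]
  note [measurable] = C1c_borel_measurable[OF \<phi>_C1c]
  have \<phi>_hypV [measurable]: "\<phi> \<in> borel_measurable hypV" by (rule borel_measurable_hypV) measurable
  obtain \<rho> where \<rho>: "\<rho> < 1" "\<And>x. norm x \<ge> \<rho> \<Longrightarrow> \<phi> x = 0"
    using test_fun_unit_ball_support[OF \<phi>] by blast
  obtain v Dv where v: "C1c v Dv" "\<And>x. 0 \<le> v x" "\<And>x. t \<le> \<bar>\<phi> x\<bar> \<Longrightarrow> v x = t - \<tau>" "\<And>x. v x \<noteq> 0 \<Longrightarrow> \<tau> < \<bar>\<phi> x\<bar>"
    and Dv: "\<And>x. norm (Dv x) \<le> 4 * (norm (egrad \<phi> x) * indicator {\<tau><..<t} \<bar>\<phi> x\<bar>)"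
    using C1c_truncation[OF \<phi>_C1c \<tau>] by metis
  interpret hyp_bump v Dv \<rho>
    using v(1,2) v(4) \<rho> \<tau>(1) by unfold_locales force+
  define E where "E = {x \<in> ball 0 1. t < \<bar>\<phi> x\<bar>}"
  have "emeasure hypV {x \<in> ball 0 1. v x > 0} \<le> distr_hyp \<phi> \<tau>"
    unfolding distr_hyp_def space_hypV
    by (intro emeasure_mono borel_subset_sets_hypV) (use v(4) in \<open>force, measurable, auto\<close>)
  hence "4 * ennreal ((t - \<tau>) * iso_profile CARD('n) s)
      \<le> ennreal (iso_const TYPE('n)) * (\<integral>\<^sup>+x. ennreal (hyp_norm x (Dv x)) \<partial>hypV)"
    using \<tau> s volumes v(3)
    by (intro isoperimetric_profile_bound[OF dim, of E]) (auto simp: E_def distr_hyp_def)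
  also have "(\<integral>\<^sup>+x. ennreal (hyp_norm x (Dv x)) \<partial>hypV)
      \<le> (\<integral>\<^sup>+x. 4 * ennreal (hyp_norm x (egrad \<phi> x) * indicator {\<tau><..<t} \<bar>\<phi> x\<bar>) \<partial>hypV)"
  proof (rule nn_integral_mono)
    fix x :: "real^'n" assume "x \<in> space hypV"
    hence "hyp_norm x (Dv x) \<le> hyp_scale x * (4 * (norm (egrad \<phi> x) * indicator {\<tau><..<t} \<bar>\<phi> x\<bar>))"
      unfolding hyp_norm_eq using Dv[of x] hyp_scale_pos[of x] by (intro mult_left_mono) auto
    thus "ennreal (hyp_norm x (Dv x)) \<le> 4 * ennreal (hyp_norm x (egrad \<phi> x) * indicator {\<tau><..<t} \<bar>\<phi> x\<bar>)"
      by (simp add: hyp_norm_eq mult_ac ennreal_leI flip: ennreal_numeral ennreal_mult')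
  qed
  also have "\<dots> = 4 * ?G"
    by (rule nn_integral_cmult, rule measurable_compose[OF _ measurable_ennreal], rule borel_measurable_hypV)
      (simp add: hyp_norm_eq)
  finally have "4 * ennreal ((t - \<tau>) * iso_profile CARD('n) s) \<le> 4 * (ennreal (iso_const TYPE('n)) * ?G)"
    by (simp add: mult_left_mono mult.left_commute)
  thus ?thesis by (simp add: ennreal_mult_le_mult_iff)
qed

definition hyp_energy :: "real \<Rightarrow> (real^'n::finite \<Rightarrow> real^'n) \<Rightarrow> ennreal" where
  "hyp_energy p G = (\<integral>\<^sup>+x. ennreal (hyp_norm x (G x) powr p) \<partial>hypV)"

lemma hyp_norm_borel_measurable_hypV [measurable (raw)]:
  assumes [measurable]: "G \<in> borel_measurable hypV"
  shows "(\<lambda>x. hyp_norm x (G x)) \<in> borel_measurable hypV"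
proof -
  have [measurable]: "hyp_scale \<in> borel_measurable (hypV :: (real^'n::finite) measure)"
    by (rule borel_measurable_hypV) measurable
  show ?thesis unfolding hyp_norm_eq by measurable
qed

definition superlevel_energy :: "real \<Rightarrow> (real^'n::finite \<Rightarrow> real) \<Rightarrow> real \<Rightarrow> ennreal" where
  "superlevel_energy p \<phi> t = (\<integral>\<^sup>+x. ennreal (hyp_norm x (egrad \<phi> x) powr p) * indicator {t<..} \<bar>\<phi> x\<bar> \<partial>hypV)"

lemma superlevel_energy_antimono: "s \<le> t \<Longrightarrow> superlevel_energy p \<phi> t \<le> superlevel_energy p \<phi> s"
  unfolding superlevel_energy_def by (intro nn_integral_mono mult_left_mono) (auto simp: indicator_def)

lemma superlevel_energy_le: "superlevel_energy p \<phi> t \<le> hyp_energy p (egrad \<phi>)"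
  unfolding superlevel_energy_def hyp_energy_def by (intro nn_integral_mono) (auto simp: indicator_def)

lemma nn_integral_band_le:
  fixes \<phi> :: "'a \<Rightarrow> real"
  assumes [measurable]: "g \<in> borel_measurable M" "\<phi> \<in> borel_measurable M" and "\<tau> < t"
    and finite: "(\<integral>\<^sup>+x. g x * indicator {t<..} (\<phi> x) \<partial>M) \<noteq> \<infinity>"
    and difference: "(\<integral>\<^sup>+x. g x * indicator {\<tau><..} (\<phi> x) \<partial>M) \<le> (\<integral>\<^sup>+x. g x * indicator {t<..} (\<phi> x) \<partial>M) + A"
  shows "(\<integral>\<^sup>+x. g x * indicator {\<tau><..<t} (\<phi> x) \<partial>M) \<le> A"
proof -
  have "(\<integral>\<^sup>+x. g x * indicator {t<..} (\<phi> x) \<partial>M) + (\<integral>\<^sup>+x. g x * indicator {\<tau><..<t} (\<phi> x) \<partial>M)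
      = (\<integral>\<^sup>+x. g x * indicator {t<..} (\<phi> x) + g x * indicator {\<tau><..<t} (\<phi> x) \<partial>M)"
    by (rule nn_integral_add[symmetric]) measurable
  also have "\<dots> \<le> (\<integral>\<^sup>+x. g x * indicator {\<tau><..} (\<phi> x) \<partial>M)"
    using \<open>\<tau> < t\<close> by (intro nn_integral_mono) (auto simp: indicator_def)
  finally have "(\<integral>\<^sup>+x. g x * indicator {t<..} (\<phi> x) \<partial>M) + (\<integral>\<^sup>+x. g x * indicator {\<tau><..<t} (\<phi> x) \<partial>M)
      \<le> (\<integral>\<^sup>+x. g x * indicator {t<..} (\<phi> x) \<partial>M) + A"
    using difference by (rule order_trans)
  thus ?thesis using finite by (simp add: ennreal_add_left_cancel_le)
qed

lemma level_gap_Holder: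
  fixes \<phi> :: "real^'n::finite \<Rightarrow> real"
  assumes \<phi>: "test_fun (ball 0 1) \<phi>" and dim: "CARD('n) \<ge> 2" and p: "p > 1"
    and d: "0 < d" "d \<le> s" and \<tau>: "0 \<le> \<tau>" "\<tau> < t"
    and volumes: "ennreal s \<le> distr_hyp \<phi> t" "distr_hyp \<phi> \<tau> \<le> ennreal (s + d)"
    and energies: "superlevel_energy p \<phi> t < \<infinity>"
        "superlevel_energy p \<phi> \<tau> \<le> superlevel_energy p \<phi> t + ennreal A" "A \<ge> 0"
  shows "(t - \<tau>) * iso_profile CARD('n) s \<le> iso_const TYPE('n) * (A powr (1 / p) * d powr (1 - 1 / p))"
proof -
  define q where "q = p / (p - 1)"
  have pq: "p > 1" "q > 1" "1 / p + 1 / q = 1" "1 / q = 1 - 1 / p" using p by (auto simp: q_def field_simps)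
  note [measurable] = C1c_borel_measurable[OF C1c_test_fun[OF \<phi>]]
  have \<phi>_hypV [measurable]: "\<phi> \<in> borel_measurable hypV" by (rule borel_measurable_hypV) measurable
  have grad_hypV [measurable]: "egrad \<phi> \<in> borel_measurable hypV" by (rule borel_measurable_hypV) measurable
  define band :: "real^'n \<Rightarrow> real" where "band x = indicator {\<tau><..<t} \<bar>\<phi> x\<bar>" for x
  have [measurable]: "band \<in> borel_measurable hypV" unfolding band_def by measurable
  have distr_eq: "distr_hyp \<phi> r = (\<integral>\<^sup>+x. 1 * indicator {r<..} \<bar>\<phi> x\<bar> \<partial>hypV)" for r
    by (simp add: distr_hyp_eq_nn_integral)
  have "ennreal s + ennreal d = ennreal (s + d)" using d by simp
  hence "distr_hyp \<phi> \<tau> \<le> distr_hyp \<phi> t + ennreal d"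
    using volumes by (metis add_right_mono order_trans)
  moreover have "distr_hyp \<phi> t \<noteq> \<infinity>"
    using rearrangeable_distr_hyp[OF test_fun_rearrangeable[OF \<phi>], of t] \<tau>
    by (metis ennreal_neq_top infinity_ennreal_def le_less_trans)
  ultimately have band_volume: "(\<integral>\<^sup>+x. 1 * indicator {\<tau><..<t} \<bar>\<phi> x\<bar> \<partial>hypV) \<le> ennreal d"
    unfolding distr_eq using \<tau> by (intro nn_integral_band_le[where t = t]) auto
  have band_energy: "(\<integral>\<^sup>+x. ennreal (hyp_norm x (egrad \<phi> x) powr p) * indicator {\<tau><..<t} \<bar>\<phi> x\<bar> \<partial>hypV)
      \<le> ennreal A"
    using energies \<tau> unfolding superlevel_energy_def by (intro nn_integral_band_le[where t = t]) auto
  have "(\<integral>\<^sup>+x. ennreal ((hyp_norm x (egrad \<phi> x) * band x) * band x) \<partial>hypV)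
      \<le> ennreal (A powr (1 / p) * d powr (1 / q))"
  proof (rule nn_integral_Holder[OF pq(1-3)])
    show "(\<integral>\<^sup>+x. ennreal ((hyp_norm x (egrad \<phi> x) * band x) powr p) \<partial>hypV) \<le> ennreal A"
      by (rule order_trans[OF _ band_energy], intro nn_integral_mono) (auto simp: band_def indicator_def)
    show "(\<integral>\<^sup>+x. ennreal (band x powr q) \<partial>hypV) \<le> ennreal d"
      by (rule order_trans[OF _ band_volume], intro nn_integral_mono) (auto simp: band_def indicator_def)
    show "0 \<le> hyp_norm x (egrad \<phi> x) * band x" if "x \<in> space hypV" for x
      using that hyp_norm_nonneg[of x] by (simp add: band_def)
  qed (use d energies(3) in \<open>auto simp: band_def\<close>)
  moreover have "(\<integral>\<^sup>+x. ennreal ((hyp_norm x (egrad \<phi> x) * band x) * band x) \<partial>hypV)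
      = (\<integral>\<^sup>+x. ennreal (hyp_norm x (egrad \<phi> x) * indicator {\<tau><..<t} \<bar>\<phi> x\<bar>) \<partial>hypV)"
    by (intro nn_integral_cong) (auto simp: band_def indicator_def)
  moreover have "distr_hyp \<phi> \<tau> \<le> ennreal (2 * s)"
    by (rule order_trans[OF volumes(2) ennreal_leI]) (use d in simp)
  ultimately have "ennreal ((t - \<tau>) * iso_profile CARD('n) s)
      \<le> ennreal (iso_const TYPE('n)) * ennreal (A powr (1 / p) * d powr (1 / q))"
    using d by (intro order_trans[OF level_gap_estimate[OF \<phi> dim _ \<tau> volumes(1)]] mult_left_mono) auto
  thus ?thesis
    using iso_const_pos[where 'n='n] pq(4) by (simp add: ennreal_le_iff flip: ennreal_mult')
qed

lemma nn_integral_mono_difference: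
  fixes e :: "real \<Rightarrow> real"
  assumes e: "mono e" "\<And>s. 0 \<le> e s" "\<And>s. e s \<le> m" and d: "d > 0" and ab: "a < b"
  shows "(\<integral>\<^sup>+s. ennreal (e (s + d) - e s) * indicator {a<..<b} s \<partial>lborel) \<le> ennreal (d * m)"
proof -
  note [measurable] = borel_measurable_mono[OF e(1)]
  define I where "I = (\<integral>\<^sup>+s. ennreal (e s) * indicator {a<..<b} s \<partial>lborel)"
  have m: "m \<ge> 0" using e(2)[of 0] e(3)[of 0] by simp
  have "I \<le> (\<integral>\<^sup>+s. ennreal m * indicator {a<..<b} s \<partial>lborel)"
    unfolding I_def using e by (intro nn_integral_mono mult_right_mono ennreal_leI) auto
  also have "\<dots> < \<infinity>" using ab by (simp add: nn_integral_cmult_indicator ennreal_mult_less_top)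
  finally have finite: "I \<noteq> top" by simp
  have "I + (\<integral>\<^sup>+s. ennreal (e (s + d) - e s) * indicator {a<..<b} s \<partial>lborel)
      = (\<integral>\<^sup>+s. ennreal (e s) * indicator {a<..<b} s + ennreal (e (s + d) - e s) * indicator {a<..<b} s \<partial>lborel)"
    unfolding I_def by (rule nn_integral_add[symmetric]) measurable
  also have "\<dots> = (\<integral>\<^sup>+s. ennreal (e (d + s)) * indicator {a + d<..<b + d} (d + s) \<partial>lborel)"
    using e(2) monoD[OF e(1)] d
      by (intro nn_integral_cong) (auto simp: indicator_def add.commute simp flip: ennreal_plus)
  also have "\<dots> = (\<integral>\<^sup>+s. ennreal (e s) * indicator {a + d<..<b + d} s \<partial>lborel)"
    using nn_integral_translation[of "\<lambda>s. ennreal (e s) * indicator {a + d<..<b + d} s" d]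
      by (simp add: add.commute)
  also have "\<dots> \<le> (\<integral>\<^sup>+s. ennreal (e s) * indicator {a<..<b} s + ennreal m * indicator {b..b + d} s \<partial>lborel)"
    using e d m by (intro nn_integral_mono) (auto simp: indicator_def intro: ennreal_leI)
  also have "\<dots> = I + ennreal m * ennreal d"
    unfolding I_def using d by (subst nn_integral_add) (auto simp: nn_integral_cmult_indicator)
  finally have "I + (\<integral>\<^sup>+s. ennreal (e (s + d) - e s) * indicator {a<..<b} s \<partial>lborel)
      \<le> I + ennreal m * ennreal d" .
  thus ?thesis using finite m d by (simp add: ennreal_add_left_cancel_le ennreal_mult mult.commute)
qed

lemma decr_rearr_difference_le:
  fixes \<phi> :: "real^'n::finite \<Rightarrow> real"
  assumes \<phi>: "test_fun (ball 0 1) \<phi>" and dim: "CARD('n) \<ge> 2" and p: "p > 1" and d: "0 < d" "d \<le> s"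
    and energies: "superlevel_energy p \<phi> (decr_rearr \<phi> s) < \<infinity>"
      "superlevel_energy p \<phi> (decr_rearr \<phi> (s + d)) \<le> superlevel_energy p \<phi> (decr_rearr \<phi> s) + ennreal A"
          "A \<ge> 0"
  shows "(decr_rearr \<phi> s - decr_rearr \<phi> (s + d)) * iso_profile CARD('n) s
    \<le> iso_const TYPE('n) * (A powr (1 / p) * d powr (1 - 1 / p))"
proof -
  note r = test_fun_rearrangeable[OF \<phi>]
  define \<tau> where "\<tau> = decr_rearr \<phi> (s + d)"
  define K where "K = iso_const TYPE('n) * (A powr (1 / p) * d powr (1 - 1 / p))"
  have K: "K \<ge> 0" using iso_const_pos[where 'n='n] by (simp add: K_def)
  have s: "s > 0" "s + d > 0" using d by auto
  have profile: "iso_profile CARD('n) s > 0" using s(1) by (rule iso_profile_pos)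
  have \<tau>: "0 \<le> \<tau>" using decr_rearr_nonneg[OF r s(2)] by (simp add: \<tau>_def)
  have "decr_rearr \<phi> s \<le> \<tau> + K / iso_profile CARD('n) s"
  proof (cases "\<tau> < decr_rearr \<phi> s")
    case True
    show ?thesis
    proof (rule dense_le_bounded[OF True])
      fix t assume t: "\<tau> < t" "t < decr_rearr \<phi> s"
      have "ennreal s \<le> distr_hyp \<phi> t" "distr_hyp \<phi> \<tau> \<le> ennreal (s + d)"
        using decr_rearr_gt_iff[OF r s(1), of t] t \<tau> distr_hyp_decr_rearr_le[OF r s(2)]
          by (auto simp: \<tau>_def)
      moreover have level: "superlevel_energy p \<phi> (decr_rearr \<phi> s) \<le> superlevel_energy p \<phi> t"
        using t by (intro superlevel_energy_antimono) simp
      moreover have "superlevel_energy p \<phi> t < \<infinity>"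
      proof -
        have "superlevel_energy p \<phi> t \<le> superlevel_energy p \<phi> \<tau>"
          using t by (intro superlevel_energy_antimono) simp
        also have "\<dots> < \<infinity>"
          unfolding \<tau>_def by (rule le_less_trans[OF energies(2)]) (use energies(1) in simp)
        finally show ?thesis .
      qed
      moreover have "superlevel_energy p \<phi> \<tau> \<le> superlevel_energy p \<phi> t + ennreal A"
        using energies(2) level unfolding \<tau>_def by (meson add_right_mono order_trans)
      ultimately have "(t - \<tau>) * iso_profile CARD('n) s \<le> K"
        unfolding K_def by (intro level_gap_Holder[OF \<phi> dim p d \<tau> t(1)] energies(3))
      thus "t \<le> \<tau> + K / iso_profile CARD('n) s" using profile by (simp add: field_simps)
    qed
  next
    case False
    moreover have "K / iso_profile CARD('n) s \<ge> 0" using K profile by simp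
    ultimately show ?thesis by simp
  qed
  thus ?thesis using profile by (simp add: \<tau>_def K_def field_simps)
qed

lemma decr_rearr_difference_quotient_powr_le:
  fixes \<phi> :: "real^'n::finite \<Rightarrow> real"
  assumes \<phi>: "test_fun (ball 0 1) \<phi>" and dim: "CARD('n) \<ge> 2" and p: "p > 1" and d: "0 < d" "d \<le> s"
    and energies: "superlevel_energy p \<phi> (decr_rearr \<phi> s) < \<infinity>"
      "superlevel_energy p \<phi> (decr_rearr \<phi> (s + d)) \<le> superlevel_energy p \<phi> (decr_rearr \<phi> s) + ennreal A"
          "A \<ge> 0"
  shows "((decr_rearr \<phi> s - decr_rearr \<phi> (s + d)) / d * iso_profile CARD('n) s) powr p
      \<le> iso_const TYPE('n) powr p / d * A"
proof -
  define c where "c = iso_const TYPE('n)"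
  have c: "c > 0" by (simp add: c_def iso_const_pos)
  have s: "s > 0" using d by simp
  have "(decr_rearr \<phi> s - decr_rearr \<phi> (s + d)) * iso_profile CARD('n) s
      \<le> c * (A powr (1 / p) * d powr (1 - 1 / p))"
    unfolding c_def by (rule decr_rearr_difference_le[OF assms])
  moreover have "d powr (1 - 1 / p) / d = d powr (- 1 / p)"
    using d by (simp add: powr_diff powr_minus_divide)
  ultimately have "(decr_rearr \<phi> s - decr_rearr \<phi> (s + d)) / d * iso_profile CARD('n) s
      \<le> c * (A powr (1 / p) * d powr (- 1 / p))"
    using d by (simp add: field_simps)
  moreover have "0 \<le> (decr_rearr \<phi> s - decr_rearr \<phi> (s + d)) / d * iso_profile CARD('n) s"
    using decr_rearr_antimono[OF test_fun_rearrangeable[OF \<phi>] s, of "s + d"] d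
        less_imp_le[OF iso_profile_pos[OF s]] by simp
  ultimately have "((decr_rearr \<phi> s - decr_rearr \<phi> (s + d)) / d * iso_profile CARD('n) s) powr p
      \<le> (c * (A powr (1 / p) * d powr (- 1 / p))) powr p"
    using p by (intro powr_mono2) auto
  also have "\<dots> = c powr p / d * A"
    using p energies(3) c d by (simp add: powr_mult powr_powr powr_minus powr_divide field_simps)
  finally show ?thesis by (simp add: c_def)
qed

lemma nn_integral_decr_rearr_difference_test_fun:
  fixes \<phi> :: "real^'n::finite \<Rightarrow> real"
  assumes \<phi>: "test_fun (ball 0 1) \<phi>" and dim: "CARD('n) \<ge> 2" and p: "p > 1"
    and energy: "hyp_energy p (egrad \<phi>) \<le> ennreal E" "E \<ge> 0"
    and ab: "0 < a" "a < b" and d: "0 < d" "d \<le> a"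
  shows "(\<integral>\<^sup>+s. ennreal (((decr_rearr \<phi> s - decr_rearr \<phi> (s + d)) / d * iso_profile CARD('n) s) powr p)
      * indicator {a<..<b} s \<partial>lborel) \<le> ennreal (iso_const TYPE('n) powr p * E)"
proof -
  note r = test_fun_rearrangeable[OF \<phi>]
  define f where "f = decr_rearr \<phi>"
  define c where "c = iso_const TYPE('n)"
  have c: "c > 0" by (simp add: c_def iso_const_pos)
  define e where "e s = (if s > 0 then enn2real (superlevel_energy p \<phi> (f s)) else 0)" for s
  have energy_le: "superlevel_energy p \<phi> t \<le> ennreal E" for t
    using superlevel_energy_le energy(1) by (rule order_trans)
  have energy_eq: "superlevel_energy p \<phi> (f s) = ennreal (e s)" if "s > 0" for s
    using le_less_trans[OF energy_le ennreal_less_top] that by (simp add: e_def)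
  have e_bounds: "0 \<le> e s" "e s \<le> E" for s
    using enn2real_leI[OF energy(2) energy_le[of "f s"]] energy(2) by (auto simp: e_def)
  have "e s \<le> e t" if st: "0 < s" "s \<le> t" for s t
  proof -
    have "superlevel_energy p \<phi> (f s) \<le> superlevel_energy p \<phi> (f t)"
      unfolding f_def by (intro superlevel_energy_antimono decr_rearr_antimono r st)
    thus ?thesis using st e_bounds(1)[of t] by (simp add: energy_eq)
  qed
  hence e_mono: "mono e"
    using e_bounds(1) by (intro monoI) (metis e_def order_refl)
  have quotient_le: "((f s - f (s + d)) / d * iso_profile CARD('n) s) powr p
      \<le> c powr p / d * (e (s + d) - e s)"
    if s: "s \<in> {a<..<b}" for s
  proof -
    have s_pos: "s > 0" "d \<le> s" using s ab d by auto
    have e_diff: "e (s + d) - e s \<ge> 0" using monoD[OF e_mono, of s "s + d"] d by simp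
    hence "superlevel_energy p \<phi> (f (s + d)) = superlevel_energy p \<phi> (f s) + ennreal (e (s + d) - e s)"
      using e_bounds(1)[of s] s_pos d by (simp add: energy_eq flip: ennreal_plus)
    thus ?thesis
      unfolding f_def c_def using s_pos d e_diff le_less_trans[OF energy_le ennreal_less_top]
      by (intro decr_rearr_difference_quotient_powr_le[OF \<phi> dim p]) auto
  qed
  have [measurable]: "e \<in> borel_measurable borel" by (rule borel_measurable_mono[OF e_mono])
  have "(\<integral>\<^sup>+s. ennreal (((f s - f (s + d)) / d * iso_profile CARD('n) s) powr p)
      * indicator {a<..<b} s \<partial>lborel)
     \<le> (\<integral>\<^sup>+s. ennreal (c powr p / d) * (ennreal (e (s + d) - e s) * indicator {a<..<b} s) \<partial>lborel)"
  proof (rule nn_integral_mono)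
    fix s
    show "ennreal (((f s - f (s + d)) / d * iso_profile CARD('n) s) powr p) * indicator {a<..<b} s
        \<le> ennreal (c powr p / d) * (ennreal (e (s + d) - e s) * indicator {a<..<b} s)"
      using ennreal_leI[OF quotient_le[of s]] d by (auto simp: indicator_def simp flip: ennreal_mult')
  qed
  also have "\<dots> = ennreal (c powr p / d) * (\<integral>\<^sup>+s. ennreal (e (s + d) - e s) * indicator {a<..<b} s \<partial>lborel)"
    by (rule nn_integral_cmult) measurable
  also have "\<dots> \<le> ennreal (c powr p / d) * ennreal (d * E)"
    using nn_integral_mono_difference[OF e_mono e_bounds d(1) ab(2)] by (intro mult_left_mono) auto
  also have "\<dots> = ennreal (c powr p * E)" using d by (simp flip: ennreal_mult')
  finally show ?thesis by (simp add: f_def c_def)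
qed

section \<open>Decreasing functions with difference quotients bounded in \<open>L\<^sup>p\<close>\<close>

definition exhausting_interval :: "nat \<Rightarrow> real set" where
  "exhausting_interval k = {1 / real (k + 2)<..<real (k + 2)}"

lemma exhausting_interval_bounds: "0 < 1 / real (k + 2)" "1 / real (k + 2) < real (k + 2)"
  by (simp, rule less_le_trans[of _ 1]) auto

lemma incseq_exhausting_interval: "incseq exhausting_interval"
proof (intro incseq_SucI)
  fix k
  have "1 / real (Suc k + 2) \<le> 1 / real (k + 2)" by (rule divide_left_mono) auto
  thus "exhausting_interval k \<subseteq> exhausting_interval (Suc k)"
    unfolding exhausting_interval_def
      by (intro greaterThanLessThan_subseteq_greaterThanLessThan[THEN iffD2]) auto
qed

lemma UN_exhausting_interval: "(\<Union>k. exhausting_interval k) = {0<..}"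
proof (intro equalityI subsetI)
  fix x assume "x \<in> (\<Union>k. exhausting_interval k)"
  then obtain k where "1 / real (k + 2) < x" by (auto simp: exhausting_interval_def)
  thus "x \<in> {0<..}" using less_trans[OF exhausting_interval_bounds(1)] by auto
next
  fix x :: real assume "x \<in> {0<..}"
  obtain k where "max x (1 / x) < real k" using reals_Archimedean2 by blast
  hence k: "x < real (k + 2)" "1 / x < real (k + 2)" by simp_all
  hence "1 / real (k + 2) < x" using \<open>x \<in> {0<..}\<close> by (simp add: divide_less_eq mult.commute)
  thus "x \<in> (\<Union>k. exhausting_interval k)" using k by (auto simp: exhausting_interval_def)
qed

lemma nn_integral_greaterThan_0_le:
  assumes [measurable]: "g \<in> borel_measurable borel"
    and bound: "\<And>a b::real. 0 < a \<Longrightarrow> a < b \<Longrightarrow> (\<integral>\<^sup>+s. g s * indicator {a<..<b} s \<partial>lborel) \<le> C"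
  shows "(\<integral>\<^sup>+s. g s * indicator {0<..} s \<partial>lborel) \<le> C"
proof -
  let ?D = "density lborel g"
  have "(\<integral>\<^sup>+s. g s * indicator {0<..} s \<partial>lborel) = emeasure ?D (\<Union>k. exhausting_interval k)"
    by (simp add: UN_exhausting_interval emeasure_density)
  also have "\<dots> = (SUP k. emeasure ?D (exhausting_interval k))"
    by (rule SUP_emeasure_incseq[symmetric, OF _ incseq_exhausting_interval])
        (auto simp: exhausting_interval_def)
  also have "\<dots> \<le> C"
    unfolding exhausting_interval_def
    by (intro SUP_least) (use bound[OF exhausting_interval_bounds] in \<open>simp add: emeasure_density\<close>)
  finally show ?thesis .
qed

definition decay_density :: "(real \<Rightarrow> real) \<Rightarrow> (real \<Rightarrow> real) \<Rightarrow> bool" where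
  "decay_density f h \<longleftrightarrow> h \<in> borel_measurable borel \<and> (\<forall>s. h s \<ge> 0) \<and>
    (\<forall>a b. 0 < a \<longrightarrow> a < b \<longrightarrow> f b \<le> f a \<and> (\<integral>\<^sup>+s. ennreal (h s) * indicator {a<..<b} s \<partial>lborel) = ennreal (f a - f b))"

lemma decay_density_borel_measurable: "decay_density f h \<Longrightarrow> h \<in> borel_measurable borel"
  by (simp add: decay_density_def)

lemma decay_density_nonneg: "decay_density f h \<Longrightarrow> h s \<ge> 0"
  by (simp add: decay_density_def)

lemma decay_density_antimono: "decay_density f h \<Longrightarrow> 0 < a \<Longrightarrow> a \<le> b \<Longrightarrow> f b \<le> f a"
  by (cases "a = b") (simp_all add: decay_density_def)

lemma nn_integral_decay_density:
  "decay_density f h \<Longrightarrow> 0 < a \<Longrightarrow> a < b \<Longrightarrow>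
    (\<integral>\<^sup>+s. ennreal (h s) * indicator {a<..<b} s \<partial>lborel) = ennreal (f a - f b)"
  by (simp add: decay_density_def)

lemma has_integral_decay_density:
  assumes h: "decay_density f h" and st: "0 < s" "s < t"
  shows "(h has_integral (f s - f t)) {s..t}"
proof -
  note [measurable] = decay_density_borel_measurable[OF h]
  have "((\<lambda>x. h x * indicator {s<..<t} x) has_integral (f s - f t)) UNIV"
    using nn_integral_decay_density[OF h st] decay_density_nonneg[OF h] decay_density_antimono[OF h, of s t] st
    by (intro nn_integral_has_integral) (auto simp: ennreal_mult'' ennreal_indicator)
  hence "((\<lambda>x. if x \<in> {s<..<t} then h x else 0) has_integral (f s - f t)) UNIV"
    by (rule has_integral_eq[rotated]) (simp add: indicator_def)
  hence "(h has_integral (f s - f t)) (box s t)"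
    by (simp only: has_integral_restrict_UNIV box_real)
  thus ?thesis unfolding has_integral_open_interval by simp
qed

lemma Lebesgue_differentiation_right:
  fixes g :: "real \<Rightarrow> real"
  assumes "\<And>a b. g integrable_on cbox a b"
  obtains N where "negligible N" "\<And>x. x \<notin> N \<Longrightarrow> ((\<lambda>t. integral {x..x + t} g / t) \<longlongrightarrow> g x) (at_right 0)"
proof -
  obtain N where N: "negligible N" "\<And>x e. x \<notin> N \<Longrightarrow> 0 < e \<Longrightarrow>
      \<exists>d>0. \<forall>h. 0 < h \<and> h < d \<longrightarrow> norm (integral (cbox x (x + h *\<^sub>R One)) g /\<^sub>R h ^ DIM(real) - g x) < e"
    by (rule integrable_ccontinuous_explicit[OF assms], rule that)
  have "((\<lambda>t. integral {x..x + t} g / t) \<longlongrightarrow> g x) (at_right 0)" if x: "x \<notin> N" for x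
  proof (rule tendstoI)
    fix e :: real assume "e > 0"
    obtain d where d: "d > 0"
        "\<And>h. 0 < h \<Longrightarrow> h < d \<Longrightarrow> norm (integral (cbox x (x + h *\<^sub>R One)) g /\<^sub>R h ^ DIM(real) - g x) < e"
      using N(2)[OF x \<open>e > 0\<close>] by blast
    show "\<forall>\<^sub>F t in at_right 0. dist (integral {x..x + t} g / t) (g x) < e"
      using eventually_at_right_real[OF d(1)]
    proof eventually_elim
      case (elim t)
      thus ?case using d(2)[of t] by (simp add: dist_real_def divide_inverse mult.commute)
    qed
  qed
  thus ?thesis using N(1) that by blast
qed

lemma AE_difference_quotient_tendsto:
  assumes h: "decay_density f h" and ab: "0 < a" "a < b"
  shows "AE s in lborel. s \<in> {a<..<b} \<longrightarrow> ((\<lambda>d. (f s - f (s + d)) / d) \<longlongrightarrow> h s) (at_right 0)"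
proof -
  note [measurable] = decay_density_borel_measurable[OF h]
  define g where "g s = h s * indicator {a<..<b} s" for s
  have "g integrable_on UNIV"
    unfolding g_def using nn_integral_decay_density[OF h ab] decay_density_nonneg[OF h]
    by (intro nn_integral_integrable_on) (auto simp: ennreal_mult'' ennreal_indicator)
  hence "g integrable_on cbox x y" for x y by (rule integrable_on_subcbox) simp
  from Lebesgue_differentiation_right[OF this]
  obtain N where N: "negligible N" "\<And>x. x \<notin> N \<Longrightarrow> ((\<lambda>t. integral {x..x + t} g / t) \<longlongrightarrow> g x) (at_right 0)"
    by blast
  have "((\<lambda>d. (f s - f (s + d)) / d) \<longlongrightarrow> h s) (at_right 0)" if s: "s \<notin> N" "s \<in> {a<..<b}" for s
  proof (rule Lim_transform_eventually)
    show "((\<lambda>d. integral {s..s + d} g / d) \<longlongrightarrow> h s) (at_right 0)"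
      using N(2)[OF s(1)] s(2) by (simp add: g_def)
    show "\<forall>\<^sub>F d in at_right 0. integral {s..s + d} g / d = (f s - f (s + d)) / d"
    proof (rule eventually_mono[OF eventually_at_right_real[of 0 "b - s"]])
      fix d assume "d \<in> {0<..<b - s}"
      hence "(g has_integral (f s - f (s + d))) {s..s + d}"
        using s(2) ab has_integral_decay_density[OF h, of s "s + d"]
        by (intro has_integral_eq[of "{s..s + d}" h g]) (auto simp: g_def)
      thus "integral {s..s + d} g / d = (f s - f (s + d)) / d" by (simp add: integral_unique)
    qed (use s(2) in simp)
  qed
  moreover have "AE s in lebesgue. s \<notin> N"
    using N(1) by (auto simp: negligible_iff_null_sets intro: AE_not_in)
  hence "AE s in lborel. s \<notin> N" by (rule AE_completion_iff[THEN iffD1])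
  ultimately show ?thesis by (auto elim: eventually_mono)
qed

locale decreasing_Stieltjes =
  fixes f :: "real \<Rightarrow> real" and m :: "real measure"
  assumes f_borel [measurable]: "f \<in> borel_measurable borel"
    and antimono: "\<And>s t. 0 < s \<Longrightarrow> s \<le> t \<Longrightarrow> f t \<le> f s"
    and sets_m [measurable_cong, simp]: "sets m = sets borel"
    and emeasure_nonpos: "emeasure m {..0} = 0"
    and emeasure_Ioc: "\<And>a b. 0 < a \<Longrightarrow> a \<le> b \<Longrightarrow> emeasure m {a<..b} = ennreal (f a - f b)"
begin

lemma space_m [simp]: "space m = UNIV"
  using sets_eq_imp_space_eq[OF sets_m] by simp

lemma sigma_finite_Stieltjes: "sigma_finite_measure m"
proof
  let ?A = "insert {..0} (range exhausting_interval)"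
  have "emeasure m (exhausting_interval k) \<noteq> \<infinity>" for k
  proof -
    have "emeasure m (exhausting_interval k) \<le> emeasure m {1 / real (k + 2)<..real (k + 2)}"
      unfolding exhausting_interval_def by (intro emeasure_mono) auto
    also have "\<dots> < \<infinity>"
      by (subst emeasure_Ioc) (use exhausting_interval_bounds[of k] in \<open>auto intro: less_imp_le\<close>)
    finally show ?thesis by simp
  qed
  hence "\<forall>S\<in>?A. emeasure m S \<noteq> \<infinity>" using emeasure_nonpos by auto
  moreover have "\<Union> ?A = UNIV" using UN_exhausting_interval by auto
  moreover have "?A \<subseteq> sets m" by (auto simp: exhausting_interval_def)
  ultimately show "\<exists>A. countable A \<and> A \<subseteq> sets m \<and> \<Union> A = space m \<and> (\<forall>a\<in>A. emeasure m a \<noteq> \<infinity>)"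
    by (intro exI[of _ ?A]) auto
qed

lemma nn_integral_difference_quotient:
  assumes [measurable]: "U \<in> sets borel" and U: "U \<subseteq> {0<..}" and d: "d > 0"
  shows "(\<integral>\<^sup>+x. (\<integral>\<^sup>+s. ennreal (1 / d) * indicator U s * (if s < x \<and> x \<le> s + d then 1 else 0) \<partial>lborel) \<partial>m)
    = (\<integral>\<^sup>+s. ennreal ((f s - f (s + d)) / d) * indicator U s \<partial>lborel)"
proof -
  interpret sigma_finite_measure m by (rule sigma_finite_Stieltjes)
  interpret P: pair_sigma_finite lborel m ..
  have "(\<integral>\<^sup>+x. (\<integral>\<^sup>+s. ennreal (1 / d) * indicator U s * (if s < x \<and> x \<le> s + d then 1 else 0) \<partial>lborel) \<partial>m)
      = (\<integral>\<^sup>+s. (\<integral>\<^sup>+x. ennreal (1 / d) * indicator U s * (if s < x \<and> x \<le> s + d then 1 else 0) \<partial>m) \<partial>lborel)"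
    by (rule P.Fubini') measurable
  also have "\<dots> = (\<integral>\<^sup>+s. ennreal ((f s - f (s + d)) / d) * indicator U s \<partial>lborel)"
  proof (rule nn_integral_cong)
    fix s
    have "(\<integral>\<^sup>+x. ennreal (1 / d) * indicator U s * (if s < x \<and> x \<le> s + d then 1 else 0) \<partial>m)
        = (\<integral>\<^sup>+x. ennreal (1 / d) * indicator U s * indicator {s<..s + d} x \<partial>m)"
      by (intro nn_integral_cong) (auto simp: indicator_def)
    also have "\<dots> = ennreal (1 / d) * indicator U s * emeasure m {s<..s + d}"
      by (rule nn_integral_cmult_indicator) simp
    also have "\<dots> = ennreal ((f s - f (s + d)) / d) * indicator U s"
      using U d by (auto simp: indicator_def emeasure_Ioc subset_eq simp flip: ennreal_mult')
    finally show "(\<integral>\<^sup>+x. ennreal (1 / d) * indicator U s * (if s < x \<and> x \<le> s + d then 1 else 0) \<partial>m)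
        = ennreal ((f s - f (s + d)) / d) * indicator U s" .
  qed
  finally show ?thesis .
qed

lemma emeasure_open_le_liminf_difference_quotients:
  assumes U: "open U" "U \<subseteq> {0<..}" and d: "\<And>k. d k > 0" "d \<longlonglongrightarrow> 0"
  shows "emeasure m U \<le> liminf (\<lambda>k. \<integral>\<^sup>+s. ennreal ((f s - f (s + d k)) / d k) * indicator U s \<partial>lborel)"
proof -
  define A where "A k x = (\<integral>\<^sup>+s. ennreal (1 / d k) * indicator U s
      * (if s < x \<and> x \<le> s + d k then 1 else 0) \<partial>lborel)" for k x
  have [measurable]: "U \<in> sets borel" using U(1) by simp
  have A_ge_1: "\<forall>\<^sub>F k in sequentially. 1 \<le> A k x" if x: "x \<in> U" for x
  proof -
    obtain r where r: "r > 0" "ball x r \<subseteq> U" using openE[OF U(1) x] .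
    have "\<forall>\<^sub>F k in sequentially. d k < r" using d(2) r(1) by (rule order_tendstoD)
    thus ?thesis
    proof eventually_elim
      case (elim k)
      have "1 = ennreal (1 / d k) * ennreal (d k)" using d(1)[of k] by (simp flip: ennreal_mult')
      also have "\<dots> = (\<integral>\<^sup>+s. ennreal (1 / d k) * indicator {x - d k..<x} s \<partial>lborel)"
        using d(1)[of k] by (subst nn_integral_cmult_indicator) auto
      also have "\<dots> \<le> A k x"
        unfolding A_def using elim r(2)
        by (intro nn_integral_mono) (auto simp: indicator_def dist_real_def subset_eq)
      finally show ?case .
    qed
  qed
  have [measurable]: "A k \<in> borel_measurable m" for k
    unfolding A_def by (intro lborel.borel_measurable_nn_integral) measurable
  have "emeasure m U = (\<integral>\<^sup>+x. indicator U x \<partial>m)" by simp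
  also have "\<dots> \<le> (\<integral>\<^sup>+x. liminf (\<lambda>k. A k x) \<partial>m)"
    by (intro nn_integral_mono) (use A_ge_1 in \<open>auto simp: indicator_def intro: Liminf_bounded\<close>)
  also have "\<dots> \<le> liminf (\<lambda>k. \<integral>\<^sup>+x. A k x \<partial>m)" by (rule nn_integral_liminf) measurable
  also have "\<dots> = liminf (\<lambda>k. \<integral>\<^sup>+s. ennreal ((f s - f (s + d k)) / d k) * indicator U s \<partial>lborel)"
    unfolding A_def using nn_integral_difference_quotient[OF _ U(2) d(1)] by simp
  finally show ?thesis .
qed

end

locale Lp_difference_quotients = decreasing_Stieltjes +
  fixes L :: "real \<Rightarrow> real" and p C :: real
  assumes p: "p > 1" and C_nonneg: "C \<ge> 0"
    and L_borel [measurable]: "L \<in> borel_measurable borel"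
    and L_pos: "\<And>s. 0 < s \<Longrightarrow> L s > 0" and L_mono: "\<And>s t. 0 < s \<Longrightarrow> s \<le> t \<Longrightarrow> L s \<le> L t"
    and quotient_bound: "\<And>a b d. 0 < a \<Longrightarrow> a < b \<Longrightarrow> 0 < d \<Longrightarrow> d \<le> a \<Longrightarrow>
       (\<integral>\<^sup>+s. ennreal (((f s - f (s + d)) / d * L s) powr p) * indicator {a<..<b} s \<partial>lborel) \<le> ennreal C"
begin

lemma quotient_nonneg: "0 < s \<Longrightarrow> 0 < d \<Longrightarrow> (f s - f (s + d)) / d \<ge> 0"
  using antimono[of s "s + d"] by simp

lemma weighted_quotient_nonneg: "0 < s \<Longrightarrow> 0 < d \<Longrightarrow> (f s - f (s + d)) / d * L s \<ge> 0"
  using quotient_nonneg L_pos by (intro mult_nonneg_nonneg) (auto intro: less_imp_le)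

lemma nn_integral_quotient_open_le:
  assumes [measurable]: "U \<in> sets borel" and U: "U \<subseteq> {a<..<b}" and a: "0 < a" "a < b"
    and B: "emeasure lborel U \<le> ennreal B" "B \<ge> 0" and d: "0 < d" "d \<le> a"
  shows "(\<integral>\<^sup>+s. ennreal ((f s - f (s + d)) / d) * indicator U s \<partial>lborel)
      \<le> ennreal (C powr (1 / p) / L a * B powr (1 - 1 / p))"
proof -
  define q where "q = p / (p - 1)"
  have pq: "p > 1" "q > 1" "1 / p + 1 / q = 1" using p by (auto simp: q_def field_simps)
  have La: "L a > 0" using L_pos a by simp
  define g where "g s = (f s - f (s + d)) / d * L s * indicator U s" for s
  define k where "k s = indicator U s / L a" for s
  have [measurable]: "g \<in> borel_measurable borel" "k \<in> borel_measurable borel"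
    unfolding g_def k_def by measurable
  have U_pos: "s > 0" "L a \<le> L s" if "s \<in> U" for s using U a that L_mono[of a s] by auto
  have "(\<integral>\<^sup>+s. ennreal ((f s - f (s + d)) / d) * indicator U s \<partial>lborel)
      \<le> (\<integral>\<^sup>+s. ennreal (g s * k s) \<partial>lborel)"
  proof (rule nn_integral_mono)
    fix s
    have "(f s - f (s + d)) / d * 1 \<le> (f s - f (s + d)) / d * (L s / L a)" if "s \<in> U"
      using U_pos[OF that] quotient_nonneg[of s d] d La by (intro mult_left_mono) auto
    thus "ennreal ((f s - f (s + d)) / d) * indicator U s \<le> ennreal (g s * k s)"
      by (auto simp: indicator_def g_def k_def intro!: ennreal_leI)
  qed
  also have "\<dots> \<le> ennreal (C powr (1 / p) * (B / L a powr q) powr (1 / q))"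
  proof (rule nn_integral_Holder[OF pq])
    have "(\<integral>\<^sup>+s. ennreal (g s powr p) \<partial>lborel)
        \<le> (\<integral>\<^sup>+s. ennreal (((f s - f (s + d)) / d * L s) powr p) * indicator {a<..<b} s \<partial>lborel)"
      using U by (intro nn_integral_mono) (auto simp: g_def indicator_def)
    thus "(\<integral>\<^sup>+s. ennreal (g s powr p) \<partial>lborel) \<le> ennreal C"
      using quotient_bound[OF a d] by (rule order_trans)
    have "(\<integral>\<^sup>+s. ennreal (k s powr q) \<partial>lborel) = (\<integral>\<^sup>+s. ennreal (1 / L a powr q) * indicator U s \<partial>lborel)"
      using La by (intro nn_integral_cong) (auto simp: k_def indicator_def powr_divide)
    also have "\<dots> = ennreal (1 / L a powr q) * emeasure lborel U" by (simp add: nn_integral_cmult_indicator)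
    also have "\<dots> \<le> ennreal (1 / L a powr q) * ennreal B" by (intro mult_left_mono B) simp
    also have "\<dots> = ennreal (B / L a powr q)" by (simp flip: ennreal_mult')
    finally show "(\<integral>\<^sup>+s. ennreal (k s powr q) \<partial>lborel) \<le> ennreal (B / L a powr q)" .
    show "0 \<le> g s" for s
      using U_pos[of s] weighted_quotient_nonneg[of s d] d by (simp add: g_def indicator_def)
  qed (use La B C_nonneg in \<open>auto simp: k_def\<close>)
  also have "C powr (1 / p) * (B / L a powr q) powr (1 / q) = C powr (1 / p) / L a * B powr (1 / q)"
    using pq La B by (simp add: powr_divide powr_powr)
  also have "1 / q = 1 - 1 / p" using pq by simp
  finally show ?thesis .
qed

lemma quotient_steps:
  fixes a :: real
  assumes "a > 0"
  shows "0 < a / real (Suc k)" "a / real (Suc k) \<le> a" "(\<lambda>k. a / real (Suc k)) \<longlonglongrightarrow> 0"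
proof -
  show "0 < a / real (Suc k)" "a / real (Suc k) \<le> a"
    using assms by (auto simp: divide_le_eq mult_le_cancel_left1)
  show "(\<lambda>k. a / real (Suc k)) \<longlonglongrightarrow> 0"
    using tendsto_mult_right_zero[OF LIMSEQ_inverse_real_of_nat, of a] by (simp add: divide_inverse)
qed

lemma emeasure_open_le:
  assumes U: "open U" "U \<subseteq> {a<..<b}" and a: "0 < a" "a < b" and B: "emeasure lborel U \<le> ennreal B" "B \<ge> 0"
  shows "emeasure m U \<le> ennreal (C powr (1 / p) / L a * B powr (1 - 1 / p))"
proof -
  have "emeasure m U \<le> liminf (\<lambda>k. \<integral>\<^sup>+s. ennreal ((f s - f (s + a / real (Suc k))) / (a / real (Suc k)))
      * indicator U s \<partial>lborel)"
    using U a by (intro emeasure_open_le_liminf_difference_quotients quotient_steps) auto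
  also have "\<dots> \<le> ennreal (C powr (1 / p) / L a * B powr (1 - 1 / p))"
    using U by (intro Liminf_le always_eventually allI nn_integral_quotient_open_le[OF _ U(2) a B] quotient_steps a(1)) auto
  finally show ?thesis .
qed

lemma emeasure_eq_0_if_lborel_null:
  assumes A: "A \<in> sets borel" "emeasure lborel A = 0" "A \<subseteq> {a<..<b}" and a: "0 < a" "a < b"
  shows "emeasure m A = 0"
proof -
  define K where "K = C powr (1 / p) / L a"
  have bound: "emeasure m A \<le> ennreal (K * B powr (1 - 1 / p))" if B: "B > 0" for B
  proof -
    obtain U where U: "open U" "A \<subseteq> U" "emeasure lborel (U - A) < ennreal B"
      using outer_regular_lborel[OF A(1) B] by blast
    have "emeasure lborel (U \<inter> {a<..<b}) \<le> emeasure lborel ((U - A) \<union> A)"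
      using U A(1) by (intro emeasure_mono) auto
    also have "\<dots> \<le> emeasure lborel (U - A) + emeasure lborel A"
      using U A by (intro emeasure_subadditive) auto
    also have "\<dots> \<le> ennreal B" using U A by simp
    finally have "emeasure m (U \<inter> {a<..<b}) \<le> ennreal (K * B powr (1 - 1 / p))"
      unfolding K_def using U B a by (intro emeasure_open_le[where b = b]) auto
    moreover have "emeasure m A \<le> emeasure m (U \<inter> {a<..<b})" using A U by (intro emeasure_mono) auto
    ultimately show ?thesis by (rule order_trans[rotated])
  qed
  have "((\<lambda>B. ennreal (K * B powr (1 - 1 / p))) \<longlongrightarrow> ennreal (K * 0 powr (1 - 1 / p))) (at_right 0)"
    using p by (intro tendsto_ennrealI tendsto_mult_left tendsto_powr2)
      (auto intro!: tendsto_eq_intros eventually_at_right_less[THEN eventually_mono])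
  hence "emeasure m A \<le> ennreal (K * 0 powr (1 - 1 / p))"
  proof (rule tendsto_lowerbound)
    show "\<forall>\<^sub>F B in at_right 0. emeasure m A \<le> ennreal (K * B powr (1 - 1 / p))"
      using eventually_at_right_less by eventually_elim (rule bound)
  qed simp
  thus ?thesis by simp
qed

lemma absolutely_continuous_Stieltjes: "absolutely_continuous lborel m"
  unfolding absolutely_continuous_def
proof
  fix A assume "A \<in> null_sets (lborel :: real measure)"
  hence A [measurable]: "A \<in> sets borel" and "emeasure lborel A = 0" by auto
  hence "emeasure lborel (A \<inter> exhausting_interval k) = 0" for k
    using emeasure_mono[of "A \<inter> exhausting_interval k" A lborel] by auto
  hence "emeasure m (A \<inter> exhausting_interval k) = 0" for k
    by (intro emeasure_eq_0_if_lborel_null[OF _ _ _ exhausting_interval_bounds])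
        (auto simp: exhausting_interval_def)
  hence "(\<Union>k. A \<inter> exhausting_interval k) \<in> null_sets m"
    by (intro null_sets_UN) (auto simp: null_sets_def exhausting_interval_def)
  moreover have "{..0} \<in> null_sets m" using emeasure_nonpos by (simp add: null_sets_def)
  ultimately have "(\<Union>k. A \<inter> exhausting_interval k) \<union> {..0} \<in> null_sets m" by (rule null_sets.Un)
  moreover have "A \<subseteq> (\<Union>k. A \<inter> exhausting_interval k) \<union> {..0}"
    using UN_exhausting_interval by auto
  ultimately show "A \<in> null_sets m" using A by (auto intro: null_sets_subset)
qed

lemma decay_density_exists: obtains h where "decay_density f h"
proof -
  obtain H where H [measurable]: "H \<in> borel_measurable lborel" and m_eq: "density lborel H = m"
    using sigma_finite_measure.Radon_Nikodym[OF sigma_finite_lborel absolutely_continuous_Stieltjes] by auto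
  have "decay_density f (\<lambda>s. enn2real (H s))"
    unfolding decay_density_def
  proof (intro conjI allI impI)
    show "(\<lambda>s. enn2real (H s)) \<in> borel_measurable borel" using H by measurable
    fix a b :: real assume ab: "0 < a" "a < b"
    show "f b \<le> f a" using antimono ab by simp
    have "(\<integral>\<^sup>+s. H s * indicator {a<..b} s \<partial>lborel) = emeasure m {a<..b}"
      unfolding m_eq[symmetric] by (rule emeasure_density[symmetric, OF H]) simp
    hence H_Ioc: "(\<integral>\<^sup>+s. H s * indicator {a<..b} s \<partial>lborel) = ennreal (f a - f b)"
      using emeasure_Ioc[of a b] ab by simp
    hence "AE s in lborel. H s * indicator {a<..b} s \<noteq> \<infinity>"
      by (intro nn_integral_noteq_infinite) auto
    hence "AE s in lborel. ennreal (enn2real (H s)) * indicator {a<..<b} s = H s * indicator {a<..b} s"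
      using AE_lborel_singleton[of b]
        by eventually_elim (auto simp: indicator_def less_top split: if_splits)
    thus "(\<integral>\<^sup>+s. ennreal (enn2real (H s)) * indicator {a<..<b} s \<partial>lborel) = ennreal (f a - f b)"
      using H_Ioc nn_integral_cong_AE by metis
  qed simp
  thus ?thesis by (rule that)
qed

lemma nn_integral_decay_density_powr_le:
  assumes h: "decay_density f h"
  shows "(\<integral>\<^sup>+s. ennreal ((h s * L s) powr p) * indicator {0<..} s \<partial>lborel) \<le> ennreal C"
proof (rule nn_integral_greaterThan_0_le)
  note [measurable] = decay_density_borel_measurable[OF h]
  show "(\<lambda>s. ennreal ((h s * L s) powr p)) \<in> borel_measurable borel" by measurable
  fix a b :: real assume ab: "0 < a" "a < b"
  define d where "d k = a / real (Suc k)" for k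
  note d = quotient_steps[OF ab(1), folded d_def]
  have "filterlim d (at_right 0) sequentially"
    unfolding filterlim_at using d by (auto intro!: always_eventually simp: less_le)
  note at_right = filterlim_compose[OF _ this]
  let ?Q = "\<lambda>k s. ennreal (((f s - f (s + d k)) / d k * L s) powr p) * indicator {a<..<b} s"
  have "AE s in lborel. ennreal ((h s * L s) powr p) * indicator {a<..<b} s \<le> liminf (\<lambda>k. ?Q k s)"
    using AE_difference_quotient_tendsto[OF h ab]
  proof eventually_elim
    case (elim s)
    show ?case
    proof (cases "s \<in> {a<..<b}")
      case True
      have "(\<lambda>k. ennreal (((f s - f (s + d k)) / d k * L s) powr p)) \<longlonglongrightarrow> ennreal ((h s * L s) powr p)"
      proof (intro tendsto_ennrealI tendsto_powr2 tendsto_mult_right)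
        show "(\<lambda>k. (f s - f (s + d k)) / d k) \<longlonglongrightarrow> h s"
          using elim True by (intro at_right) simp
        show "\<forall>\<^sub>F k in sequentially. 0 \<le> (f s - f (s + d k)) / d k * L s"
          using True ab d(1) by (intro always_eventually allI weighted_quotient_nonneg) auto
      qed (use p in auto)
      hence "(\<lambda>k. ?Q k s) \<longlonglongrightarrow> ennreal ((h s * L s) powr p) * indicator {a<..<b} s"
        using True by simp
      from lim_imp_Liminf[OF sequentially_bot this] show ?thesis by simp
    qed simp
  qed
  hence "(\<integral>\<^sup>+s. ennreal ((h s * L s) powr p) * indicator {a<..<b} s \<partial>lborel)
      \<le> (\<integral>\<^sup>+s. liminf (\<lambda>k. ?Q k s) \<partial>lborel)"
    by (rule nn_integral_mono_AE)
  also have "\<dots> \<le> liminf (\<lambda>k. \<integral>\<^sup>+s. ?Q k s \<partial>lborel)" by (rule nn_integral_liminf) measurable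
  also have "\<dots> \<le> ennreal C"
    using quotient_bound[OF ab d(1,2)] by (intro Liminf_le always_eventually) auto
  finally show "(\<integral>\<^sup>+s. ennreal ((h s * L s) powr p) * indicator {a<..<b} s \<partial>lborel) \<le> ennreal C" .
qed

end

section \<open>The derivative of the rearrangement of a Sobolev function\<close>

lemma powr_add_le:
  fixes a b :: real
  assumes "a \<ge> 0" "b \<ge> 0" "p \<ge> 0"
  shows "(a + b) powr p \<le> 2 powr p * (a powr p + b powr p)"
proof -
  have "(a + b) powr p \<le> (2 * max a b) powr p" using assms by (intro powr_mono2) auto
  also have "\<dots> = 2 powr p * (max a b) powr p" using assms by (simp add: powr_mult)
  also have "(max a b) powr p \<le> a powr p + b powr p" by (simp add: max_def)
  finally show ?thesis by simp
qed

lemma hyp_norm_le_add: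
  assumes "norm x < 1"
  shows "hyp_norm x F \<le> hyp_norm x (F - G) + hyp_norm x G"
proof -
  have "norm F \<le> norm (F - G) + norm G" using norm_triangle_ineq[of "F - G" G] by simp
  hence "hyp_scale x * norm F \<le> hyp_scale x * (norm (F - G) + norm G)"
    using hyp_scale_pos[OF assms] by (intro mult_left_mono) auto
  thus ?thesis by (simp add: hyp_norm_eq distrib_left)
qed

lemma hyp_energy_le_add:
  assumes [measurable]: "F \<in> borel_measurable hypV" "G \<in> borel_measurable hypV" and p: "p \<ge> 0"
  shows "hyp_energy p F \<le> ennreal (2 powr p) * (hyp_energy p (\<lambda>x. F x - G x) + hyp_energy p G)"
proof -
  have "hyp_energy p F \<le> (\<integral>\<^sup>+x. ennreal (2 powr p)
      * (ennreal (hyp_norm x (F x - G x) powr p) + ennreal (hyp_norm x (G x) powr p)) \<partial>hypV)"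
    unfolding hyp_energy_def
  proof (rule nn_integral_mono)
    fix x assume "x \<in> space (hypV :: (real^'a) measure)"
    hence x: "norm x < 1" by simp
    have "hyp_norm x (F x) powr p \<le> (hyp_norm x (F x - G x) + hyp_norm x (G x)) powr p"
      using x p hyp_norm_nonneg hyp_norm_le_add by (intro powr_mono2) auto
    also have "\<dots> \<le> 2 powr p * (hyp_norm x (F x - G x) powr p + hyp_norm x (G x) powr p)"
      using x p hyp_norm_nonneg by (intro powr_add_le) auto
    finally show "ennreal (hyp_norm x (F x) powr p) \<le> ennreal (2 powr p)
        * (ennreal (hyp_norm x (F x - G x) powr p) + ennreal (hyp_norm x (G x) powr p))"
      by (simp add: ennreal_leI flip: ennreal_plus ennreal_mult')
  qed
  also have "\<dots> = ennreal (2 powr p) * (hyp_energy p (\<lambda>x. F x - G x) + hyp_energy p G)"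
    unfolding hyp_energy_def by (subst nn_integral_cmult, measurable, subst nn_integral_add) auto
  finally show ?thesis .
qed

lemma distr_hyp_tendsto_0:
  fixes f :: "nat \<Rightarrow> real^'n::finite \<Rightarrow> real"
  assumes f: "\<And>k. f k \<in> borel_measurable hypV" and p: "p > 0" and \<epsilon>: "\<epsilon> > 0"
    and lim: "(\<lambda>k. \<integral>\<^sup>+x. ennreal (\<bar>f k x\<bar> powr p) \<partial>hypV) \<longlonglongrightarrow> 0"
  shows "(\<lambda>k. distr_hyp (f k) \<epsilon>) \<longlonglongrightarrow> 0"
proof (rule tendsto_sandwich[where f = "\<lambda>_. 0"])
  show "\<forall>\<^sub>F k in sequentially. distr_hyp (f k) \<epsilon>
      \<le> ennreal (1 / \<epsilon> powr p) * (\<integral>\<^sup>+x. ennreal (\<bar>f k x\<bar> powr p) \<partial>hypV)"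
    by (intro always_eventually allI distr_hyp_Markov f \<epsilon> p)
  show "(\<lambda>k. ennreal (1 / \<epsilon> powr p) * (\<integral>\<^sup>+x. ennreal (\<bar>f k x\<bar> powr p) \<partial>hypV)) \<longlonglongrightarrow> 0"
    using ennreal_tendsto_cmult[OF _ lim, of "ennreal (1 / \<epsilon> powr p)"] by simp
qed simp_all

lemma AE_isCont_decr_rearr_shift:
  assumes "rearrangeable u"
  shows "AE s in lborel. s + d > 0 \<longrightarrow> isCont (decr_rearr u) (s + d)"
proof -
  have "AE s in distr lborel borel ((+) d). s > 0 \<longrightarrow> isCont (decr_rearr u) s"
    using AE_isCont_decr_rearr[OF assms] unfolding lborel_distr_plus .
  hence "AE s in lborel. d + s > 0 \<longrightarrow> isCont (decr_rearr u) (d + s)" by (rule AE_distrD[rotated]) simp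
  thus ?thesis by (simp add: add.commute)
qed

lemma nn_integral_decr_rearr_difference_le_if_approximable:
  fixes u :: "real^'n::finite \<Rightarrow> real" and \<phi> :: "nat \<Rightarrow> real^'n \<Rightarrow> real" and L :: "real \<Rightarrow> real"
  assumes u: "rearrangeable u" and \<phi>: "\<And>k. rearrangeable (\<phi> k)"
    and conv: "\<And>\<epsilon>. \<epsilon> > 0 \<Longrightarrow> (\<lambda>k. distr_hyp (\<lambda>x. \<phi> k x - u x) \<epsilon>) \<longlonglongrightarrow> 0"
    and [measurable]: "L \<in> borel_measurable borel" and L: "\<And>s. s > 0 \<Longrightarrow> L s \<ge> 0"
    and p: "p > 0" and a: "a > 0" and d: "d > 0"
    and bound: "\<forall>\<^sub>F k in sequentially. (\<integral>\<^sup>+s. ennreal (((decr_rearr (\<phi> k) s - decr_rearr (\<phi> k) (s + d)) / d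
        * L s) powr p)
      * indicator {a<..<b} s \<partial>lborel) \<le> C"
  shows "(\<integral>\<^sup>+s. ennreal (((decr_rearr u s - decr_rearr u (s + d)) / d * L s) powr p)
      * indicator {a<..<b} s \<partial>lborel) \<le> C"
proof -
  define Q where "Q v s = ennreal (((decr_rearr v s - decr_rearr v (s + d)) / d * L s) powr p)
      * indicator {a<..<b} s"
    for v :: "real^'n \<Rightarrow> real" and s
  have [measurable]: "Q (\<phi> k) \<in> borel_measurable lborel" for k
    using decr_rearr_borel_measurable[OF \<phi>[of k]] unfolding Q_def by measurable
  have "AE s in lborel. Q u s \<le> liminf (\<lambda>k. Q (\<phi> k) s)"
    using AE_isCont_decr_rearr[OF u] AE_isCont_decr_rearr_shift[OF u, of d]
  proof eventually_elim
    case (elim s)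
    show ?case
    proof (cases "s \<in> {a<..<b}")
      case True
      hence s: "s > 0" "s + d > 0" using a d by auto
      have "(\<lambda>k. ennreal (((decr_rearr (\<phi> k) s - decr_rearr (\<phi> k) (s + d)) / d * L s) powr p))
          \<longlonglongrightarrow> ennreal (((decr_rearr u s - decr_rearr u (s + d)) / d * L s) powr p)"
      proof (intro tendsto_ennrealI tendsto_powr2 tendsto_mult_right tendsto_divide tendsto_diff tendsto_const
          decr_rearr_tendsto[OF u \<phi> conv])
        have "0 \<le> (decr_rearr (\<phi> k) s - decr_rearr (\<phi> k) (s + d)) / d * L s" for k
          using decr_rearr_antimono[OF \<phi> s(1), of "s + d" k] d L[OF s(1)] by simp
        thus "\<forall>\<^sub>F k in sequentially. 0 \<le> (decr_rearr (\<phi> k) s - decr_rearr (\<phi> k) (s + d)) / d * L s"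
          by (rule always_eventually[OF allI])
      qed (use s elim p d in auto)
      hence "(\<lambda>k. Q (\<phi> k) s) \<longlonglongrightarrow> Q u s" using True by (simp add: Q_def)
      from lim_imp_Liminf[OF sequentially_bot this] show ?thesis by simp
    qed (simp add: Q_def)
  qed
  hence "(\<integral>\<^sup>+s. Q u s \<partial>lborel) \<le> (\<integral>\<^sup>+s. liminf (\<lambda>k. Q (\<phi> k) s) \<partial>lborel)" by (rule nn_integral_mono_AE)
  also have "\<dots> \<le> liminf (\<lambda>k. \<integral>\<^sup>+s. Q (\<phi> k) s \<partial>lborel)" by (rule nn_integral_liminf) measurable
  also have "\<dots> \<le> C" using bound unfolding Q_def by (intro Liminf_le) auto
  finally show ?thesis by (simp add: Q_def)
qed

lemma W1p_hyp_Lp: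
  assumes "u \<in> W1p_hyp p"
  shows "u \<in> borel_measurable hypV" "(\<integral>\<^sup>+x. ennreal (\<bar>u x\<bar> powr p) \<partial>hypV) < \<infinity>"
  using assms by (auto simp: W1p_hyp_def)

lemma W1p_hyp_rearrangeable: "u \<in> W1p_hyp p \<Longrightarrow> p > 0 \<Longrightarrow> rearrangeable u"
  by (intro rearrangeable_if_Lp W1p_hyp_Lp)

lemma W1p_hyp_approximation:
  fixes u :: "real^'n::finite \<Rightarrow> real"
  assumes u: "u \<in> W1p_hyp p" and p: "p > 0"
  obtains \<phi> E where "\<And>k. test_fun (ball 0 1) (\<phi> k)" "E \<ge> 0"
    "\<forall>\<^sub>F k in sequentially. hyp_energy p (egrad (\<phi> k)) \<le> ennreal E"
    "\<And>\<epsilon>. \<epsilon> > 0 \<Longrightarrow> (\<lambda>k. distr_hyp (\<lambda>x. \<phi> k x - u x) \<epsilon>) \<longlonglongrightarrow> 0"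
proof -
  obtain G \<phi> where [measurable]: "G \<in> borel_measurable hypV" and G: "hyp_energy p G < \<infinity>"
    and \<phi>: "\<And>k. test_fun (ball 0 1) (\<phi> k)"
    and Lp_conv: "(\<lambda>k. \<integral>\<^sup>+x. ennreal (\<bar>\<phi> k x - u x\<bar> powr p) \<partial>hypV) \<longlonglongrightarrow> 0"
    and grad_conv: "(\<lambda>k. hyp_energy p (\<lambda>x. egrad (\<phi> k) x - G x)) \<longlonglongrightarrow> 0"
    using u unfolding W1p_hyp_def hyp_energy_def by blast
  note [measurable] = W1p_hyp_Lp(1)[OF u]
  have [measurable]: "\<phi> k \<in> borel_measurable hypV" "egrad (\<phi> k) \<in> borel_measurable hypV" for k
    by (intro borel_measurable_hypV C1c_borel_measurable[OF C1c_test_fun[OF \<phi>]])+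
  define E where "E = enn2real (ennreal (2 powr p) * (1 + hyp_energy p G))"
  have E: "ennreal (2 powr p) * (1 + hyp_energy p G) = ennreal E"
    using G unfolding E_def by (intro ennreal_enn2real[symmetric])
        (simp add: ennreal_mult_less_top ennreal_add_less_top)
  have "\<forall>\<^sub>F k in sequentially. hyp_energy p (\<lambda>x. egrad (\<phi> k) x - G x) < 1"
    using grad_conv by (rule order_tendstoD) simp
  hence "\<forall>\<^sub>F k in sequentially. hyp_energy p (egrad (\<phi> k)) \<le> ennreal E"
  proof eventually_elim
    case (elim k)
    have "hyp_energy p (egrad (\<phi> k))
        \<le> ennreal (2 powr p) * (hyp_energy p (\<lambda>x. egrad (\<phi> k) x - G x) + hyp_energy p G)"
      using p by (intro hyp_energy_le_add) auto
    also have "\<dots> \<le> ennreal (2 powr p) * (1 + hyp_energy p G)"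
      using elim by (intro mult_left_mono add_right_mono) auto
    finally show ?case by (simp only: E)
  qed
  moreover have "(\<lambda>k. distr_hyp (\<lambda>x. \<phi> k x - u x) \<epsilon>) \<longlonglongrightarrow> 0" if "\<epsilon> > 0" for \<epsilon>
    using p that Lp_conv by (intro distr_hyp_tendsto_0) auto
  ultimately show ?thesis using \<phi> by (intro that[of \<phi> E]) (auto simp: E_def)
qed

lemma W1p_hyp_decay_density:
  fixes u :: "real^'n::finite \<Rightarrow> real"
  assumes dim: "CARD('n) \<ge> 2" and p: "p > 1" and u: "u \<in> W1p_hyp p"
  obtains h where "decay_density (decr_rearr u) h"
    "(\<integral>\<^sup>+s. ennreal ((h s * iso_profile CARD('n) s) powr p) * indicator {0<..} s \<partial>lborel) < \<infinity>"
proof -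
  have p_pos: "p > 0" using p by simp
  note r = W1p_hyp_rearrangeable[OF u p_pos]
  obtain \<phi> E where \<phi>: "\<And>k. test_fun (ball 0 1) (\<phi> k)" and E: "E \<ge> 0"
    and energy: "\<forall>\<^sub>F k in sequentially. hyp_energy p (egrad (\<phi> k)) \<le> ennreal E"
    and conv: "\<And>\<epsilon>. \<epsilon> > 0 \<Longrightarrow> (\<lambda>k. distr_hyp (\<lambda>x. \<phi> k x - u x) \<epsilon>) \<longlonglongrightarrow> 0"
    using W1p_hyp_approximation[OF u p_pos] by blast
  interpret Lp_difference_quotients "decr_rearr u" "rearr_measure u" "iso_profile CARD('n)" p
      "iso_const TYPE('n) powr p * E"
  proof
    fix a b d :: real assume ab: "0 < a" "a < b" and d: "0 < d" "d \<le> a"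
    show "(\<integral>\<^sup>+s. ennreal (((decr_rearr u s - decr_rearr u (s + d)) / d * iso_profile CARD('n) s) powr p)
        * indicator {a<..<b} s \<partial>lborel)
        \<le> ennreal (iso_const TYPE('n) powr p * E)"
    proof (rule nn_integral_decr_rearr_difference_le_if_approximable[OF r test_fun_rearrangeable[OF \<phi>] conv])
      show "\<forall>\<^sub>F k in sequentially. (\<integral>\<^sup>+s. ennreal (((decr_rearr (\<phi> k) s - decr_rearr (\<phi> k) (s + d)) / d
          * iso_profile CARD('n) s) powr p)
          * indicator {a<..<b} s \<partial>lborel) \<le> ennreal (iso_const TYPE('n) powr p * E)"
        using energy by eventually_elim
            (rule nn_integral_decr_rearr_difference_test_fun[OF \<phi> dim p _ E ab d])
    qed (use p ab d in \<open>auto intro: less_imp_le[OF iso_profile_pos]\<close>)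
  qed (use p E decr_rearr_antimono[OF r] in \<open>auto simp: decr_rearr_borel_measurable[OF r]
      emeasure_rearr_measure_nonpos[OF r] emeasure_rearr_measure_Ioc[OF r]
      iso_profile_pos iso_profile_mono\<close>)
  obtain h where h: "decay_density (decr_rearr u) h" using decay_density_exists .
  show ?thesis
    using le_less_trans[OF nn_integral_decay_density_powr_le[OF h]] by (intro that[OF h]) simp
qed

section \<open>Comparison of the energies\<close>

lemma nn_integral_substitution_open:
  fixes g V V' :: "real \<Rightarrow> real"
  assumes [measurable]: "g \<in> borel_measurable borel" and g: "\<And>s. 0 < s \<Longrightarrow> g s \<ge> 0" and "r < b" "0 < V r"
    and deriv: "\<And>x. x \<in> {r..b} \<Longrightarrow> (V has_real_derivative V' x) (at x)"
    and cont: "continuous_on {r..b} V'" and V': "\<And>x. x \<in> {r..b} \<Longrightarrow> V' x \<ge> 0"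
  shows "(\<integral>\<^sup>+t. ennreal (g (V t) * V' t) * indicator {r<..<b} t \<partial>lborel)
    = (\<integral>\<^sup>+s. ennreal (g s) * indicator {V r<..<V b} s \<partial>lborel)"
proof -
  have "V r \<le> V t" if "t \<in> {r..b}" for t
    using that by (intro DERIV_nonneg_imp_nondecreasing[of r t V]) (auto intro!: exI[of _ "V' _"] deriv V')
  hence g_V: "g (V t) \<ge> 0" if "t \<in> {r..b}" for t
    using g[of "V t"] \<open>0 < V r\<close> that by (meson less_le_trans)
  have "(\<integral>\<^sup>+t. ennreal (g (V t) * V' t) * indicator {r<..<b} t \<partial>lborel)
      = (\<integral>\<^sup>+t. ennreal (g (V t)) * ennreal (V' t) * indicator {r..b} t \<partial>lborel)"
  proof (rule nn_integral_cong_AE)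
    show "AE t in lborel. ennreal (g (V t) * V' t) * indicator {r<..<b} t
        = ennreal (g (V t)) * ennreal (V' t) * indicator {r..b} t"
      using AE_lborel_singleton[of r] AE_lborel_singleton[of b]
      by eventually_elim (use g_V in \<open>auto simp: indicator_def ennreal_mult'\<close>)
  qed
  also have "\<dots> = (\<integral>\<^sup>+s. ennreal (g s) * indicator {V r..V b} s \<partial>lborel)"
    by (rule nn_integral_substitution_aux[symmetric, OF _ _ deriv cont V' \<open>r < b\<close>]) auto
  also have "\<dots> = (\<integral>\<^sup>+s. ennreal (g s) * indicator {V r<..<V b} s \<partial>lborel)"
  proof (rule nn_integral_cong_AE)
    show "AE s in lborel. ennreal (g s) * indicator {V r..V b} s = ennreal (g s) * indicator {V r<..<V b} s"
      using AE_lborel_singleton[of "V r"] AE_lborel_singleton[of "V b"]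
      by eventually_elim (auto simp: indicator_def)
  qed
  finally show ?thesis .
qed

lemma nn_integral_bounded_interval_finite_if_Lp:
  fixes g :: "real \<Rightarrow> real"
  assumes [measurable]: "g \<in> borel_measurable borel" and p: "p \<ge> 1"
    and finite: "(\<integral>\<^sup>+s. ennreal (g s powr p) * indicator {0<..} s \<partial>lborel) < \<infinity>"
  shows "(\<integral>\<^sup>+s. ennreal (g s) * indicator {0<..<b} s \<partial>lborel) < \<infinity>"
proof -
  have "(\<integral>\<^sup>+s. ennreal (g s) * indicator {0<..<b} s \<partial>lborel)
      \<le> (\<integral>\<^sup>+s. indicator {0<..<b} s + ennreal (g s powr p) * indicator {0<..} s \<partial>lborel)"
  proof (rule nn_integral_mono)
    fix s
    have "g s \<le> 1 + g s powr p"
    proof (cases "g s \<ge> 1")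
      case True
      hence "g s powr 1 \<le> g s powr p" using p by (intro powr_mono) auto
      thus ?thesis using True by simp
    qed (simp add: add_increasing2)
    hence "ennreal (g s) \<le> ennreal (1 + g s powr p)" by (rule ennreal_leI)
    also have "\<dots> = 1 + ennreal (g s powr p)" by (simp add: ennreal_plus)
    finally show "ennreal (g s) * indicator {0<..<b} s
        \<le> indicator {0<..<b} s + ennreal (g s powr p) * indicator {0<..} s"
      by (simp add: indicator_def)
  qed
  also have "\<dots> = emeasure lborel {0<..<b} + (\<integral>\<^sup>+s. ennreal (g s powr p) * indicator {0<..} s \<partial>lborel)"
    by (subst nn_integral_add) auto
  also have "\<dots> < \<infinity>"
    using finite emeasure_bounded_finite[of "{0<..<b}"]
      by (simp add: ennreal_add_less_top less_top[symmetric])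
  finally show ?thesis .
qed

definition euc_perimeter :: "'n::finite itself \<Rightarrow> real \<Rightarrow> real" where
  "euc_perimeter _ s = real CARD('n) * unit_ball_vol TYPE('n) powr (1 / real CARD('n))
      * s powr (1 - 1 / real CARD('n))"

text \<open>As a function of the Euclidean radius, whereas \<open>euc_perimeter\<close> is a function of the volume.\<close>
definition hyp_perimeter :: "'n::finite itself \<Rightarrow> real \<Rightarrow> real" where
  "hyp_perimeter _ r = unit_ball_vol TYPE('n) * (real CARD('n) * hsinh r ^ (CARD('n) - 1))"

lemma euc_perimeter_nonneg: "euc_perimeter TYPE('n::finite) s \<ge> 0"
  by (simp add: euc_perimeter_def)

lemma euc_perimeter_borel_measurable [measurable]: "euc_perimeter TYPE('n::finite) \<in> borel_measurable borel"
  unfolding euc_perimeter_def[abs_def] by measurable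

lemma hyp_perimeter_pos: "0 < r \<Longrightarrow> r < 1 \<Longrightarrow> hyp_perimeter TYPE('n::finite) r > 0"
  using unit_ball_vol_pos[where 'n='n] hsinh_pos[of r] by (simp add: hyp_perimeter_def)

lemma hyp_perimeter_borel_measurable [measurable]: "hyp_perimeter TYPE('n::finite) \<in> borel_measurable borel"
  unfolding hyp_perimeter_def[abs_def] by measurable

lemma euc_vol_pos: "r > 0 \<Longrightarrow> euc_vol TYPE('n::finite) r > 0"
  using unit_ball_vol_pos[where 'n='n] by (simp add: euc_vol_def)

lemma euc_perimeter_mult_unit_ball_vol:
  assumes "q \<ge> 0"
  shows "euc_perimeter TYPE('n::finite) (unit_ball_vol TYPE('n) * q)
    = unit_ball_vol TYPE('n) * (real CARD('n) * q powr (1 - 1 / real CARD('n)))"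
proof -
  let ?\<sigma> = "unit_ball_vol TYPE('n)"
  have "?\<sigma> powr (1 / real CARD('n)) * ?\<sigma> powr (1 - 1 / real CARD('n)) = ?\<sigma>"
    using unit_ball_vol_pos[where 'n='n] by (simp flip: powr_add)
  thus ?thesis
    using assms unit_ball_vol_pos[where 'n='n] by (simp add: euc_perimeter_def powr_mult)
qed

lemma sphere_area_eq_euc_perimeter:
  assumes "r > 0"
  shows "sphere_area TYPE(real^'n::finite) r = euc_perimeter TYPE('n) (euc_vol TYPE('n) r)"
proof -
  have "(r ^ CARD('n)) powr (1 - 1 / real CARD('n)) = r powr (real CARD('n) * (1 - 1 / real CARD('n)))"
    using assms by (intro powr_of_power) auto
  also have "real CARD('n) * (1 - 1 / real CARD('n)) = real (CARD('n) - 1)"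
    by (simp add: of_nat_diff Suc_leI field_simps)
  also have "r powr real (CARD('n) - 1) = r ^ (CARD('n) - 1)" using assms by (rule powr_realpow)
  finally show ?thesis
    using assms by (simp add: euc_vol_def euc_perimeter_mult_unit_ball_vol)
      (simp add: sphere_area_def unit_ball_vol_def)
qed

lemma euc_perimeter_mono: "0 < s \<Longrightarrow> s \<le> t \<Longrightarrow> euc_perimeter TYPE('n::finite) s \<le> euc_perimeter TYPE('n) t"
  unfolding euc_perimeter_def by (intro mult_left_mono powr_mono2) (auto simp: Suc_leI)

lemma euc_perimeter_le_iso_profile:
  assumes "s > 0"
  shows "euc_perimeter TYPE('n::finite) s
    \<le> real CARD('n) * unit_ball_vol TYPE('n) powr (1 / real CARD('n)) * iso_profile CARD('n) s"
  unfolding euc_perimeter_def iso_profile_def using assms by (intro mult_left_mono) auto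

lemma hyp_perimeter_le:
  assumes dim: "CARD('n::finite) \<ge> 2" and r: "0 < r" "r < 1"
  shows "hyp_perimeter TYPE('n) r
      \<le> 2 * (real CARD('n) * hyp_vol TYPE('n) r + euc_perimeter TYPE('n) (hyp_vol TYPE('n) r))"
proof -
  let ?\<sigma> = "unit_ball_vol TYPE('n)" and ?q = "hvol CARD('n) r"
  have "hyp_perimeter TYPE('n) r \<le> ?\<sigma> * (real CARD('n) * (2 * (?q + ?q powr (1 - 1 / real CARD('n)))))"
    unfolding hyp_perimeter_def using hsinh_power_le[of r "CARD('n)"] r dim unit_ball_vol_pos[where 'n='n]
    by (intro mult_left_mono) auto
  also have "\<dots> = 2 * (real CARD('n) * (?\<sigma> * ?q) + ?\<sigma> * (real CARD('n) * ?q powr (1 - 1 / real CARD('n))))"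
    by (simp add: algebra_simps)
  finally show ?thesis
    using r hvol_nonneg[of r "CARD('n)"] by (simp add: hyp_vol_def euc_perimeter_mult_unit_ball_vol)
qed

lemma hyp_perimeter_le_iso_profile:
  assumes "CARD('n::finite) \<ge> 2"
  obtains C where "C > 0" "\<And>r. 0 < r \<Longrightarrow> r < 1 \<Longrightarrow> hyp_perimeter TYPE('n) r
      \<le> C * iso_profile CARD('n) (hyp_vol TYPE('n) r)"
proof -
  define c where "c = real CARD('n) * unit_ball_vol TYPE('n) powr (1 / real CARD('n))"
  have c: "c \<ge> 0" by (simp add: c_def)
  have "hyp_perimeter TYPE('n) r \<le> 2 * (real CARD('n) + c) * iso_profile CARD('n) (hyp_vol TYPE('n) r)"
    if r: "0 < r" "r < 1" for r
  proof -
    have "hyp_vol TYPE('n) r \<le> iso_profile CARD('n) (hyp_vol TYPE('n) r)" by (simp add: iso_profile_def)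
    hence "real CARD('n) * hyp_vol TYPE('n) r \<le> real CARD('n) * iso_profile CARD('n) (hyp_vol TYPE('n) r)"
      by (rule mult_left_mono) simp
    moreover have "euc_perimeter TYPE('n) (hyp_vol TYPE('n) r)
        \<le> c * iso_profile CARD('n) (hyp_vol TYPE('n) r)"
      unfolding c_def by (intro euc_perimeter_le_iso_profile hyp_vol_pos r)
    ultimately have "hyp_perimeter TYPE('n) r
        \<le> 2 * (real CARD('n) * iso_profile CARD('n) (hyp_vol TYPE('n) r) + c * iso_profile CARD('n) (hyp_vol TYPE('n) r))"
      by (intro order_trans[OF hyp_perimeter_le[OF assms r]] mult_left_mono add_mono) auto
    thus ?thesis by (simp add: algebra_simps)
  qed
  thus ?thesis using c by (intro that[of "2 * (real CARD('n) + c)"]) (auto intro: add_pos_nonneg)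
qed

lemma euc_perimeter_powr_add_le_hyp_perimeter:
  assumes exponent: "(CARD('n::finite) = 2 \<and> p \<ge> 2) \<or> (CARD('n) \<ge> 3
      \<and> p \<ge> 2 * real CARD('n) / (real CARD('n) - 1))"
    and r: "0 < r" "r < 1"
  shows "euc_perimeter TYPE('n) (hyp_vol TYPE('n) r) powr p
      + ((real CARD('n) - 1) * hyp_vol TYPE('n) r) powr p
    \<le> hyp_perimeter TYPE('n) r powr p"
proof -
  define n where "n = real CARD('n)"
  define \<sigma> where "\<sigma> = unit_ball_vol TYPE('n)"
  define q where "q = hvol CARD('n) r"
  have n: "n \<ge> 2" and pos: "q \<ge> 0" "\<sigma> > 0" "hsinh r \<ge> 0"
    using exponent r hvol_nonneg[of r] hsinh_nonneg[of r] unit_ball_vol_pos[where 'n='n]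
    by (auto simp: n_def q_def \<sigma>_def)
  have "(n * q powr (1 - 1 / n)) powr p + ((n - 1) * q) powr p \<le> (n * hsinh r ^ (CARD('n) - 1)) powr p"
    using perimeter_comparison[OF _ r(2) exponent] r(1) n by (simp add: n_def q_def diff_divide_distrib)
  hence "\<sigma> powr p * ((n * q powr (1 - 1 / n)) powr p + ((n - 1) * q) powr p)
      \<le> \<sigma> powr p * (n * hsinh r ^ (CARD('n) - 1)) powr p"
    by (rule mult_left_mono) simp
  also have "\<dots> = hyp_perimeter TYPE('n) r powr p"
    using n pos by (subst powr_mult[symmetric]) (auto simp: hyp_perimeter_def \<sigma>_def n_def)
  also have "\<sigma> powr p * ((n * q powr (1 - 1 / n)) powr p + ((n - 1) * q) powr p)
      = (\<sigma> * (n * q powr (1 - 1 / n))) powr p + (\<sigma> * ((n - 1) * q)) powr p"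
    using n pos by (simp only: powr_mult distrib_left)
  also have "\<sigma> * (n * q powr (1 - 1 / n)) = euc_perimeter TYPE('n) (hyp_vol TYPE('n) r)"
    using pos by (simp add: hyp_vol_def euc_perimeter_mult_unit_ball_vol \<sigma>_def n_def q_def)
  also have "\<sigma> * ((n - 1) * q) = (real CARD('n) - 1) * hyp_vol TYPE('n) r"
    by (simp add: hyp_vol_def \<sigma>_def n_def q_def)
  finally show ?thesis .
qed

locale volume_rearrangement =
  fixes f h V V' :: "real \<Rightarrow> real" and u :: "real^'n::finite \<Rightarrow> real" and R :: ereal and p :: real
  assumes density: "decay_density f h" and p: "p \<ge> 1"
    and Lp: "(\<integral>\<^sup>+s. ennreal ((h s * iso_profile CARD('n) s) powr p) * indicator {0<..} s \<partial>lborel) < \<infinity>"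
    and R_pos: "0 < R" and V_borel [measurable]: "V \<in> borel_measurable borel" "V' \<in> borel_measurable borel"
    and V_deriv: "\<And>r. 0 < r \<Longrightarrow> ereal r < R \<Longrightarrow> (V has_real_derivative V' r) (at r)"
    and V'_cont: "\<And>r. 0 < r \<Longrightarrow> ereal r < R \<Longrightarrow> isCont V' r"
    and V'_pos: "\<And>r. 0 < r \<Longrightarrow> ereal r < R \<Longrightarrow> V' r > 0"
    and euc_vol_le: "\<And>r. 0 < r \<Longrightarrow> ereal r < R \<Longrightarrow> euc_vol TYPE('n) r \<le> V r"
    and u_eq: "\<And>x. x \<noteq> 0 \<Longrightarrow> ereal (norm x) < R \<Longrightarrow> u x = f (V (norm x))"
begin

lemmas h_borel [measurable] = decay_density_borel_measurable[OF density]

lemma V_pos: "0 < r \<Longrightarrow> ereal r < R \<Longrightarrow> V r > 0"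
  using less_le_trans[OF euc_vol_pos euc_vol_le] .

lemma less_R: "r \<le> b \<Longrightarrow> ereal b < R \<Longrightarrow> ereal r < R"
  by (rule le_less_trans[of _ "ereal b"]) auto

lemma V_strict_mono:
  assumes "0 < r" "r < b" "ereal b < R"
  shows "V r < V b"
  using assms V_deriv V'_pos less_R[of _ b]
  by (intro DERIV_pos_imp_increasing[of r b V]) (meson less_le_trans)+

lemma nn_integral_substitution_V:
  assumes "g \<in> borel_measurable borel" "\<And>s. 0 < s \<Longrightarrow> g s \<ge> 0" and r: "0 < r" "r < b" "ereal b < R"
  shows "(\<integral>\<^sup>+t. ennreal (g (V t) * V' t) * indicator {r<..<b} t \<partial>lborel)
    = (\<integral>\<^sup>+s. ennreal (g s) * indicator {V r<..<V b} s \<partial>lborel)"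
proof (rule nn_integral_substitution_open[OF assms(1,2) r(2)])
  have inside: "0 < x" "ereal x < R" if "x \<in> {r..b}" for x using that r less_R[of x b] by auto
  show "(V has_real_derivative V' x) (at x)" "V' x \<ge> 0" if "x \<in> {r..b}" for x
    using V_deriv V'_pos inside[OF that] less_imp_le by blast+
  show "continuous_on {r..b} V'"
    using inside V'_cont by (intro continuous_at_imp_continuous_on) blast
  show "0 < V r" using V_pos r less_R[of r b] by simp
qed

lemma nn_integral_substitution_V_le:
  assumes [measurable]: "g \<in> borel_measurable borel" and g: "\<And>s. 0 < s \<Longrightarrow> g s \<ge> 0"
    and b: "0 < b" "ereal b < R"
  shows "(\<integral>\<^sup>+t. ennreal (g (V t) * V' t) * indicator {0<..<b} t \<partial>lborel)
    \<le> (\<integral>\<^sup>+s. ennreal (g s) * indicator {0<..<V b} s \<partial>lborel)"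
proof -
  have "(\<integral>\<^sup>+t. (ennreal (g (V t) * V' t) * indicator {..<b} t) * indicator {0<..} t \<partial>lborel)
      \<le> (\<integral>\<^sup>+s. ennreal (g s) * indicator {0<..<V b} s \<partial>lborel)"
  proof (rule nn_integral_greaterThan_0_le)
    fix a c :: real assume a: "0 < a" "a < c"
    show "(\<integral>\<^sup>+t. (ennreal (g (V t) * V' t) * indicator {..<b} t) * indicator {a<..<c} t \<partial>lborel)
        \<le> (\<integral>\<^sup>+s. ennreal (g s) * indicator {0<..<V b} s \<partial>lborel)"
    proof (cases "a < b")
      case True
      have "(\<integral>\<^sup>+t. (ennreal (g (V t) * V' t) * indicator {..<b} t) * indicator {a<..<c} t \<partial>lborel)
          \<le> (\<integral>\<^sup>+t. ennreal (g (V t) * V' t) * indicator {a<..<b} t \<partial>lborel)"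
        by (intro nn_integral_mono) (auto simp: indicator_def)
      also have "\<dots> = (\<integral>\<^sup>+s. ennreal (g s) * indicator {V a<..<V b} s \<partial>lborel)"
        by (rule nn_integral_substitution_V[OF assms(1) g a(1) True b(2)])
      also have "\<dots> \<le> (\<integral>\<^sup>+s. ennreal (g s) * indicator {0<..<V b} s \<partial>lborel)"
        using V_pos[OF a(1) less_R[OF less_imp_le[OF True] b(2)]]
        by (intro nn_integral_mono) (auto simp: indicator_def)
      finally show ?thesis .
    next
      case False
      hence vanish: "(ennreal (g (V t) * V' t) * indicator {..<b} t) * indicator {a<..<c} t = 0" for t
        by (auto simp: indicator_def)
      show ?thesis unfolding vanish by simp
    qed
  qed measurable
  moreover have "(ennreal (g (V t) * V' t) * indicator {..<b} t) * indicator {0<..} t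
      = ennreal (g (V t) * V' t) * indicator {0<..<b} t" for t
    by (auto simp: indicator_def)
  ultimately show ?thesis by simp
qed

text \<open>Since balls are at least as large as Euclidean ones, the Euclidean area element is bounded by the
  isoperimetric profile at the volume \<open>V r\<close>, and \<open>h\<close> times the profile is locally integrable.\<close>
lemma nn_integral_ball_finite:
  assumes b: "0 < b" "ereal b < R"
  shows "(\<integral>\<^sup>+x. ennreal (h (V (norm x)) * V' (norm x)) * indicator (ball (0::real^'n) b) x \<partial>lborel) < \<infinity>"
proof -
  define c where "c = real CARD('n) * unit_ball_vol TYPE('n) powr (1 / real CARD('n))"
  define g where "g s = h s * iso_profile CARD('n) s" for s
  have [measurable]: "g \<in> borel_measurable borel" unfolding g_def by measurable
  have g: "g s \<ge> 0" if "s > 0" for s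
    using that iso_profile_pos[of s] decay_density_nonneg[OF density] by (simp add: g_def less_imp_le)
  have "(\<integral>\<^sup>+x. ennreal (h (V (norm x)) * V' (norm x)) * indicator (ball (0::real^'n) b) x \<partial>lborel)
      = (\<integral>\<^sup>+x. (\<lambda>r. ennreal (h (V r) * V' r) * indicator {..<b} r) (norm (x::real^'n)) \<partial>lborel)"
    by (intro nn_integral_cong) (auto simp: indicator_def)
  also have "\<dots> = (\<integral>\<^sup>+r. (ennreal (h (V r) * V' r) * indicator {..<b} r)
      * (ennreal (sphere_area TYPE(real^'n) r) * indicator {0<..} r) \<partial>lborel)"
    by (rule nn_integral_radial) measurable
  also have "\<dots> \<le> (\<integral>\<^sup>+r. ennreal c * (ennreal (g (V r) * V' r) * indicator {0<..<b} r) \<partial>lborel)"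
  proof (rule nn_integral_mono)
    fix r
    have "h (V r) * V' r * sphere_area TYPE(real^'n) r \<le> c * (g (V r) * V' r)" if r: "0 < r" "r < b"
    proof -
      have inside: "ereal r < R" using r b less_R[of r b] by simp
      have "sphere_area TYPE(real^'n) r \<le> euc_perimeter TYPE('n) (V r)"
        unfolding sphere_area_eq_euc_perimeter[OF r(1)]
        by (intro euc_perimeter_mono euc_vol_pos euc_vol_le r(1) inside)
      also have "\<dots> \<le> c * iso_profile CARD('n) (V r)"
        unfolding c_def by (rule euc_perimeter_le_iso_profile[OF V_pos[OF r(1) inside]])
      finally have "h (V r) * V' r * sphere_area TYPE(real^'n) r
          \<le> h (V r) * V' r * (c * iso_profile CARD('n) (V r))"
        using decay_density_nonneg[OF density] V'_pos[OF r(1) inside] by (intro mult_left_mono) auto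
      thus ?thesis by (simp add: g_def mult_ac)
    qed
    thus "(ennreal (h (V r) * V' r) * indicator {..<b} r)
        * (ennreal (sphere_area TYPE(real^'n) r) * indicator {0<..} r)
        \<le> ennreal c * (ennreal (g (V r) * V' r) * indicator {0<..<b} r)"
      using sphere_area_nonneg[of r, where 'a="real^'n"]
      by (auto simp: indicator_def c_def intro!: ennreal_leI simp flip: ennreal_mult'' ennreal_mult')
  qed
  also have "\<dots> = ennreal c * (\<integral>\<^sup>+r. ennreal (g (V r) * V' r) * indicator {0<..<b} r \<partial>lborel)"
    by (rule nn_integral_cmult) measurable
  also have "\<dots> \<le> ennreal c * (\<integral>\<^sup>+s. ennreal (g s) * indicator {0<..<V b} s \<partial>lborel)"
    by (intro mult_left_mono nn_integral_substitution_V_le g b) auto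
  also have "\<dots> < \<infinity>"
    using nn_integral_bounded_interval_finite_if_Lp[OF _ p Lp[folded g_def], of "V b"]
      by (simp add: ennreal_mult_less_top)
  finally show ?thesis .
qed

lemma weak_grad_rearrangement:
  "weak_grad {x. ereal (norm x) < R} u (radial_field (\<lambda>r. h (V r) * V' r))"
proof -
  interpret radial_profile "\<lambda>r. f (V r)" "\<lambda>r. h (V r) * V' r" u R
  proof
    show "h (V r) * V' r \<ge> 0" if "0 < r" "ereal r < R" for r
      using V'_pos[OF that] decay_density_nonneg[OF density] by simp
    fix r b :: real assume r: "0 < r" "r < b" "ereal b < R"
    have V: "0 < V r" "V r < V b" using V_pos[of r] V_strict_mono[OF r] less_R[of r b] r by auto
    show "f (V b) \<le> f (V r) \<and>
        (\<integral>\<^sup>+t. ennreal (h (V t) * V' t) * indicator {r<..<b} t \<partial>lborel) = ennreal (f (V r) - f (V b))"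
      using nn_integral_substitution_V[OF h_borel decay_density_nonneg[OF density] r]
        nn_integral_decay_density[OF density V] decay_density_antimono[OF density, of "V r" "V b"] V by simp
  qed (use R_pos u_eq nn_integral_ball_finite in auto)
  show ?thesis by (rule weak_grad_radial)
qed

end

definition hyp_rearr_grad :: "(real \<Rightarrow> real) \<Rightarrow> real^'n::finite \<Rightarrow> real^'n" where
  "hyp_rearr_grad h = radial_field (\<lambda>r. h (hyp_vol TYPE('n) r) * (hyp_perimeter TYPE('n) r * conf r))"

definition euc_rearr_grad :: "(real \<Rightarrow> real) \<Rightarrow> real^'n::finite \<Rightarrow> real^'n" where
  "euc_rearr_grad h = radial_field (\<lambda>r. h (euc_vol TYPE('n) r) * sphere_area TYPE(real^'n) r)"

lemma hyp_rearr_grad_borel_measurable [measurable]: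
  assumes [measurable]: "h \<in> borel_measurable borel"
  shows "hyp_rearr_grad h \<in> borel_measurable borel"
  unfolding hyp_rearr_grad_def by measurable

lemma euc_rearr_grad_borel_measurable [measurable]:
  assumes [measurable]: "h \<in> borel_measurable borel"
  shows "euc_rearr_grad h \<in> borel_measurable borel"
  unfolding euc_rearr_grad_def by measurable

lemma power_le_hvol:
  assumes "0 \<le> r" "r < 1" "n > 0"
  shows "r ^ n \<le> hvol n r"
proof -
  define F where "F r = hvol n r - r ^ n" for r
  have "0 \<le> F r"
  proof (rule nonneg_if_DERIV_nonneg[OF assms(1,2)])
    show "F 0 = 0" using assms(3) by (simp add: F_def)
    show "continuous_on {0..<1} F" unfolding F_def by (intro continuous_intros continuous_on_hvol)
    fix x :: real assume x: "0 < x" "x < 1"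
    show "(F has_real_derivative real n * hsinh x ^ (n - 1) * conf x - real n * x ^ (n - 1)) (at x)"
      unfolding F_def using DERIV_pow[of n x UNIV] by (intro DERIV_diff DERIV_hvol x) simp
    have conf: "conf x \<ge> 1" using conf_ge_2[of x] x by simp
    hence "x \<le> hsinh x" using x by (simp add: hsinh_eq_conf_mult)
    hence "real n * x ^ (n - 1) * 1 \<le> real n * hsinh x ^ (n - 1) * conf x"
      using x conf by (intro mult_mono power_mono) auto
    thus "real n * hsinh x ^ (n - 1) * conf x - real n * x ^ (n - 1) \<ge> 0" by simp
  qed
  thus ?thesis by (simp add: F_def)
qed

lemma weak_grad_hyp_sym_rearr:
  fixes u :: "real^'n::finite \<Rightarrow> real"
  assumes h: "decay_density (decr_rearr u) h" and p: "p \<ge> 1"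
    and Lp: "(\<integral>\<^sup>+s. ennreal ((h s * iso_profile CARD('n) s) powr p) * indicator {0<..} s \<partial>lborel) < \<infinity>"
  shows "weak_grad (ball 0 1) (hyp_sym_rearr u) (hyp_rearr_grad h)"
proof -
  interpret volume_rearrangement "decr_rearr u" h "hyp_vol TYPE('n)" "\<lambda>r. hyp_perimeter TYPE('n) r * conf r"
    "hyp_sym_rearr u" 1 p
  proof
    fix r :: real assume "0 < r" "ereal r < 1"
    hence r: "0 < r" "r < 1" by simp_all
    show "(hyp_vol TYPE('n) has_real_derivative hyp_perimeter TYPE('n) r * conf r) (at r)"
      unfolding hyp_vol_def[abs_def] hyp_perimeter_def mult.assoc
      using DERIV_cmult[OF DERIV_hvol[OF r]] by (simp add: mult.assoc)
    show "isCont (\<lambda>r. hyp_perimeter TYPE('n) r * conf r) r"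
      unfolding hyp_perimeter_def using r continuous_on_interior[OF continuous_on_hsinh, of r]
        continuous_on_interior[OF continuous_on_conf, of r] by (intro continuous_intros) auto
    show "hyp_perimeter TYPE('n) r * conf r > 0" using r hyp_perimeter_pos[of r, where 'n='n] conf_pos[of r]
      by simp
    show "euc_vol TYPE('n) r \<le> hyp_vol TYPE('n) r"
      using r power_le_hvol[of r "CARD('n)"] unit_ball_vol_pos[where 'n='n]
        by (simp add: euc_vol_def hyp_vol_def)
  qed (use h p Lp in \<open>auto simp: hyp_sym_rearr_eq\<close>)
  have "{x::real^'n. ereal (norm x) < 1} = ball 0 1" by auto
  thus ?thesis using weak_grad_rearrangement unfolding hyp_rearr_grad_def by simp
qed

lemma weak_grad_euc_sym_rearr:
  fixes u :: "real^'n::finite \<Rightarrow> real"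
  assumes h: "decay_density (decr_rearr u) h" and p: "p \<ge> 1"
    and Lp: "(\<integral>\<^sup>+s. ennreal ((h s * iso_profile CARD('n) s) powr p) * indicator {0<..} s \<partial>lborel) < \<infinity>"
  shows "weak_grad UNIV (euc_sym_rearr u) (euc_rearr_grad h)"
proof -
  interpret volume_rearrangement "decr_rearr u" h "euc_vol TYPE('n)" "sphere_area TYPE(real^'n)"
      "euc_sym_rearr u" \<infinity> p
  proof
    fix r :: real assume r: "0 < r"
    show "(euc_vol TYPE('n) has_real_derivative sphere_area TYPE(real^'n) r) (at r)"
      unfolding euc_vol_def[abs_def] sphere_area_def unit_ball_vol_def
        by (auto intro!: derivative_eq_intros)
    show "isCont (sphere_area TYPE(real^'n)) r"
      unfolding sphere_area_def[abs_def] by (intro continuous_intros)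
    show "sphere_area TYPE(real^'n) r > 0"
      using r unit_ball_vol_pos[where 'n='n] by (simp add: sphere_area_def unit_ball_vol_def)
  qed (use h p Lp in \<open>auto simp: euc_sym_rearr_eq\<close>)
  have "{x::real^'n. ereal (norm x) < \<infinity>} = UNIV" by auto
  thus ?thesis using weak_grad_rearrangement unfolding euc_rearr_grad_def by simp
qed

lemma AE_hypV_neq_0: "AE x in (hypV :: (real^'n::finite) measure). x \<noteq> 0"
  by (rule AE_hypV_if_AE_lborel[OF AE_lborel_singleton])

lemma hyp_energy_hyp_rearr_grad:
  fixes h :: "real \<Rightarrow> real"
  assumes "\<And>s. h s \<ge> 0"
  shows "hyp_energy p (hyp_rearr_grad h :: real^'n::finite \<Rightarrow> real^'n)
    = (\<integral>\<^sup>+x. ennreal ((h (hyp_vol TYPE('n) (norm x)) * hyp_perimeter TYPE('n) (norm x)) powr p) \<partial>(hypV :: (real^'n) measure))"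
  unfolding hyp_energy_def
proof (rule nn_integral_cong_AE)
  show "AE x::real^'n in hypV. ennreal (hyp_norm x (hyp_rearr_grad h x) powr p)
      = ennreal ((h (hyp_vol TYPE('n) (norm x)) * hyp_perimeter TYPE('n) (norm x)) powr p)"
    using AE_hypV_neq_0 AE_space
  proof eventually_elim
    case (elim x)
    define r where "r = norm x"
    have r: "0 < r" "r < 1" using elim by (auto simp: r_def)
    have "norm (hyp_rearr_grad h x) = h (hyp_vol TYPE('n) r) * (hyp_perimeter TYPE('n) r * conf r)"
      unfolding hyp_rearr_grad_def norm_radial_field[OF elim(1)] r_def[symmetric]
      using assms hyp_perimeter_pos[OF r, where 'n='n] conf_pos[of r] r by (simp add: abs_mult)
    hence "hyp_norm x (hyp_rearr_grad h x) = h (hyp_vol TYPE('n) r) * hyp_perimeter TYPE('n) r"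
      using hyp_scale_pos[of x] elim(2) by (simp add: hyp_norm_eq r_def conf_eq)
    thus ?case by (simp add: r_def)
  qed
qed

lemma hyp_energy_hyp_rearr_grad_finite:
  assumes dim: "CARD('n::finite) \<ge> 2" and p: "p \<ge> 1"
    and [measurable]: "h \<in> borel_measurable borel" and h: "\<And>s. h s \<ge> 0"
    and Lp: "(\<integral>\<^sup>+s. ennreal ((h s * iso_profile CARD('n) s) powr p) * indicator {0<..} s \<partial>lborel) < \<infinity>"
  shows "hyp_energy p (hyp_rearr_grad h :: real^'n \<Rightarrow> real^'n) < \<infinity>"
proof -
  let ?V = "hyp_vol TYPE('n)" and ?L = "iso_profile CARD('n)"
  obtain C where C: "C > 0" "\<And>r. 0 < r \<Longrightarrow> r < 1 \<Longrightarrow> hyp_perimeter TYPE('n) r \<le> C * ?L (?V r)"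
    using hyp_perimeter_le_iso_profile[OF dim] by blast
  have "hyp_energy p (hyp_rearr_grad h :: real^'n \<Rightarrow> real^'n)
      \<le> (\<integral>\<^sup>+x. ennreal (C powr p) * ennreal ((h (?V (norm x)) * ?L (?V (norm x))) powr p) \<partial>(hypV :: (real^'n) measure))"
    unfolding hyp_energy_hyp_rearr_grad[OF h]
  proof (rule nn_integral_mono_AE)
    show "AE x in (hypV :: (real^'n) measure). ennreal ((h (?V (norm x))
        * hyp_perimeter TYPE('n) (norm x)) powr p)
        \<le> ennreal (C powr p) * ennreal ((h (?V (norm x)) * ?L (?V (norm x))) powr p)"
      using AE_hypV_neq_0 AE_space
    proof eventually_elim
      case (elim x)
      define r where "r = norm x"
      have r: "0 < r" "r < 1" using elim by (auto simp: r_def)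
      have "(h (?V r) * hyp_perimeter TYPE('n) r) powr p \<le> (C * (h (?V r) * ?L (?V r))) powr p"
        using mult_left_mono[OF C(2)[OF r] h[of "?V r"]] h p hyp_perimeter_pos[OF r, where 'n='n]
        by (intro powr_mono2) (auto simp: mult_ac)
      also have "\<dots> = C powr p * (h (?V r) * ?L (?V r)) powr p"
        using C(1) h less_imp_le[OF iso_profile_pos[OF hyp_vol_pos[OF r]]] by (simp add: powr_mult)
      finally show ?case by (simp add: r_def ennreal_leI flip: ennreal_mult')
    qed
  qed
  also have "\<dots> = (\<integral>\<^sup>+s. (ennreal (C powr p) * ennreal ((h s * ?L s) powr p)) * indicator {0<..} s \<partial>lborel)"
    by (subst hyp_volume_coordinate[OF dim, symmetric]) simp_all
  also have "\<dots> = ennreal (C powr p) * (\<integral>\<^sup>+s. ennreal ((h s * ?L s) powr p) * indicator {0<..} s \<partial>lborel)"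
    unfolding mult.assoc by (rule nn_integral_cmult) measurable
  also have "\<dots> < \<infinity>" using Lp by (simp add: ennreal_mult_less_top)
  finally show ?thesis .
qed

lemma nn_integral_euc_rearr_grad_powr:
  assumes [measurable]: "h \<in> borel_measurable borel" and h: "\<And>s. h s \<ge> 0"
  shows "(\<integral>\<^sup>+x. ennreal (norm (euc_rearr_grad h (x::real^'n::finite)) powr p) \<partial>lebesgue)
    = (\<integral>\<^sup>+s. ennreal ((h s * euc_perimeter TYPE('n) s) powr p) * indicator {0<..} s \<partial>lborel)"
proof -
  let ?V = "euc_vol TYPE('n)"
  have "(\<integral>\<^sup>+x. ennreal (norm (euc_rearr_grad h (x::real^'n)) powr p) \<partial>lebesgue)
      = (\<integral>\<^sup>+x. ennreal ((h (?V (norm (x::real^'n))) * euc_perimeter TYPE('n) (?V (norm x))) powr p) \<partial>lborel)"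
    unfolding nn_integral_completion
  proof (rule nn_integral_cong_AE)
    show "AE x::real^'n in lborel. ennreal (norm (euc_rearr_grad h x) powr p)
        = ennreal ((h (?V (norm x)) * euc_perimeter TYPE('n) (?V (norm x))) powr p)"
      using AE_lborel_singleton[of 0]
      by eventually_elim (use h euc_perimeter_nonneg[where 'n='n] in
        \<open>simp add: euc_rearr_grad_def norm_radial_field sphere_area_eq_euc_perimeter\<close>)
  qed
  also have "\<dots> = (\<integral>\<^sup>+s. ennreal ((h s * euc_perimeter TYPE('n) s) powr p) * indicator {0<..} s \<partial>lborel)"
    by (rule euc_volume_coordinate[of "\<lambda>s. ennreal ((h s * euc_perimeter TYPE('n) s) powr p)"]) measurable
  finally show ?thesis .
qed

lemma hyp_sym_rearr_borel_measurable:
  assumes "rearrangeable u"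
  shows "hyp_sym_rearr u \<in> borel_measurable hypV"
proof -
  note [measurable] = decr_rearr_borel_measurable[OF assms]
  have "(\<lambda>x. decr_rearr u (hyp_vol TYPE('a) (norm x))) \<in> borel_measurable hypV"
    by (rule borel_measurable_hypV) measurable
  thus ?thesis by (rule measurable_cong[THEN iffD2, rotated]) (simp add: hyp_sym_rearr_eq)
qed

lemma nn_integral_hyp_sym_rearr_powr:
  fixes u :: "real^'n::finite \<Rightarrow> real"
  assumes dim: "CARD('n) \<ge> 2" and u: "rearrangeable u"
  shows "(\<integral>\<^sup>+x. ennreal (\<bar>hyp_sym_rearr u x\<bar> powr p) \<partial>hypV)
    = (\<integral>\<^sup>+s. ennreal (decr_rearr u s powr p) * indicator {0<..} s \<partial>lborel)"
proof -
  note [measurable] = decr_rearr_borel_measurable[OF u]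
  have "(\<integral>\<^sup>+x. ennreal (\<bar>hyp_sym_rearr u x\<bar> powr p) \<partial>hypV)
      = (\<integral>\<^sup>+x. ennreal (\<bar>decr_rearr u (hyp_vol TYPE('n) (norm x))\<bar> powr p) \<partial>(hypV :: (real^'n) measure))"
    by (intro nn_integral_cong) (simp add: hyp_sym_rearr_eq)
  also have "\<dots> = (\<integral>\<^sup>+s. ennreal (\<bar>decr_rearr u s\<bar> powr p) * indicator {0<..} s \<partial>lborel)"
    by (rule hyp_volume_coordinate[OF dim, of "\<lambda>s. ennreal (\<bar>decr_rearr u s\<bar> powr p)"]) measurable
  also have "\<dots> = (\<integral>\<^sup>+s. ennreal (decr_rearr u s powr p) * indicator {0<..} s \<partial>lborel)"
    by (intro nn_integral_cong) (simp add: indicator_def decr_rearr_nonneg[OF u])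
  finally show ?thesis .
qed

lemma decr_rearr_le_nn_integral_tail:
  assumes u: "rearrangeable u" and h: "decay_density (decr_rearr u) h" and s: "s > 0"
  shows "ennreal (decr_rearr u s) \<le> (\<integral>\<^sup>+t. ennreal (h t) * indicator {s..} t \<partial>lborel)"
proof (rule ennreal_le_epsilon)
  fix e :: real assume e: "e > 0"
  obtain b where b: "b > 0" "\<And>t. t \<ge> b \<Longrightarrow> decr_rearr u t \<le> e"
    using decr_rearr_small_at_top[OF u e] by blast
  define c where "c = max b (s + 1)"
  have c: "s < c" "decr_rearr u c \<le> e" using b by (auto simp: c_def)
  have "ennreal (decr_rearr u s) \<le> ennreal ((decr_rearr u s - decr_rearr u c) + e)"
    using c by (intro ennreal_leI) simp
  also have "\<dots> = ennreal (decr_rearr u s - decr_rearr u c) + ennreal e"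
    using decr_rearr_antimono[OF u s, of c] c e by (intro ennreal_plus) auto
  also have "ennreal (decr_rearr u s - decr_rearr u c)
      = (\<integral>\<^sup>+t. ennreal (h t) * indicator {s<..<c} t \<partial>lborel)"
    using nn_integral_decay_density[OF h s c(1)] by simp
  also have "\<dots> \<le> (\<integral>\<^sup>+t. ennreal (h t) * indicator {s..} t \<partial>lborel)"
    by (intro nn_integral_mono) (auto simp: indicator_def)
  finally show "ennreal (decr_rearr u s) \<le> (\<integral>\<^sup>+t. ennreal (h t) * indicator {s..} t \<partial>lborel) + ennreal e"
    by (simp add: add_right_mono)
qed

lemma nn_integral_perimeter_comparison:
  assumes dim: "CARD('n::finite) \<ge> 2"
    and exponent: "(CARD('n) = 2 \<and> p \<ge> 2) \<or> (CARD('n) \<ge> 3 \<and> p \<ge> 2 * real CARD('n) / (real CARD('n) - 1))"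
    and [measurable]: "h \<in> borel_measurable borel" and h: "\<And>s. h s \<ge> 0"
  shows "(\<integral>\<^sup>+s. ennreal ((h s * euc_perimeter TYPE('n) s) powr p) * indicator {0<..} s \<partial>lborel)
      + ennreal ((real CARD('n) - 1) powr p)
        * (\<integral>\<^sup>+s. ennreal ((s * h s) powr p) * indicator {0<..} s \<partial>lborel)
    \<le> hyp_energy p (hyp_rearr_grad h :: real^'n \<Rightarrow> real^'n)"
proof -
  define n where "n = real CARD('n)"
  define g where "g s = (h s * euc_perimeter TYPE('n) s) powr p + (n - 1) powr p * (s * h s) powr p" for s
  have [measurable]: "g \<in> borel_measurable borel" unfolding g_def by measurable
  have "(\<integral>\<^sup>+s. ennreal ((h s * euc_perimeter TYPE('n) s) powr p) * indicator {0<..} s \<partial>lborel)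
      + ennreal ((n - 1) powr p) * (\<integral>\<^sup>+s. ennreal ((s * h s) powr p) * indicator {0<..} s \<partial>lborel)
      = (\<integral>\<^sup>+s. ennreal ((h s * euc_perimeter TYPE('n) s) powr p) * indicator {0<..} s
          + ennreal ((n - 1) powr p) * (ennreal ((s * h s) powr p) * indicator {0<..} s) \<partial>lborel)"
    by (subst nn_integral_add) (auto simp: nn_integral_cmult)
  also have "\<dots> = (\<integral>\<^sup>+s. ennreal (g s) * indicator {0<..} s \<partial>lborel)"
    by (intro nn_integral_cong) (auto simp: g_def indicator_def simp flip: ennreal_plus ennreal_mult')
  also have "\<dots> = (\<integral>\<^sup>+x. ennreal (g (hyp_vol TYPE('n) (norm x))) \<partial>(hypV :: (real^'n) measure))"
    by (rule hyp_volume_coordinate[OF dim, of "\<lambda>s. ennreal (g s)", symmetric]) measurable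
  also have "\<dots> \<le> hyp_energy p (hyp_rearr_grad h :: real^'n \<Rightarrow> real^'n)"
    unfolding hyp_energy_hyp_rearr_grad[OF h]
  proof (rule nn_integral_mono_AE)
    show "AE x in (hypV :: (real^'n) measure). ennreal (g (hyp_vol TYPE('n) (norm x)))
        \<le> ennreal ((h (hyp_vol TYPE('n) (norm x)) * hyp_perimeter TYPE('n) (norm x)) powr p)"
      using AE_hypV_neq_0 AE_space
    proof eventually_elim
      case (elim x)
      define r where "r = norm x"
      define v where "v = hyp_vol TYPE('n) r"
      have r: "0 < r" "r < 1" using elim by (auto simp: r_def)
      have pos: "v > 0" "n - 1 > 0" using hyp_vol_pos[OF r] dim by (auto simp: v_def n_def)
      have "g v = h v powr p * (euc_perimeter TYPE('n) v powr p + ((n - 1) * v) powr p)"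
        using h pos euc_perimeter_nonneg[of v, where 'n='n] by (simp add: g_def powr_mult distrib_left)
      also have "\<dots> \<le> h v powr p * hyp_perimeter TYPE('n) r powr p"
        unfolding n_def v_def by
            (intro mult_left_mono euc_perimeter_powr_add_le_hyp_perimeter[OF exponent r]) simp
      also have "\<dots> = (h v * hyp_perimeter TYPE('n) r) powr p"
        using h hyp_perimeter_pos[OF r, where 'n='n] by (simp add: powr_mult)
      finally show ?case by (simp add: v_def r_def ennreal_leI)
    qed
  qed
  finally show ?thesis by (simp add: n_def)
qed

lemma energy_comparison:
  fixes u :: "real^'n::finite \<Rightarrow> real"
  assumes dim: "CARD('n) \<ge> 2" and p: "p > 1"
    and exponent: "(CARD('n) = 2 \<and> p \<ge> 2) \<or> (CARD('n) \<ge> 3 \<and> p \<ge> 2 * real CARD('n) / (real CARD('n) - 1))"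
    and u: "rearrangeable u" and h: "decay_density (decr_rearr u) h"
  shows "(\<integral>\<^sup>+x. ennreal (norm (euc_rearr_grad h (x::real^'n)) powr p) \<partial>lebesgue)
      + ennreal (((real CARD('n) - 1) / p) powr p) * (\<integral>\<^sup>+x. ennreal (\<bar>hyp_sym_rearr u x\<bar> powr p) \<partial>hypV)
    \<le> hyp_energy p (hyp_rearr_grad h :: real^'n \<Rightarrow> real^'n)"
proof -
  note h_borel [measurable] = decay_density_borel_measurable[OF h] and h_nonneg = decay_density_nonneg[OF h]
  let ?S = "\<integral>\<^sup>+s. ennreal ((s * h s) powr p) * indicator {0<..} s \<partial>lborel"
  define n where "n = real CARD('n)"
  have n: "n > 1" using dim by (simp add: n_def)
  have "ennreal (((n - 1) / p) powr p) * (\<integral>\<^sup>+x. ennreal (\<bar>hyp_sym_rearr u x\<bar> powr p) \<partial>hypV)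
      = ennreal (((n - 1) / p) powr p)
        * (\<integral>\<^sup>+s. ennreal (decr_rearr u s powr p) * indicator {0<..} s \<partial>lborel)"
    by (simp only: nn_integral_hyp_sym_rearr_powr[OF dim u])
  also have "\<dots> \<le> ennreal (((n - 1) / p) powr p) * (ennreal (p powr p) * ?S)"
    by (intro mult_left_mono Hardy_inequality_tail[OF p decr_rearr_borel_measurable[OF u] h_borel h_nonneg]
        decr_rearr_nonneg[OF u] decr_rearr_le_nn_integral_tail[OF u h]) auto
  also have "\<dots> = ennreal ((n - 1) powr p) * ?S"
  proof -
    have "((n - 1) / p) powr p * p powr p = (n - 1) powr p" using p n by (simp add: powr_divide)
    thus ?thesis by (simp flip: ennreal_mult' mult.assoc)
  qed
  finally have "(\<integral>\<^sup>+x. ennreal (norm (euc_rearr_grad h (x::real^'n)) powr p) \<partial>lebesgue)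
      + ennreal (((n - 1) / p) powr p) * (\<integral>\<^sup>+x. ennreal (\<bar>hyp_sym_rearr u x\<bar> powr p) \<partial>hypV)
    \<le> (\<integral>\<^sup>+s. ennreal ((h s * euc_perimeter TYPE('n) s) powr p) * indicator {0<..} s \<partial>lborel)
      + ennreal ((n - 1) powr p) * ?S"
    unfolding nn_integral_euc_rearr_grad_powr[OF h_borel h_nonneg] by (rule add_left_mono)
  also have "\<dots> \<le> hyp_energy p (hyp_rearr_grad h :: real^'n \<Rightarrow> real^'n)"
    unfolding n_def by (rule nn_integral_perimeter_comparison[OF dim exponent h_borel h_nonneg])
  finally show ?thesis by (simp only: n_def)
qed

lemma integral_le_if_nn_integral_le:
  fixes a b :: "'a \<Rightarrow> real" and c :: "'b \<Rightarrow> real"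
  assumes [measurable]: "a \<in> borel_measurable M" "b \<in> borel_measurable M" "c \<in> borel_measurable N"
    and nonneg: "\<And>x. a x \<ge> 0" "\<And>x. b x \<ge> 0" "\<And>y. c y \<ge> 0" and K: "K > 0"
    and comparison:
      "(\<integral>\<^sup>+y. ennreal (c y) \<partial>N) + ennreal K * (\<integral>\<^sup>+x. ennreal (b x) \<partial>M) \<le> (\<integral>\<^sup>+x. ennreal (a x) \<partial>M)"
    and finite: "(\<integral>\<^sup>+x. ennreal (a x) \<partial>M) < \<infinity>"
  shows "integrable M a" "integrable M b" "integrable N c" "(\<integral>x. a x \<partial>M) - K * (\<integral>x. b x \<partial>M) \<ge> (\<integral>y. c y \<partial>N)"
proof -
  have finite_sum: "(\<integral>\<^sup>+y. ennreal (c y) \<partial>N) + ennreal K * (\<integral>\<^sup>+x. ennreal (b x) \<partial>M) < \<infinity>"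
    using comparison finite by (rule le_less_trans)
  hence "(\<integral>\<^sup>+y. ennreal (c y) \<partial>N) < \<infinity>" "(\<integral>\<^sup>+x. ennreal (b x) \<partial>M) < \<infinity>"
    using K by (auto simp: ennreal_add_less_top ennreal_mult_less_top)
  thus integrable: "integrable M a" "integrable M b" "integrable N c"
    using finite nonneg by (auto intro!: integrableI_nonneg)
  have "ennreal (\<integral>y. c y \<partial>N) + ennreal K * ennreal (\<integral>x. b x \<partial>M) \<le> ennreal (\<integral>x. a x \<partial>M)"
    using comparison by (simp add: nn_integral_eq_integral integrable nonneg)
  hence "(\<integral>y. c y \<partial>N) + K * (\<integral>x. b x \<partial>M) \<le> (\<integral>x. a x \<partial>M)"
    using K by (simp add: ennreal_le_iff nonneg flip: ennreal_mult' ennreal_plus)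
  thus "(\<integral>x. a x \<partial>M) - K * (\<integral>x. b x \<partial>M) \<ge> (\<integral>y. c y \<partial>N)" by simp
qed

lemma integral_energy_comparison:
  fixes u :: "real^'n::finite \<Rightarrow> real"
  assumes dim: "CARD('n) \<ge> 2" and p: "p > 1"
    and exponent: "(CARD('n) = 2 \<and> p \<ge> 2) \<or> (CARD('n) \<ge> 3 \<and> p \<ge> 2 * real CARD('n) / (real CARD('n) - 1))"
    and u: "rearrangeable u" and h: "decay_density (decr_rearr u) h"
    and Lp: "(\<integral>\<^sup>+s. ennreal ((h s * iso_profile CARD('n) s) powr p) * indicator {0<..} s \<partial>lborel) < \<infinity>"
  shows "integrable hypV (\<lambda>x::real^'n. hyp_norm x (hyp_rearr_grad h x) powr p)"
    and "integrable hypV (\<lambda>x. \<bar>hyp_sym_rearr u x\<bar> powr p)"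
    and "integrable lebesgue (\<lambda>x::real^'n. norm (euc_rearr_grad h x) powr p)"
    and "(\<integral>x. hyp_norm x (hyp_rearr_grad h (x::real^'n)) powr p \<partial>hypV)
        - ((real CARD('n) - 1) / p) powr p * (\<integral>x. \<bar>hyp_sym_rearr u x\<bar> powr p \<partial>hypV)
      \<ge> (\<integral>x. norm (euc_rearr_grad h (x::real^'n)) powr p \<partial>lebesgue)"
proof -
  note [measurable] = decay_density_borel_measurable[OF h] hyp_sym_rearr_borel_measurable[OF u]
  have [measurable]: "hyp_rearr_grad h \<in> borel_measurable (hypV :: (real^'n) measure)"
    by (rule borel_measurable_hypV) measurable
  have energy_densities:
      "(\<lambda>x::real^'n. hyp_norm x (hyp_rearr_grad h x) powr p) \<in> borel_measurable hypV"
      "(\<lambda>x. \<bar>hyp_sym_rearr u x\<bar> powr p) \<in> borel_measurable hypV"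
      "(\<lambda>x::real^'n. norm (euc_rearr_grad h x) powr p) \<in> borel_measurable lebesgue"
    by (measurable, rule measurable_completion, measurable)
  have factor: "((real CARD('n) - 1) / p) powr p > 0" using dim p by simp
  have finite: "hyp_energy p (hyp_rearr_grad h :: real^'n \<Rightarrow> real^'n) < \<infinity>"
    using hyp_energy_hyp_rearr_grad_finite[OF dim _ _ decay_density_nonneg[OF h] Lp] p by simp
  note energies = integral_le_if_nn_integral_le[OF energy_densities powr_ge_zero powr_ge_zero powr_ge_zero factor
      energy_comparison[OF dim p exponent u h, unfolded hyp_energy_def] finite[unfolded hyp_energy_def]]
  show "integrable hypV (\<lambda>x::real^'n. hyp_norm x (hyp_rearr_grad h x) powr p)"
    "integrable hypV (\<lambda>x. \<bar>hyp_sym_rearr u x\<bar> powr p)"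
    "integrable lebesgue (\<lambda>x::real^'n. norm (euc_rearr_grad h x) powr p)"
    "(\<integral>x. hyp_norm x (hyp_rearr_grad h (x::real^'n)) powr p \<partial>hypV)
        - ((real CARD('n) - 1) / p) powr p * (\<integral>x. \<bar>hyp_sym_rearr u x\<bar> powr p \<partial>hypV)
      \<ge> (\<integral>x. norm (euc_rearr_grad h (x::real^'n)) powr p \<partial>lebesgue)"
    by (fact energies)+
qed

theorem theorem2p2:
  fixes u :: "real^'n::finite \<Rightarrow> real" and p :: real
  assumes n2: "CARD('n) \<ge> 2"
    and hp: "(CARD('n) = 2 \<and> p \<ge> 2) \<or>
             (CARD('n) \<ge> 3 \<and> p \<ge> 2 * real CARD('n) / (real CARD('n) - 1))"
    and hu: "u \<in> W1p_hyp p"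
  shows "\<exists>Gg Ge.
           weak_grad (ball 0 1) (hyp_sym_rearr u) Gg \<and>
           weak_grad UNIV (euc_sym_rearr u) Ge \<and>
           integrable hypV (\<lambda>x. hyp_norm x (Gg x) powr p) \<and>
           integrable hypV (\<lambda>x. \<bar>hyp_sym_rearr u x\<bar> powr p) \<and>
           integrable lebesgue (\<lambda>x. norm (Ge x) powr p) \<and>
           (\<integral>x. hyp_norm x (Gg x) powr p \<partial>hypV)
             - ((real CARD('n) - 1) / p) powr p * (\<integral>x. \<bar>hyp_sym_rearr u x\<bar> powr p \<partial>hypV)
           \<ge> (\<integral>x. norm (Ge x) powr p \<partial>lebesgue)"
proof -
  have p: "p > 1"
  proof -
    have "2 * real CARD('n) / (real CARD('n) - 1) > 1" using n2 by (simp add: less_divide_eq)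
    thus ?thesis using hp by linarith
  qed
  have u: "rearrangeable u" using W1p_hyp_rearrangeable[OF hu] p by simp
  obtain h where h: "decay_density (decr_rearr u) h"
    and Lp: "(\<integral>\<^sup>+s. ennreal ((h s * iso_profile CARD('n) s) powr p) * indicator {0<..} s \<partial>lborel) < \<infinity>"
    using W1p_hyp_decay_density[OF n2 p hu] .
  have "weak_grad (ball 0 1) (hyp_sym_rearr u) (hyp_rearr_grad h)"
    using weak_grad_hyp_sym_rearr[OF h _ Lp] p by simp
  moreover have "weak_grad UNIV (euc_sym_rearr u) (euc_rearr_grad h)"
    using weak_grad_euc_sym_rearr[OF h _ Lp] p by simp
  ultimately show ?thesis
    using integral_energy_comparison[OF n2 p hp u h Lp] by blast
qed

end
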